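(* Let $\mathfrak g$ be a complex semisimple Lie algebra and let $H\in\mathcal S^k(\mathfrak g)^{\mathfrak g}$. Suppose that $\mathsf m_{2r+1}(H)$ is a symmetric invariant, i.e. $\mathsf m_{2r+1}(H)\in\mathcal S^{k-2r}(\mathfrak g)$, for each $r\ge1$ (with $2r+1\le k$). Then $$S=\varpi(H[-1])+\sum_{1\le r<(k-1)/2}\binom{k}{2r}\,\varpi\bigl(\tau^{2r}\,\mathsf m_{2r+1}(H)[-1]\bigr)\cdot1$$ is a Segal--Sugawara vector associated with $H$, i.e. $S\in\mathfrak z(\widehat{\mathfrak g})$ (and $H[-1]$ is its leading term).
   Context: Put $\widehat{\mathfrak g}^-=t^{-1}\mathfrak g[t^{-1}]$ and $x[a]=xt^a$. The symmetrisation map $\varpi:\mathcal S(\mathfrak q)\to\mathcal U(\mathfrak q)$ is $\varpi(y_1\cdots y_m)=\frac1{m!}\sum_{\sigma\in S_m}y_{\sigma(1)}\cdots y_{\sigma(m)}$; the analogous map $\mathcal S^m(\mathfrak q)\to\mathfrak q^{\otimes m}$ is also denoted $\varpi$. For $F\in\mathcal S(\mathfrak g)$, $F[-1]\in\mathcal S(\mathfrak gt^{-1})$ is its image under $x\mapsto x[-1]$. The Feigin--Frenkel centre $\mathfrak z(\widehat{\mathfrak g})\subset\mathcal U(\widehat{\mathfrak g}^-)$ is the centre of the universal affine vertex algebra at the critical level (the space of $\mathfrak g[t]$-invariant vectors in the vacuum module at the critical level, identified as a vector space with $\mathcal U(\widehat{\mathfrak g}^-)$). By a theorem of Rybnikov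 it equals the centraliser in $\mathcal U(\widehat{\mathfrak g}^-)$ of $\mathcal H[-1]=\sum_i x_i[-1]x_i[-1]$, where $\{x_i\}$ is an orthonormal basis of $\mathfrak g$ for a fixed non-degenerate $\mathfrak g$-invariant scalar product, chosen so that $\sum_i\operatorname{ad}(x_i)^2$ acts on $\mathfrak g$ as a scalar. Maps $\mathsf m_{2r+1}$: embed $\mathcal S^k(\mathfrak g)$ in $\mathfrak g^{\otimes k}$ via $\varpi$. For $2r+1\le k$, $\mathsf m_{2r+1}$ is the restriction to $\mathcal S^k(\mathfrak g)$ of the map $\mathfrak g^{\otimes k}\to\mathfrak{gl}(\mathfrak g)\otimes\mathfrak g^{\otimes(k-2r-1)}$, $y_1\otimes\dots\otimes y_k\mapsto\operatorname{ad}(y_1)\cdots\operatorname{ad}(y_{2r+1})\otimes y_{2r+2}\otimes\dots\otimes y_k$. The image lies in $\mathfrak{so}(\mathfrak g)\otimes\mathfrak g^{\otimes(k-2r-1)}\cong\Lambda^2\mathfrak g\otimes\mathfrak g^{\otimes(k-2r-1)}$. One regards $\mathfrak g\subset\mathfrak{so}(\mathfrak g)$ via $\operatorname{ad}$ and $\mathcal S^{k-2r}(\mathfrak g)\subset\mathfrak g^{\otimes(k-2r)}=\mathfrak g\otimes\mathfrak g^{\otimes(k-2r-1)}\subset\mathfrak{so}(\mathfrak g)\otimes\mathfrak g^{\otimes(k-2r-1)}$ via $\varpi$; "$\mathsf m_{2r+1}(H)\in\mathcal S^{k-2r}(\mathfrak g)$" is meant in this sense. Notation $\varpi(\tau^rF[-1])\cdot1$: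 let $\tau=-\partial_t$, so that $\tau x[a]-x[a]\tau=\tau(x[a])=-a\,x[a-1]$ in the algebra generated by $\mathcal U(\widehat{\mathfrak g}^-)$ and $\tau$. For $F=y_1\cdots y_m$, $\varpi(\tau^rF[-1])$ is the average over all $(m+r)!$ orderings of the product of the $m+r$ factors $\tau,\dots,\tau$ ($r$ times), $y_1[-1],\dots,y_m[-1]$; then $\varpi(\tau^rF[-1])\cdot1\in\mathcal U(\widehat{\mathfrak g}^-)$ is obtained by moving all $\tau$'s to the right and setting $\tau\cdot1=0$. Extend to all $F$ by linearity. *)

theory Defs
  imports Complex_Main "HOL-Library.Poly_Mapping" "HOL-Combinatorics.Permutations"
begin

section \<open>Complex vector spaces and algebras\<close>

class complex_vector = ab_group_add +
  fixes scaleC :: "complex \<Rightarrow> 'a \<Rightarrow> 'a"  (infixr "*\<^sub>C" 75)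
  assumes scaleC_add_right: "c *\<^sub>C (x + y) = c *\<^sub>C x + c *\<^sub>C y"
    and scaleC_add_left: "(c + d) *\<^sub>C x = c *\<^sub>C x + d *\<^sub>C x"
    and scaleC_scaleC: "c *\<^sub>C d *\<^sub>C x = (c * d) *\<^sub>C x"
    and scaleC_one: "1 *\<^sub>C x = x"

global_interpretation complex_vector: vector_space "scaleC :: complex \<Rightarrow> 'a \<Rightarrow> 'a::complex_vector"
  by unfold_locales (simp_all add: scaleC_add_right scaleC_add_left scaleC_scaleC scaleC_one)

abbreviation clinear :: "('a::complex_vector \<Rightarrow> 'b::complex_vector) \<Rightarrow> bool"
  where "clinear \<equiv> Vector_Spaces.linear scaleC scaleC"

lemma clinearI:
  fixes f :: "'a::complex_vector \<Rightarrow> 'b::complex_vector"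
  assumes "\<And>x y. f (x + y) = f x + f y" "\<And>c x. f (c *\<^sub>C x) = c *\<^sub>C f x"
  shows "clinear f"
  by (intro Vector_Spaces.linear_iff[THEN iffD2] conjI allI assms
        complex_vector.vector_space_axioms)

lemma clinear_add: "clinear f \<Longrightarrow> f (x + y) = f x + f y"
  by (simp add: Vector_Spaces.linear_iff)

lemma clinear_scale: "clinear f \<Longrightarrow> f (c *\<^sub>C x) = c *\<^sub>C f x"
  by (simp add: Vector_Spaces.linear_iff)

class complex_algebra_1 = complex_vector + ring_1 +
  assumes scaleC_mult_left: "(c *\<^sub>C x) * y = c *\<^sub>C (x * y)"
    and scaleC_mult_right: "x * (c *\<^sub>C y) = c *\<^sub>C (x * y)"

instantiation complex :: complex_algebra_1
begin
definition scaleC_complex :: "complex \<Rightarrow> complex \<Rightarrow> complex"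
  where "scaleC_complex c z = c * z"
instance by standard (simp_all add: scaleC_complex_def algebra_simps)
end

instantiation poly_mapping :: (type, complex_vector) complex_vector
begin
definition scaleC_poly_mapping :: "complex \<Rightarrow> ('a \<Rightarrow>\<^sub>0 'b) \<Rightarrow> 'a \<Rightarrow>\<^sub>0 'b"
  where "scaleC_poly_mapping c p = Poly_Mapping.map (\<lambda>v. c *\<^sub>C v) p"
lemma lookup_scaleC: "Poly_Mapping.lookup (c *\<^sub>C p) k = c *\<^sub>C Poly_Mapping.lookup p k" for p :: "'a \<Rightarrow>\<^sub>0 'b"
  by (simp add: scaleC_poly_mapping_def map.rep_eq when_def)
instance
  by standard (simp_all add: poly_mapping_eq_iff fun_eq_iff lookup_scaleC lookup_add
      scaleC_add_right scaleC_add_left scaleC_scaleC scaleC_one)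
end

lemma scaleC_single: "c *\<^sub>C Poly_Mapping.single k v = Poly_Mapping.single k (c *\<^sub>C v)"
  by (simp add: poly_mapping_eq_iff fun_eq_iff lookup_scaleC lookup_single when_def)

lemma poly_mapping_sum_single:
  "p = (\<Sum>k\<in>Poly_Mapping.keys p. Poly_Mapping.single k (Poly_Mapping.lookup p k))"
  by (simp add: poly_mapping_eq_iff fun_eq_iff lookup_sum lookup_single when_def in_keys_iff)

lemma poly_mapping_single_induct [case_names zero add]:
  fixes p :: "'k \<Rightarrow>\<^sub>0 'v::comm_monoid_add"
  assumes "P 0" "\<And>k v p. P p \<Longrightarrow> P (Poly_Mapping.single k v + p)"
  shows "P p"
proof -
  have "P (\<Sum>k\<in>A. Poly_Mapping.single k (Poly_Mapping.lookup p k))" if "finite A" for A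
    using that by (induction A) (auto intro: assms)
  then show ?thesis by (metis poly_mapping_sum_single finite_keys)
qed

instance poly_mapping :: (monoid_add, complex_algebra_1) complex_algebra_1
proof
  fix c :: complex and p q :: "'a \<Rightarrow>\<^sub>0 'b"
  have l: "(c *\<^sub>C p) * Poly_Mapping.single k v = c *\<^sub>C (p * Poly_Mapping.single k v)" for k v
    by (induction p rule: poly_mapping_single_induct)
      (simp_all add: scaleC_add_right distrib_right scaleC_single mult_single scaleC_mult_left)
  show "(c *\<^sub>C p) * q = c *\<^sub>C (p * q)"
    by (induction q rule: poly_mapping_single_induct) (simp_all add: l scaleC_add_right distrib_left)
  have r: "Poly_Mapping.single k v * (c *\<^sub>C q) = c *\<^sub>C (Poly_Mapping.single k v * q)" for k v
    by (induction q rule: poly_mapping_single_induct)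
      (simp_all add: scaleC_add_right distrib_left scaleC_single mult_single scaleC_mult_right)
  show "p * (c *\<^sub>C q) = c *\<^sub>C (p * q)"
    by (induction p rule: poly_mapping_single_induct) (simp_all add: r scaleC_add_right distrib_right)
qed

definition lin_ext :: "('b \<Rightarrow> 'v::complex_vector) \<Rightarrow> ('b \<Rightarrow>\<^sub>0 complex) \<Rightarrow> 'v"
  where "lin_ext f p = (\<Sum>b\<in>Poly_Mapping.keys p. Poly_Mapping.lookup p b *\<^sub>C f b)"

lemma lin_ext_superset:
  "finite A \<Longrightarrow> Poly_Mapping.keys p \<subseteq> A \<Longrightarrow> lin_ext f p = (\<Sum>b\<in>A. Poly_Mapping.lookup p b *\<^sub>C f b)"
  unfolding lin_ext_def by (rule sum.mono_neutral_left) (auto simp: in_keys_iff)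

lemma lin_ext_add: "lin_ext f (p + q) = lin_ext f p + lin_ext f q"
proof -
  let ?A = "Poly_Mapping.keys p \<union> Poly_Mapping.keys q"
  have "Poly_Mapping.keys (p + q) \<subseteq> ?A" by (rule Poly_Mapping.keys_add)
  then show ?thesis
    by (simp add: lin_ext_superset[of ?A] lookup_add scaleC_add_left sum.distrib)
qed

lemma lin_ext_scaleC: "lin_ext f (c *\<^sub>C p) = c *\<^sub>C lin_ext f p"
proof -
  have "Poly_Mapping.keys (c *\<^sub>C p) \<subseteq> Poly_Mapping.keys p" by (auto simp: in_keys_iff lookup_scaleC)
  then show ?thesis
    by (simp add: lin_ext_superset[of "Poly_Mapping.keys p"] lookup_scaleC scaleC_complex_def
        complex_vector.scale_sum_right scaleC_scaleC)
qed

lemma clinear_lin_ext: "clinear (lin_ext f)"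
  by (intro clinearI lin_ext_add lin_ext_scaleC)

lemma lin_ext_single [simp]: "lin_ext f (Poly_Mapping.single b c) = c *\<^sub>C f b"
  by (simp add: lin_ext_def)

lemma lin_ext_zero [simp]: "lin_ext f 0 = 0"
  by (simp add: lin_ext_def)

lemma lin_ext_diff: "lin_ext f (p - q) = lin_ext f p - lin_ext f q"
  using lin_ext_add[of f "p - q" q] by (simp add: algebra_simps)

section \<open>Ideals\<close>

inductive_set two_sided_ideal :: "'r::ring_1 set \<Rightarrow> 'r set" for R where
  zero: "0 \<in> two_sided_ideal R"
| add: "r \<in> R \<Longrightarrow> s \<in> two_sided_ideal R \<Longrightarrow> a * r * b + s \<in> two_sided_ideal R"

inductive_set left_ideal :: "'r::ring_1 set \<Rightarrow> 'r set" for R where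
  zero: "0 \<in> left_ideal R"
| add: "r \<in> R \<Longrightarrow> s \<in> left_ideal R \<Longrightarrow> a * r + s \<in> left_ideal R"

lemma two_sided_ideal_gen: "r \<in> R \<Longrightarrow> r \<in> two_sided_ideal R"
  using two_sided_ideal.add[OF _ two_sided_ideal.zero, of r R 1 1] by simp

lemma two_sided_ideal_plus:
  "x \<in> two_sided_ideal R \<Longrightarrow> y \<in> two_sided_ideal R \<Longrightarrow> x + y \<in> two_sided_ideal R"
  by (induction rule: two_sided_ideal.induct) (auto simp: add.assoc intro: two_sided_ideal.intros)

lemma two_sided_ideal_mult:
  assumes "x \<in> two_sided_ideal R" shows "a * x * b \<in> two_sided_ideal R"
  using assms
proof induction
  case (add r s c d)
  have "a * (c * r * d + s) * b = (a * c) * r * (d * b) + a * s * b"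
    by (simp add: algebra_simps)
  with add show ?case by (metis two_sided_ideal.add)
qed (simp add: two_sided_ideal.zero)

lemma two_sided_ideal_lmult: "x \<in> two_sided_ideal R \<Longrightarrow> a * x \<in> two_sided_ideal R"
  using two_sided_ideal_mult[of x R a 1] by simp

lemma two_sided_ideal_rmult: "x \<in> two_sided_ideal R \<Longrightarrow> x * a \<in> two_sided_ideal R"
  using two_sided_ideal_mult[of x R 1 a] by simp

lemma two_sided_ideal_minus: "x \<in> two_sided_ideal R \<Longrightarrow> - x \<in> two_sided_ideal R"
  using two_sided_ideal_lmult[of x R "- 1"] by simp

definition ideal_cong :: "'r::ring_1 set \<Rightarrow> 'r \<Rightarrow> 'r \<Rightarrow> bool"
  where "ideal_cong R x y \<longleftrightarrow> x - y \<in> two_sided_ideal R"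

lemma equivp_ideal_cong: "equivp (ideal_cong R)"
proof (rule equivpI)
  show "reflp (ideal_cong R)" by (auto simp: reflp_def ideal_cong_def two_sided_ideal.zero)
  show "symp (ideal_cong R)"
    by (auto simp: symp_def ideal_cong_def dest: two_sided_ideal_minus)
  show "transp (ideal_cong R)"
    unfolding transp_def ideal_cong_def using two_sided_ideal_plus by fastforce
qed

lemma ideal_cong_add: "ideal_cong R x x' \<Longrightarrow> ideal_cong R y y' \<Longrightarrow> ideal_cong R (x + y) (x' + y')"
  unfolding ideal_cong_def using two_sided_ideal_plus[of "x - x'" R "y - y'"]
  by (simp add: algebra_simps)

lemma ideal_cong_uminus: "ideal_cong R x x' \<Longrightarrow> ideal_cong R (- x) (- x')"
  unfolding ideal_cong_def using two_sided_ideal_minus[of "x - x'" R] by simp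

lemma ideal_cong_diff: "ideal_cong R x x' \<Longrightarrow> ideal_cong R y y' \<Longrightarrow> ideal_cong R (x - y) (x' - y')"
  using ideal_cong_add[OF _ ideal_cong_uminus, of R x x' y y'] by simp

lemma ideal_cong_mult: "ideal_cong R x x' \<Longrightarrow> ideal_cong R y y' \<Longrightarrow> ideal_cong R (x * y) (x' * y')"
  unfolding ideal_cong_def
  using two_sided_ideal_plus[OF two_sided_ideal_rmult[of "x - x'" R y]
      two_sided_ideal_lmult[of "y - y'" R x']]
  by (simp add: algebra_simps)

lemma ideal_cong_scaleC:
  "ideal_cong R x x' \<Longrightarrow> ideal_cong R (c *\<^sub>C x) (c *\<^sub>C x')" for x :: "'r::complex_algebra_1"
  unfolding ideal_cong_def using two_sided_ideal_lmult[of "x - x'" R "c *\<^sub>C 1"]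
  by (simp add: scaleC_mult_left complex_vector.scale_right_diff_distrib)

section \<open>The tensor algebra\<close>

datatype 'a free_monoid = Word (letters: "'a list")

instantiation free_monoid :: (type) monoid_add
begin
definition zero_free_monoid :: "'a free_monoid" where "0 = Word []"
definition plus_free_monoid :: "'a free_monoid \<Rightarrow> 'a free_monoid \<Rightarrow> 'a free_monoid"
  where "v + w = Word (letters v @ letters w)"
instance by standard (simp_all add: zero_free_monoid_def plus_free_monoid_def)
end

type_synonym 'a free_algebra = "'a free_monoid \<Rightarrow>\<^sub>0 complex"

definition word :: "'a list \<Rightarrow> 'a free_algebra"
  where "word xs = Poly_Mapping.single (Word xs) 1"

lemma word_mult [simp]: "word xs * word ys = word (xs @ ys)"
  by (simp add: word_def mult_single plus_free_monoid_def)

lemma word_Nil: "word [] = 1"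
  by (simp add: word_def flip: zero_free_monoid_def)

definition linearity_relations :: "'v::complex_vector free_algebra set"
  where "linearity_relations =
    {word [x + y] - word [x] - word [y] | x y. True} \<union> {word [c *\<^sub>C x] - c *\<^sub>C word [x] | c x. True}"

quotient_type (overloaded) 'v tensor_algebra = "'v::complex_vector free_algebra" / "ideal_cong linearity_relations"
  by (rule equivp_ideal_cong)

definition multilinear :: "('v::complex_vector list \<Rightarrow> 'w::complex_vector) \<Rightarrow> bool"
  where "multilinear f \<longleftrightarrow> (\<forall>u v. clinear (\<lambda>x. f (u @ [x] @ v)))"

lemma lin_ext_two_sided_ideal:
  assumes "\<And>u v r. r \<in> R \<Longrightarrow> lin_ext f (word u * r * word v) = 0" "p \<in> two_sided_ideal R"
  shows "lin_ext f p = 0"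
proof -
  have *: "Poly_Mapping.single w c = c *\<^sub>C word (letters w)" for w :: "'a free_monoid" and c
    by (simp add: word_def scaleC_single scaleC_complex_def)
  have 1: "lin_ext f (word u * r * b) = 0" if "r \<in> R" for u r b
    by (induction b rule: poly_mapping_single_induct)
      (simp_all add: * distrib_left lin_ext_add scaleC_mult_right lin_ext_scaleC assms(1) that)
  have 2: "lin_ext f (a * r * b) = 0" if "r \<in> R" for a r b
    by (induction a rule: poly_mapping_single_induct)
      (simp_all add: * distrib_right lin_ext_add scaleC_mult_left lin_ext_scaleC 1 that)
  from assms(2) show ?thesis by induction (simp_all add: lin_ext_add 2)
qed

lemma lin_ext_multilinear_cong:
  assumes "multilinear f" "ideal_cong linearity_relations p q"
  shows "lin_ext (\<lambda>w. f (letters w)) p = lin_ext (\<lambda>w. f (letters w)) q"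
proof -
  let ?F = "lin_ext (\<lambda>w. f (letters w))"
  have w: "?F (word xs) = f xs" for xs by (simp add: word_def scaleC_one)
  have m: "clinear (\<lambda>x. f (u @ x # v))" for u v
    using assms(1) by (simp add: multilinear_def)
  have "?F (p - q) = 0"
  proof (rule lin_ext_two_sided_ideal)
    show "p - q \<in> two_sided_ideal linearity_relations"
      using assms(2) by (simp add: ideal_cong_def)
    show "?F (word u * r * word v) = 0" if "r \<in> linearity_relations" for u v r
      using that clinear_add[OF m] clinear_scale[OF m] unfolding linearity_relations_def
      by (auto simp: right_diff_distrib left_diff_distrib distrib_left distrib_right
          scaleC_mult_left scaleC_mult_right lin_ext_diff lin_ext_add lin_ext_scaleC w)
  qed
  then show ?thesis by (simp add: lin_ext_diff)
qed

lemma multilinear_augmentation: "multilinear (\<lambda>xs. if xs = [] then 1 else (0::complex))"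
  unfolding multilinear_def by (auto intro!: clinearI)

instantiation tensor_algebra :: (complex_vector) complex_algebra_1
begin
lift_definition zero_tensor_algebra :: "'a tensor_algebra" is 0 .
lift_definition one_tensor_algebra :: "'a tensor_algebra" is 1 .
lift_definition plus_tensor_algebra :: "'a tensor_algebra \<Rightarrow> 'a tensor_algebra \<Rightarrow> 'a tensor_algebra"
  is "(+)" by (rule ideal_cong_add)
lift_definition uminus_tensor_algebra :: "'a tensor_algebra \<Rightarrow> 'a tensor_algebra"
  is uminus by (rule ideal_cong_uminus)
lift_definition minus_tensor_algebra :: "'a tensor_algebra \<Rightarrow> 'a tensor_algebra \<Rightarrow> 'a tensor_algebra"
  is "(-)" by (rule ideal_cong_diff)
lift_definition times_tensor_algebra :: "'a tensor_algebra \<Rightarrow> 'a tensor_algebra \<Rightarrow> 'a tensor_algebra"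
  is "(*)" by (rule ideal_cong_mult)
lift_definition scaleC_tensor_algebra :: "complex \<Rightarrow> 'a tensor_algebra \<Rightarrow> 'a tensor_algebra"
  is scaleC by (rule ideal_cong_scaleC)
instance
proof
  show "(0::'a tensor_algebra) \<noteq> 1"
  proof (transfer, rule notI)
    assume "ideal_cong linearity_relations (0 :: 'a free_algebra) 1"
    from lin_ext_multilinear_cong[OF multilinear_augmentation this] show False
      by (simp add: word_def scaleC_one flip: word_Nil)
  qed
qed (transfer, (simp add: algebra_simps scaleC_add_right scaleC_add_left scaleC_scaleC
        scaleC_mult_left scaleC_mult_right scaleC_one equivp_reflp[OF equivp_ideal_cong]; fail))+
end

lift_definition tensor_of :: "'v::complex_vector \<Rightarrow> 'v tensor_algebra" is "\<lambda>x. word [x]" .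

definition tensor_power :: "nat \<Rightarrow> 'v::complex_vector tensor_algebra set"
  where "tensor_power k = complex_vector.span {prod_list (map tensor_of xs) | xs. length xs = k}"

(* The linear map on T(V) with y_1 \<otimes> ... \<otimes> y_k \<mapsto> f [y_1, ..., y_k]; only meaningful for
   multilinear f, see tensor_ext_prod_list and clinear_tensor_ext. *)
definition tensor_ext ::
    "('v::complex_vector list \<Rightarrow> 'w::complex_vector) \<Rightarrow> 'v tensor_algebra \<Rightarrow> 'w"
  where "tensor_ext f t = lin_ext (\<lambda>w. f (letters w)) (rep_tensor_algebra t)"

lemma tensor_ext_abs:
  "multilinear f \<Longrightarrow> tensor_ext f (abs_tensor_algebra p) = lin_ext (\<lambda>w. f (letters w)) p"
  unfolding tensor_ext_def
  by (erule lin_ext_multilinear_cong) (rule Quotient3_rep_abs[OF Quotient3_tensor_algebra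
        equivp_reflp[OF equivp_ideal_cong]])

lemma prod_list_tensor_of: "prod_list (map tensor_of xs) = abs_tensor_algebra (word xs)"
proof (induction xs)
  case Nil
  show ?case by (simp add: word_Nil one_tensor_algebra.abs_eq)
next
  case (Cons x xs)
  then show ?case by (simp add: tensor_of.abs_eq times_tensor_algebra.abs_eq)
qed

lemma tensor_ext_prod_list: "multilinear f \<Longrightarrow> tensor_ext f (prod_list (map tensor_of xs)) = f xs"
  by (simp add: prod_list_tensor_of tensor_ext_abs word_def scaleC_one)

lemma abs_tensor_algebra_surj: obtains p where "t = abs_tensor_algebra p"
  by (metis Quotient3_abs_rep[OF Quotient3_tensor_algebra])

lemma clinear_tensor_ext:
  assumes "multilinear f" shows "clinear (tensor_ext f)"
proof (rule clinearI)
  fix x y :: "'a tensor_algebra" and c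
  obtain p where p: "x = abs_tensor_algebra p" by (rule abs_tensor_algebra_surj)
  obtain q where q: "y = abs_tensor_algebra q" by (rule abs_tensor_algebra_surj)
  show "tensor_ext f (x + y) = tensor_ext f x + tensor_ext f y"
    by (simp add: p q plus_tensor_algebra.abs_eq tensor_ext_abs assms lin_ext_add)
  show "tensor_ext f (c *\<^sub>C x) = c *\<^sub>C tensor_ext f x"
    by (simp add: p scaleC_tensor_algebra.abs_eq tensor_ext_abs assms lin_ext_scaleC)
qed

lemma tensor_algebra_induct [case_names zero add]:
  assumes "P 0" "\<And>c xs t. P t \<Longrightarrow> P (c *\<^sub>C prod_list (map tensor_of xs) + t)"
  shows "P t"
proof -
  have "P (abs_tensor_algebra p)" for p
  proof (induction p rule: poly_mapping_single_induct)
    case zero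
    show ?case using assms(1) by (simp add: zero_tensor_algebra.abs_eq)
  next
    case (add k v p)
    have "Poly_Mapping.single k v = v *\<^sub>C word (letters k)"
      by (simp add: word_def scaleC_single scaleC_complex_def)
    then show ?case
      using assms(2)[OF add, of v "letters k"]
      by (simp add: prod_list_tensor_of plus_tensor_algebra.abs_eq scaleC_tensor_algebra.abs_eq)
  qed
  then show ?thesis by (metis abs_tensor_algebra_surj)
qed

lemma tensor_of_add: "tensor_of (x + y) = tensor_of x + tensor_of y"
  by (transfer, simp add: ideal_cong_def)
    (rule two_sided_ideal_gen, auto simp: linearity_relations_def algebra_simps)

lemma tensor_of_scaleC: "tensor_of (c *\<^sub>C x) = c *\<^sub>C tensor_of x"
  by (transfer, simp add: ideal_cong_def)
    (rule two_sided_ideal_gen, auto simp: linearity_relations_def)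

lemma tensor_ext_two_sided_ideal:
  assumes f: "multilinear f"
    and R: "\<And>u v r. r \<in> R \<Longrightarrow>
      tensor_ext f (prod_list (map tensor_of u) * r * prod_list (map tensor_of v)) = 0"
    and t: "t \<in> two_sided_ideal R"
  shows "tensor_ext f t = 0"
proof -
  note lin = clinear_add[OF clinear_tensor_ext[OF f]] clinear_scale[OF clinear_tensor_ext[OF f]]
  have z: "tensor_ext f 0 = 0" using lin(2)[of 0 0] by simp
  have 1: "tensor_ext f (prod_list (map tensor_of u) * r * b) = 0" if "r \<in> R" for u r b
    by (induction b rule: tensor_algebra_induct)
      (simp_all add: distrib_left lin scaleC_mult_right R that z)
  have 2: "tensor_ext f (a * r * b) = 0" if "r \<in> R" for a r b
    by (induction a rule: tensor_algebra_induct)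
      (simp_all add: distrib_right lin scaleC_mult_left 1 that z)
  from t show ?thesis by induction (simp_all add: lin 2 z)
qed

section \<open>The symmetric algebra\<close>

definition commutators :: "'v::complex_vector tensor_algebra set"
  where "commutators = {tensor_of x * tensor_of y - tensor_of y * tensor_of x | x y. True}"

definition symmetric_multilinear :: "('v::complex_vector list \<Rightarrow> 'w::complex_vector) \<Rightarrow> bool"
  where "symmetric_multilinear f \<longleftrightarrow>
    multilinear f \<and> (\<forall>xs ys. mset xs = mset ys \<longrightarrow> f xs = f ys)"

lemma symmetric_multilinearD: "symmetric_multilinear f \<Longrightarrow> multilinear f"
  unfolding symmetric_multilinear_def by (rule conjunct1)

lemma tensor_ext_sym_cong:
  assumes "symmetric_multilinear f" "ideal_cong commutators s t"
  shows "tensor_ext f s = tensor_ext f t"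
proof -
  from assms(1) have f: "multilinear f" and s: "\<forall>xs ys. mset xs = mset ys \<longrightarrow> f xs = f ys"
    unfolding symmetric_multilinear_def by (rule conjunct1, rule conjunct2)
  note lin = clinear_add[OF clinear_tensor_ext[OF f]]
  have d: "tensor_ext f (a - b) = tensor_ext f a - tensor_ext f b" for a b
    using lin[of "a - b" b] by (simp add: algebra_simps)
  have "tensor_ext f (s - t) = 0"
  proof (rule tensor_ext_two_sided_ideal[OF f])
    show "s - t \<in> two_sided_ideal commutators" using assms(2) by (simp add: ideal_cong_def)
    fix u v :: "'a list" and r :: "'a tensor_algebra" assume "r \<in> commutators"
    then obtain x y where r: "r = tensor_of x * tensor_of y - tensor_of y * tensor_of x"
      unfolding commutators_def by auto
    have e: "prod_list (map tensor_of u) * r * prod_list (map tensor_of v) =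
        prod_list (map tensor_of (u @ [x, y] @ v)) - prod_list (map tensor_of (u @ [y, x] @ v))"
      by (simp add: r algebra_simps)
    have "f (u @ [x, y] @ v) - f (u @ [y, x] @ v) = 0"
      using s[rule_format, of "u @ [x, y] @ v" "u @ [y, x] @ v"] by simp
    then show "tensor_ext f (prod_list (map tensor_of u) * r * prod_list (map tensor_of v)) = 0"
      unfolding e d tensor_ext_prod_list[OF f] .
  qed
  then show ?thesis by (simp add: d)
qed

lemma symmetric_multilinear_augmentation:
  "symmetric_multilinear (\<lambda>xs. if xs = [] then 1 else (0::complex))"
  unfolding symmetric_multilinear_def using multilinear_augmentation
  by (metis mset_zero_iff)

quotient_type (overloaded) 'v sym_algebra = "'v::complex_vector tensor_algebra" / "ideal_cong commutators"
  by (rule equivp_ideal_cong)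

instantiation sym_algebra :: (complex_vector) complex_algebra_1
begin
lift_definition zero_sym_algebra :: "'a sym_algebra" is 0 .
lift_definition one_sym_algebra :: "'a sym_algebra" is 1 .
lift_definition plus_sym_algebra :: "'a sym_algebra \<Rightarrow> 'a sym_algebra \<Rightarrow> 'a sym_algebra"
  is "(+)" by (rule ideal_cong_add)
lift_definition uminus_sym_algebra :: "'a sym_algebra \<Rightarrow> 'a sym_algebra"
  is uminus by (rule ideal_cong_uminus)
lift_definition minus_sym_algebra :: "'a sym_algebra \<Rightarrow> 'a sym_algebra \<Rightarrow> 'a sym_algebra"
  is "(-)" by (rule ideal_cong_diff)
lift_definition times_sym_algebra :: "'a sym_algebra \<Rightarrow> 'a sym_algebra \<Rightarrow> 'a sym_algebra"
  is "(*)" by (rule ideal_cong_mult)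
lift_definition scaleC_sym_algebra :: "complex \<Rightarrow> 'a sym_algebra \<Rightarrow> 'a sym_algebra"
  is scaleC by (rule ideal_cong_scaleC)
instance
proof
  show "(0::'a sym_algebra) \<noteq> 1"
  proof (transfer, rule notI)
    assume "ideal_cong commutators (0 :: 'a tensor_algebra) 1"
    from tensor_ext_sym_cong[OF symmetric_multilinear_augmentation this]
    have "tensor_ext (\<lambda>xs. if xs = [] then 1 else (0::complex)) (0 :: 'a tensor_algebra) =
        tensor_ext (\<lambda>xs. if xs = [] then 1 else 0) (prod_list (map tensor_of ([] :: 'a list)))"
      by simp
    moreover have "tensor_ext (\<lambda>xs. if xs = [] then 1 else (0::complex)) (0 :: 'a tensor_algebra) = 0"
      using clinear_scale[OF clinear_tensor_ext[OF multilinear_augmentation], of 0 0] by simp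
    ultimately show False
      unfolding tensor_ext_prod_list[OF multilinear_augmentation] by simp
  qed
qed (transfer, (simp add: algebra_simps scaleC_add_right scaleC_add_left scaleC_scaleC
        scaleC_mult_left scaleC_mult_right scaleC_one equivp_reflp[OF equivp_ideal_cong]; fail))+
end

lift_definition sym_of :: "'v::complex_vector \<Rightarrow> 'v sym_algebra" is tensor_of .

definition sym_power :: "nat \<Rightarrow> 'v::complex_vector sym_algebra set"
  where "sym_power k = complex_vector.span {prod_list (map sym_of xs) | xs. length xs = k}"

(* The linear map on S(V) with y_1 ... y_k \<mapsto> f [y_1, ..., y_k]; only meaningful for
   symmetric multilinear f. *)
definition sym_ext ::
    "('v::complex_vector list \<Rightarrow> 'w::complex_vector) \<Rightarrow> 'v sym_algebra \<Rightarrow> 'w"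
  where "sym_ext f s = tensor_ext f (rep_sym_algebra s)"

lemma sym_ext_abs:
  "symmetric_multilinear f \<Longrightarrow> sym_ext f (abs_sym_algebra t) = tensor_ext f t"
  unfolding sym_ext_def
  by (erule tensor_ext_sym_cong) (rule Quotient3_rep_abs[OF Quotient3_sym_algebra
        equivp_reflp[OF equivp_ideal_cong]])

lemma prod_list_sym_of: "prod_list (map sym_of xs) = abs_sym_algebra (prod_list (map tensor_of xs))"
  by (induction xs) (simp_all add: one_sym_algebra.abs_eq sym_of.abs_eq times_sym_algebra.abs_eq)

lemma sym_ext_prod_list: "symmetric_multilinear f \<Longrightarrow> sym_ext f (prod_list (map sym_of xs)) = f xs"
  by (simp add: prod_list_sym_of sym_ext_abs tensor_ext_prod_list symmetric_multilinearD)

lemma clinear_sym_ext: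
  assumes f: "symmetric_multilinear f" shows "clinear (sym_ext f)"
proof (rule clinearI)
  have m: "clinear (tensor_ext f)"
    using f by (intro clinear_tensor_ext symmetric_multilinearD)
  fix x y :: "'a sym_algebra" and c
  obtain p where p: "x = abs_sym_algebra p" using Quotient3_abs_rep[OF Quotient3_sym_algebra] by metis
  obtain q where q: "y = abs_sym_algebra q" using Quotient3_abs_rep[OF Quotient3_sym_algebra] by metis
  show "sym_ext f (x + y) = sym_ext f x + sym_ext f y"
    by (simp add: p q plus_sym_algebra.abs_eq sym_ext_abs f clinear_add[OF m])
  show "sym_ext f (c *\<^sub>C x) = c *\<^sub>C sym_ext f x"
    by (simp add: p scaleC_sym_algebra.abs_eq sym_ext_abs f clinear_scale[OF m])
qed

section \<open>Lie algebras and their enveloping algebras\<close>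

class complex_lie_algebra = complex_vector +
  fixes bracket :: "'a \<Rightarrow> 'a \<Rightarrow> 'a"
  assumes bracket_add_left: "bracket (x + y) z = bracket x z + bracket y z"
    and bracket_scaleC_left: "bracket (c *\<^sub>C x) y = c *\<^sub>C bracket x y"
    and bracket_add_right: "bracket x (y + z) = bracket x y + bracket x z"
    and bracket_scaleC_right: "bracket x (c *\<^sub>C y) = c *\<^sub>C bracket x y"
    and bracket_self: "bracket x x = 0"
    and jacobi: "bracket x (bracket y z) + bracket y (bracket z x) + bracket z (bracket x y) = 0"

definition env_relations :: "'l::complex_lie_algebra tensor_algebra set"
  where "env_relations =
    {tensor_of x * tensor_of y - tensor_of y * tensor_of x - tensor_of (bracket x y) | x y. True}"

definition lie_multilinear :: "('l::complex_lie_algebra list \<Rightarrow> 'w::complex_vector) \<Rightarrow> bool"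
  where "lie_multilinear f \<longleftrightarrow> multilinear f \<and>
    (\<forall>u v x y. f (u @ [x, y] @ v) - f (u @ [y, x] @ v) = f (u @ [bracket x y] @ v))"

lemma tensor_ext_env_cong:
  assumes "lie_multilinear f" "ideal_cong env_relations s t"
  shows "tensor_ext f s = tensor_ext f t"
proof -
  have f: "multilinear f"
    and lie: "f (u @ [x, y] @ v) - f (u @ [y, x] @ v) = f (u @ [bracket x y] @ v)" for u v x y
    using assms(1) by (simp_all add: lie_multilinear_def)
  note lin = clinear_add[OF clinear_tensor_ext[OF f]]
  have d: "tensor_ext f (a - b) = tensor_ext f a - tensor_ext f b" for a b
    using lin[of "a - b" b] by (simp add: algebra_simps)
  have "tensor_ext f (s - t) = 0"
  proof (rule tensor_ext_two_sided_ideal[OF f])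
    show "s - t \<in> two_sided_ideal env_relations" using assms(2) by (simp add: ideal_cong_def)
    fix u v :: "'a list" and r :: "'a tensor_algebra" assume "r \<in> env_relations"
    then obtain x y where
      r: "r = tensor_of x * tensor_of y - tensor_of y * tensor_of x - tensor_of (bracket x y)"
      unfolding env_relations_def by auto
    have "prod_list (map tensor_of u) * r * prod_list (map tensor_of v) =
        prod_list (map tensor_of (u @ [x, y] @ v)) - prod_list (map tensor_of (u @ [y, x] @ v))
        - prod_list (map tensor_of (u @ [bracket x y] @ v))"
      by (simp add: r algebra_simps)
    then show "tensor_ext f (prod_list (map tensor_of u) * r * prod_list (map tensor_of v)) = 0"
      by (simp only: d tensor_ext_prod_list[OF f] lie diff_self)
  qed
  then show ?thesis by (simp add: d)
qed

lemma lie_multilinear_augmentation: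
  "lie_multilinear (\<lambda>xs. if xs = [] then 1 else (0::complex))"
  unfolding lie_multilinear_def using multilinear_augmentation by auto

quotient_type (overloaded) 'l env_algebra = "'l::complex_lie_algebra tensor_algebra" / "ideal_cong env_relations"
  by (rule equivp_ideal_cong)

instantiation env_algebra :: (complex_lie_algebra) complex_algebra_1
begin
lift_definition zero_env_algebra :: "'a env_algebra" is 0 .
lift_definition one_env_algebra :: "'a env_algebra" is 1 .
lift_definition plus_env_algebra :: "'a env_algebra \<Rightarrow> 'a env_algebra \<Rightarrow> 'a env_algebra"
  is "(+)" by (rule ideal_cong_add)
lift_definition uminus_env_algebra :: "'a env_algebra \<Rightarrow> 'a env_algebra"
  is uminus by (rule ideal_cong_uminus)
lift_definition minus_env_algebra :: "'a env_algebra \<Rightarrow> 'a env_algebra \<Rightarrow> 'a env_algebra"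
  is "(-)" by (rule ideal_cong_diff)
lift_definition times_env_algebra :: "'a env_algebra \<Rightarrow> 'a env_algebra \<Rightarrow> 'a env_algebra"
  is "(*)" by (rule ideal_cong_mult)
lift_definition scaleC_env_algebra :: "complex \<Rightarrow> 'a env_algebra \<Rightarrow> 'a env_algebra"
  is scaleC by (rule ideal_cong_scaleC)
instance
proof
  show "(0::'a env_algebra) \<noteq> 1"
  proof (transfer, rule notI)
    assume "ideal_cong env_relations (0 :: 'a tensor_algebra) 1"
    from tensor_ext_env_cong[OF lie_multilinear_augmentation this]
    have "tensor_ext (\<lambda>xs. if xs = [] then 1 else (0::complex)) (0 :: 'a tensor_algebra) =
        tensor_ext (\<lambda>xs. if xs = [] then 1 else 0) (prod_list (map tensor_of ([] :: 'a list)))"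
      by simp
    moreover have "tensor_ext (\<lambda>xs. if xs = [] then 1 else (0::complex)) (0 :: 'a tensor_algebra) = 0"
      using clinear_scale[OF clinear_tensor_ext[OF multilinear_augmentation], of 0 0] by simp
    ultimately show False
      unfolding tensor_ext_prod_list[OF multilinear_augmentation] by simp
  qed
qed (transfer, (simp add: algebra_simps scaleC_add_right scaleC_add_left scaleC_scaleC
        scaleC_mult_left scaleC_mult_right scaleC_one equivp_reflp[OF equivp_ideal_cong]; fail))+
end

lift_definition env_of :: "'l::complex_lie_algebra \<Rightarrow> 'l env_algebra" is tensor_of .

(* The linear map on U(L) with y_1 ... y_k \<mapsto> f [y_1, ..., y_k]; only meaningful for
   f with lie_multilinear f. *)
definition env_ext ::
    "('l::complex_lie_algebra list \<Rightarrow> 'w::complex_vector) \<Rightarrow> 'l env_algebra \<Rightarrow> 'w"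
  where "env_ext f u = tensor_ext f (rep_env_algebra u)"

lemma env_ext_abs:
  "lie_multilinear f \<Longrightarrow> env_ext f (abs_env_algebra t) = tensor_ext f t"
  unfolding env_ext_def
  by (erule tensor_ext_env_cong) (rule Quotient3_rep_abs[OF Quotient3_env_algebra
        equivp_reflp[OF equivp_ideal_cong]])

lemma prod_list_env_of: "prod_list (map env_of xs) = abs_env_algebra (prod_list (map tensor_of xs))"
  by (induction xs) (simp_all add: one_env_algebra.abs_eq env_of.abs_eq times_env_algebra.abs_eq)

lemma env_ext_prod_list: "lie_multilinear f \<Longrightarrow> env_ext f (prod_list (map env_of xs)) = f xs"
  by (simp add: prod_list_env_of env_ext_abs tensor_ext_prod_list lie_multilinear_def)

lemma clinear_env_ext:
  assumes f: "lie_multilinear f" shows "clinear (env_ext f)"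
proof (rule clinearI)
  have m: "clinear (tensor_ext f)"
    using f by (intro clinear_tensor_ext) (simp add: lie_multilinear_def)
  fix x y :: "'a env_algebra" and c
  obtain p where p: "x = abs_env_algebra p" by (metis Quotient3_abs_rep[OF Quotient3_env_algebra])
  obtain q where q: "y = abs_env_algebra q" by (metis Quotient3_abs_rep[OF Quotient3_env_algebra])
  show "env_ext f (x + y) = env_ext f x + env_ext f y"
    by (simp add: p q plus_env_algebra.abs_eq env_ext_abs f clinear_add[OF m])
  show "env_ext f (c *\<^sub>C x) = c *\<^sub>C env_ext f x"
    by (simp add: p scaleC_env_algebra.abs_eq env_ext_abs f clinear_scale[OF m])
qed

lemma env_of_add: "env_of (x + y) = env_of x + env_of y"
  by (simp add: env_of.abs_eq tensor_of_add plus_env_algebra.abs_eq)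

lemma env_of_scaleC: "env_of (c *\<^sub>C x) = c *\<^sub>C env_of x"
  by (simp add: env_of.abs_eq tensor_of_scaleC scaleC_env_algebra.abs_eq)

lemma sym_of_add: "sym_of (x + y) = sym_of x + sym_of y"
  by (simp add: sym_of.abs_eq tensor_of_add plus_sym_algebra.abs_eq)

lemma sym_of_scaleC: "sym_of (c *\<^sub>C x) = c *\<^sub>C sym_of x"
  by (simp add: sym_of.abs_eq tensor_of_scaleC scaleC_sym_algebra.abs_eq)

lemma env_of_commutator: "env_of x * env_of y - env_of y * env_of x = env_of (bracket x y)"
  by (transfer, simp add: ideal_cong_def)
    (rule two_sided_ideal_gen, auto simp: env_relations_def)

lemma sym_of_commute: "sym_of x * sym_of y = sym_of y * sym_of x"
  by (transfer, simp add: ideal_cong_def)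
    (rule two_sided_ideal_gen, auto simp: commutators_def)

instance sym_algebra :: (complex_vector) comm_ring_1
proof
  have 1: "prod_list (map sym_of xs) * sym_of y = sym_of y * prod_list (map sym_of xs)"
    for xs and y :: 'a
  proof (induction xs)
    case (Cons x xs)
    have "prod_list (map sym_of (x # xs)) * sym_of y = sym_of x * (prod_list (map sym_of xs) * sym_of y)"
      by (simp add: mult.assoc)
    also have "\<dots> = (sym_of x * sym_of y) * prod_list (map sym_of xs)"
      by (simp only: Cons.IH mult.assoc)
    also have "\<dots> = sym_of y * prod_list (map sym_of (x # xs))"
      by (simp only: sym_of_commute[of x y]) (simp add: mult.assoc)
    finally show ?case .
  qed simp
  have 2: "prod_list (map sym_of xs) * prod_list (map sym_of ys) =
      prod_list (map sym_of ys) * prod_list (map sym_of xs)" for xs ys :: "'a list"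
  proof (induction ys)
    case (Cons y ys)
    have "prod_list (map sym_of xs) * prod_list (map sym_of (y # ys)) =
        (prod_list (map sym_of xs) * sym_of y) * prod_list (map sym_of ys)"
      by (simp add: mult.assoc)
    also have "\<dots> = sym_of y * (prod_list (map sym_of xs) * prod_list (map sym_of ys))"
      by (simp only: 1 mult.assoc)
    also have "\<dots> = prod_list (map sym_of (y # ys)) * prod_list (map sym_of xs)"
      by (simp add: Cons.IH mult.assoc)
    finally show ?case .
  qed simp
  have 3: "prod_list (map sym_of xs) * abs_sym_algebra t = abs_sym_algebra t * prod_list (map sym_of xs)"
    for xs and t :: "'a tensor_algebra"
  proof (induction t rule: tensor_algebra_induct)
    case zero
    show ?case by (simp flip: zero_sym_algebra.abs_eq)
  next
    case (add c ys t)
    have "abs_sym_algebra (c *\<^sub>C prod_list (map tensor_of ys) + t) =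
        c *\<^sub>C prod_list (map sym_of ys) + abs_sym_algebra t"
      by (simp add: plus_sym_algebra.abs_eq scaleC_sym_algebra.abs_eq prod_list_sym_of)
    then show ?case
      by (simp only: distrib_left distrib_right scaleC_mult_left scaleC_mult_right add 2[of xs ys])
  qed
  have 4: "abs_sym_algebra s * abs_sym_algebra t' = abs_sym_algebra t' * abs_sym_algebra s"
    for s t' :: "'a tensor_algebra"
  proof (induction s rule: tensor_algebra_induct)
    case zero
    show ?case by (simp flip: zero_sym_algebra.abs_eq)
  next
    case (add c ys t)
    have "abs_sym_algebra (c *\<^sub>C prod_list (map tensor_of ys) + t) =
        c *\<^sub>C prod_list (map sym_of ys) + abs_sym_algebra t"
      by (simp add: plus_sym_algebra.abs_eq scaleC_sym_algebra.abs_eq prod_list_sym_of)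
    then show ?case
      by (simp only: distrib_left distrib_right scaleC_mult_left scaleC_mult_right add 3[of ys t'])
  qed
  show "a * b = b * a" for a b :: "'a sym_algebra"
    using 4[of "rep_sym_algebra a" "rep_sym_algebra b"]
    by (simp add: Quotient3_abs_rep[OF Quotient3_sym_algebra])
qed (simp_all add: distrib_right)

section \<open>Symmetrisation\<close>

definition permutation_average :: "('x list \<Rightarrow> 'v::complex_vector) \<Rightarrow> 'x list \<Rightarrow> 'v"
  where "permutation_average f xs =
    (1 / fact (length xs)) *\<^sub>C (\<Sum>\<sigma> | \<sigma> permutes {..<length xs}. f (permute_list \<sigma> xs))"

lemma permutation_average_mset:
  assumes "mset xs = mset ys" shows "permutation_average f xs = permutation_average f ys"
proof -
  from assms obtain p where p: "p permutes {..<length ys}" "permute_list p ys = xs"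
    by (rule mset_eq_permutation)
  have l: "length xs = length ys" using assms by (metis size_mset)
  have "(\<Sum>\<sigma> | \<sigma> permutes {..<length ys}. f (permute_list \<sigma> xs)) =
      (\<Sum>\<sigma> | \<sigma> permutes {..<length ys}. f (permute_list (p \<circ> \<sigma>) ys))"
  proof (rule sum.cong[OF refl])
    fix \<sigma> assume "\<sigma> \<in> {\<sigma>. \<sigma> permutes {..<length ys}}"
    then show "f (permute_list \<sigma> xs) = f (permute_list (p \<circ> \<sigma>) ys)"
      using permute_list_compose[of \<sigma> ys p] p by simp
  qed
  also have "\<dots> = (\<Sum>\<sigma> | \<sigma> permutes {..<length ys}. f (permute_list \<sigma> ys))"
    by (rule setum_permutations_compose_left[OF p(1), symmetric])
  finally show ?thesis by (simp add: permutation_average_def l)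
qed

lemma permute_list_slot:
  assumes "\<sigma> permutes {..<length u + Suc (length v)}"
  shows "\<exists>u' v'. \<forall>x. permute_list \<sigma> (u @ [x] @ v) = u' @ [x] @ v'"
proof -
  let ?n = "length u + Suc (length v)" and ?xs = "\<lambda>x. u @ [x] @ v"
  define i where "i = inv \<sigma> (length u)"
  have si: "\<sigma> i = length u" unfolding i_def using permutes_inverses(1)[OF assms] by simp
  have i: "i < ?n"
    using permutes_in_image[OF assms, of i] si by simp
  have split: "[0..<?n] = [0..<i] @ [i] @ [Suc i..<?n]"
    using i upt_add_eq_append[of 0 i "?n - i"] upt_conv_Cons[of i ?n] by simp
  have ne: "\<sigma> k \<noteq> length u" if "k \<noteq> i" for k
    using that si injD[OF permutes_inj[OF assms], of k i] by auto
  have nth: "?xs x ! \<sigma> k = ?xs y ! \<sigma> k" if "k \<noteq> i" for k x y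
    using ne[OF that] by (auto simp: nth_append nth_Cons')
  have "permute_list \<sigma> (?xs x) = map (\<lambda>k. ?xs undefined ! \<sigma> k) [0..<i] @ [x] @
      map (\<lambda>k. ?xs undefined ! \<sigma> k) [Suc i..<?n]" for x
  proof -
    have "permute_list \<sigma> (?xs x) = map (\<lambda>k. ?xs x ! \<sigma> k) [0..<?n]"
      by (simp add: permute_list_def)
    also have "\<dots> = map (\<lambda>k. ?xs x ! \<sigma> k) [0..<i] @ [?xs x ! \<sigma> i] @
        map (\<lambda>k. ?xs x ! \<sigma> k) [Suc i..<?n]"
      unfolding split by simp
    also have "?xs x ! \<sigma> i = x" by (simp add: si)
    also have "map (\<lambda>k. ?xs x ! \<sigma> k) [0..<i] = map (\<lambda>k. ?xs undefined ! \<sigma> k) [0..<i]"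
      by (intro map_cong refl nth) auto
    also have "map (\<lambda>k. ?xs x ! \<sigma> k) [Suc i..<?n] = map (\<lambda>k. ?xs undefined ! \<sigma> k) [Suc i..<?n]"
      by (intro map_cong refl nth) auto
    finally show ?thesis .
  qed
  then show ?thesis by blast
qed

lemma clinear_sum: "(\<And>i. i \<in> A \<Longrightarrow> clinear (f i)) \<Longrightarrow> clinear (\<lambda>x. \<Sum>i\<in>A. f i x)"
  by (intro clinearI)
    (simp_all add: clinear_add clinear_scale sum.distrib complex_vector.scale_sum_right)

lemma clinear_scaled: "clinear f \<Longrightarrow> clinear (\<lambda>x. c *\<^sub>C f x)"
  by (intro clinearI)
    (simp_all add: clinear_add clinear_scale scaleC_add_right scaleC_scaleC mult.commute)

lemma clinear_permutation_average:
  assumes "\<And>u v. clinear (\<lambda>x. f (u @ [h x] @ v))"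
  shows "clinear (\<lambda>x. permutation_average f (u @ [h x] @ v))"
proof -
  have "clinear (\<lambda>x. f (permute_list \<sigma> (u @ [h x] @ v)))"
    if \<sigma>: "\<sigma> permutes {..<length u + Suc (length v)}" for \<sigma>
  proof -
    obtain u' v' where "\<forall>x. permute_list \<sigma> (u @ [x] @ v) = u' @ [x] @ v'"
      using permute_list_slot[OF \<sigma>] by blast
    then have "(\<lambda>x. f (permute_list \<sigma> (u @ [h x] @ v))) = (\<lambda>x. f (u' @ [h x] @ v'))" by simp
    then show ?thesis using assms[of u' v'] by simp
  qed
  then show ?thesis
    unfolding permutation_average_def length_append list.size add_0_right
    by (auto intro!: clinear_sum clinear_scaled)
qed

lemma symmetric_multilinear_permutation_average:
  "multilinear f \<Longrightarrow> symmetric_multilinear (permutation_average f)"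
  unfolding symmetric_multilinear_def multilinear_def
  using clinear_permutation_average[of f "\<lambda>x. x"]
  by (intro conjI allI impI permutation_average_mset) simp_all

lemma multilinear_prod_list:
  fixes h :: "'v::complex_vector \<Rightarrow> 'a::complex_algebra_1"
  assumes "clinear h" shows "multilinear (\<lambda>xs. prod_list (map h xs))"
  unfolding multilinear_def
  by (intro allI clinearI)
    (simp_all add: clinear_add[OF assms] clinear_scale[OF assms] distrib_left distrib_right
      scaleC_mult_left scaleC_mult_right)

definition sym_to_tensor :: "'v::complex_vector sym_algebra \<Rightarrow> 'v tensor_algebra"
  where "sym_to_tensor = sym_ext (permutation_average (\<lambda>xs. prod_list (map tensor_of xs)))"

definition sym_to_env :: "'l::complex_lie_algebra sym_algebra \<Rightarrow> 'l env_algebra"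
  where "sym_to_env = sym_ext (permutation_average (\<lambda>xs. prod_list (map env_of xs)))"

lemma clinear_tensor_of: "clinear tensor_of"
  by (intro clinearI tensor_of_add tensor_of_scaleC)

lemma clinear_env_of: "clinear env_of"
  by (intro clinearI env_of_add env_of_scaleC)

lemma clinear_sym_of: "clinear sym_of"
  by (intro clinearI sym_of_add sym_of_scaleC)

lemma sym_to_tensor_prod_list:
  "sym_to_tensor (prod_list (map sym_of ys)) =
    permutation_average (\<lambda>xs. prod_list (map tensor_of xs)) ys"
  unfolding sym_to_tensor_def
  by (intro sym_ext_prod_list symmetric_multilinear_permutation_average multilinear_prod_list
      clinear_tensor_of)

lemma clinear_sym_to_tensor: "clinear sym_to_tensor"
  unfolding sym_to_tensor_def
  by (intro clinear_sym_ext symmetric_multilinear_permutation_average multilinear_prod_list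
      clinear_tensor_of)

lemma sym_to_env_prod_list:
  "sym_to_env (prod_list (map sym_of ys)) =
    permutation_average (\<lambda>xs. prod_list (map env_of xs)) ys"
  unfolding sym_to_env_def
  by (intro sym_ext_prod_list symmetric_multilinear_permutation_average multilinear_prod_list
      clinear_env_of)

lemma clinear_sym_to_env: "clinear sym_to_env"
  unfolding sym_to_env_def
  by (intro clinear_sym_ext symmetric_multilinear_permutation_average multilinear_prod_list
      clinear_env_of)

section \<open>Induced maps and derivations\<close>

definition sym_map :: "('v::complex_vector \<Rightarrow> 'w::complex_vector) \<Rightarrow> 'v sym_algebra \<Rightarrow> 'w sym_algebra"
  where "sym_map h = sym_ext (\<lambda>xs. prod_list (map (\<lambda>x. sym_of (h x)) xs))"

lemma prod_list_mset_eq: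
  fixes h :: "'v \<Rightarrow> 'a::comm_monoid_mult"
  assumes "mset xs = mset ys" shows "prod_list (map h xs) = prod_list (map h ys)"
  by (metis assms mset_map prod_mset_prod_list)

lemma clinear_compose: "clinear f \<Longrightarrow> clinear g \<Longrightarrow> clinear (\<lambda>x. f (g x))"
  by (intro clinearI) (simp_all add: clinear_add clinear_scale)

lemma symmetric_multilinear_sym_map:
  "clinear h \<Longrightarrow> symmetric_multilinear (\<lambda>xs. prod_list (map (\<lambda>x. sym_of (h x)) xs))"
  unfolding symmetric_multilinear_def
  by (intro conjI allI impI multilinear_prod_list clinear_compose[OF clinear_sym_of] prod_list_mset_eq)

lemma sym_map_prod_list:
  "clinear h \<Longrightarrow> sym_map h (prod_list (map sym_of ys)) = prod_list (map (\<lambda>y. sym_of (h y)) ys)"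
  unfolding sym_map_def by (intro sym_ext_prod_list symmetric_multilinear_sym_map)

fun leibniz :: "('l \<Rightarrow> 'a::ring_1) \<Rightarrow> ('l \<Rightarrow> 'l) \<Rightarrow> 'l list \<Rightarrow> 'a" where
  "leibniz h d [] = 0"
| "leibniz h d (y # ys) = h (d y) * prod_list (map h ys) + h y * leibniz h d ys"

lemma leibniz_append:
  "leibniz h d (u @ v) = leibniz h d u * prod_list (map h v) + prod_list (map h u) * leibniz h d v"
  by (induction u) (simp_all add: algebra_simps)

lemma multilinear_leibniz:
  fixes h :: "'v::complex_vector \<Rightarrow> 'a::complex_algebra_1"
  assumes h: "clinear h" and d: "clinear d" shows "multilinear (leibniz h d)"
  unfolding multilinear_def
  by (intro allI clinearI)
    (simp_all add: leibniz_append clinear_add[OF h] clinear_scale[OF h] clinear_add[OF d]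
      clinear_scale[OF d] distrib_left distrib_right scaleC_add_right
      scaleC_mult_left scaleC_mult_right algebra_simps)

lemma leibniz_mset:
  fixes h :: "'v \<Rightarrow> 'a::comm_ring_1"
  assumes "mset xs = mset ys" shows "leibniz h d xs = leibniz h d ys"
  using assms
proof (induction xs arbitrary: ys)
  case (Cons x xs)
  then have "x \<in> set ys" by (metis list.set_intros(1) set_mset_mset)
  then obtain a b where ys: "ys = a @ x # b" by (meson split_list)
  have m: "mset xs = mset (a @ b)" using Cons.prems ys by simp
  have "leibniz h d ys = h (d x) * prod_list (map h (a @ b)) + h x * leibniz h d (a @ b)"
    by (simp add: ys leibniz_append algebra_simps)
  then show ?case using Cons.IH[OF m] prod_list_mset_eq[OF m, of h] by simp
qed simp

(* The action of x on S(L): the derivation extending ad x. *)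
definition lie_action :: "'l::complex_lie_algebra \<Rightarrow> 'l sym_algebra \<Rightarrow> 'l sym_algebra"
  where "lie_action x = sym_ext (leibniz sym_of (bracket x))"

definition sym_invariants :: "nat \<Rightarrow> 'l::complex_lie_algebra sym_algebra set"
  where "sym_invariants k = {H \<in> sym_power k. \<forall>x. lie_action x H = 0}"

lemma clinear_bracket: "clinear (bracket x)"
  by (intro clinearI bracket_add_right bracket_scaleC_right)

lemma lie_action_prod_list:
  "lie_action x (prod_list (map sym_of ys)) = leibniz sym_of (bracket x) ys"
  unfolding lie_action_def
  by (rule sym_ext_prod_list)
    (auto simp: symmetric_multilinear_def intro: multilinear_leibniz clinear_sym_of
      clinear_bracket leibniz_mset)

lemma lie_multilinear_leibniz:
  fixes d :: "'l::complex_lie_algebra \<Rightarrow> 'l"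
  assumes d: "clinear d" and der: "\<And>x y. d (bracket x y) = bracket (d x) y + bracket x (d y)"
  shows "lie_multilinear (leibniz env_of d)"
proof -
  have "leibniz env_of d [x, y] - leibniz env_of d [y, x] = env_of (d (bracket x y))" for x y
  proof -
    have "leibniz env_of d [x, y] - leibniz env_of d [y, x] =
        (env_of (d x) * env_of y - env_of y * env_of (d x)) +
        (env_of x * env_of (d y) - env_of (d y) * env_of x)"
      by simp
    then show ?thesis by (simp add: env_of_commutator der env_of_add)
  qed
  then have e: "leibniz env_of d [bracket x y] = leibniz env_of d [x, y] - leibniz env_of d [y, x]" for x y
    by simp
  have p: "prod_list (map env_of [bracket x y]) =
      prod_list (map env_of [x, y]) - prod_list (map env_of [y, x])" for x y :: 'l
    by (simp add: env_of_commutator)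
  have "leibniz env_of d (u @ [x, y] @ v) - leibniz env_of d (u @ [y, x] @ v) =
      leibniz env_of d (u @ [bracket x y] @ v)" for u v x y
    unfolding leibniz_append e p map_append prod_list.append by (simp only: algebra_simps)
  then show ?thesis
    unfolding lie_multilinear_def using multilinear_leibniz[OF clinear_env_of d] by blast
qed

definition env_map :: "('l::complex_lie_algebra \<Rightarrow> 'm::complex_lie_algebra) \<Rightarrow> 'l env_algebra \<Rightarrow> 'm env_algebra"
  where "env_map h = env_ext (\<lambda>xs. prod_list (map (\<lambda>x. env_of (h x)) xs))"

lemma lie_multilinear_env_map:
  assumes h: "clinear h" and hom: "\<And>x y. h (bracket x y) = bracket (h x) (h y)"
  shows "lie_multilinear (\<lambda>xs. prod_list (map (\<lambda>x. env_of (h x)) xs))"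
  unfolding lie_multilinear_def
proof (intro conjI allI)
  show "multilinear (\<lambda>xs. prod_list (map (\<lambda>x. env_of (h x)) xs))"
    by (intro multilinear_prod_list clinear_compose[OF clinear_env_of] h)
  fix u v x y
  show "prod_list (map (\<lambda>x. env_of (h x)) (u @ [x, y] @ v)) -
      prod_list (map (\<lambda>x. env_of (h x)) (u @ [y, x] @ v)) =
      prod_list (map (\<lambda>x. env_of (h x)) (u @ [bracket x y] @ v))"
    by (simp add: hom algebra_simps flip: env_of_commutator)
qed

definition env_filtration_less :: "nat \<Rightarrow> 'l::complex_lie_algebra env_algebra set"
  where "env_filtration_less k = complex_vector.span {prod_list (map env_of xs) | xs. length xs < k}"

section \<open>Linear endomorphisms, tensor products and the maps m\<close>

typedef (overloaded) 'v endo = "{f :: 'v \<Rightarrow> 'v::complex_vector. clinear f}"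
  morphisms apply_endo Endo
  using clinearI[of "\<lambda>x. x"] by auto

setup_lifting type_definition_endo

instantiation endo :: (complex_vector) "{complex_vector, ring, monoid_mult}"
begin
lift_definition zero_endo :: "'a endo" is "\<lambda>x. 0" by (intro clinearI) simp_all
lift_definition one_endo :: "'a endo" is "\<lambda>x. x" by (intro clinearI) simp_all
lift_definition plus_endo :: "'a endo \<Rightarrow> 'a endo \<Rightarrow> 'a endo" is "\<lambda>f g x. f x + g x"
  by (intro clinearI) (simp_all add: clinear_add clinear_scale scaleC_add_right)
lift_definition uminus_endo :: "'a endo \<Rightarrow> 'a endo" is "\<lambda>f x. - f x"
  by (intro clinearI) (simp_all add: clinear_add clinear_scale)
lift_definition minus_endo :: "'a endo \<Rightarrow> 'a endo \<Rightarrow> 'a endo" is "\<lambda>f g x. f x - g x"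
  by (intro clinearI)
    (simp_all add: clinear_add clinear_scale complex_vector.scale_right_diff_distrib)
lift_definition times_endo :: "'a endo \<Rightarrow> 'a endo \<Rightarrow> 'a endo" is "\<lambda>f g x. f (g x)"
  by (rule clinear_compose)
lift_definition scaleC_endo :: "complex \<Rightarrow> 'a endo \<Rightarrow> 'a endo" is "\<lambda>c f x. c *\<^sub>C f x"
  by (rule clinear_scaled)
instance
  by standard (transfer, (simp add: fun_eq_iff clinear_add scaleC_add_right scaleC_add_left
        scaleC_scaleC scaleC_one; fail))+
end

lemma endo_scaleC_mult: "(c *\<^sub>C f) * g = c *\<^sub>C (f * g)" "f * (c *\<^sub>C g) = c *\<^sub>C (f * g)"
  for f g :: "'v::complex_vector endo"
  by (transfer, simp add: fun_eq_iff clinear_scale)+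

lift_definition ad :: "'l::complex_lie_algebra \<Rightarrow> 'l endo" is bracket
  by (rule clinear_bracket)

lemma clinear_ad: "clinear ad"
  by (intro clinearI; transfer) (simp_all add: fun_eq_iff bracket_add_left bracket_scaleC_left)

definition pair :: "'a \<Rightarrow> 'b \<Rightarrow> ('a \<times> 'b) \<Rightarrow>\<^sub>0 complex"
  where "pair a b = Poly_Mapping.single (a, b) 1"

definition bilinearity_relations :: "(('a::complex_vector \<times> 'b::complex_vector) \<Rightarrow>\<^sub>0 complex) set"
  where "bilinearity_relations =
    {pair (a + a') b - pair a b - pair a' b | a a' b. True} \<union>
    {pair a (b + b') - pair a b - pair a b' | a b b'. True} \<union>
    {pair (c *\<^sub>C a) b - c *\<^sub>C pair a b | c a b. True} \<union>
    {pair a (c *\<^sub>C b) - c *\<^sub>C pair a b | c a b. True}"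

definition span_cong :: "'v::complex_vector set \<Rightarrow> 'v \<Rightarrow> 'v \<Rightarrow> bool"
  where "span_cong R p q \<longleftrightarrow> p - q \<in> complex_vector.span R"

lemma equivp_span_cong: "equivp (span_cong R)"
proof (rule equivpI)
  show "reflp (span_cong R)"
    by (simp add: reflp_def span_cong_def complex_vector.span_zero)
  show "symp (span_cong R)"
  proof (rule sympI)
    fix x y assume "span_cong R x y"
    then show "span_cong R y x"
      using complex_vector.span_neg[of "x - y" R] by (simp add: span_cong_def)
  qed
  show "transp (span_cong R)"
  proof (rule transpI)
    fix x y z assume "span_cong R x y" "span_cong R y z"
    then show "span_cong R x z"
      using complex_vector.span_add[of "x - y" R "y - z"] by (simp add: span_cong_def)
  qed
qed

lemma span_cong_add: "span_cong R p p' \<Longrightarrow> span_cong R q q' \<Longrightarrow> span_cong R (p + q) (p' + q')"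
  using complex_vector.span_add[of "p - p'" R "q - q'"] by (simp add: span_cong_def algebra_simps)

lemma span_cong_uminus: "span_cong R p p' \<Longrightarrow> span_cong R (- p) (- p')"
  using complex_vector.span_neg[of "p - p'" R] by (simp add: span_cong_def)

lemma span_cong_diff: "span_cong R p p' \<Longrightarrow> span_cong R q q' \<Longrightarrow> span_cong R (p - q) (p' - q')"
  using span_cong_add[OF _ span_cong_uminus, of R p p' q q'] by simp

lemma span_cong_scaleC: "span_cong R p p' \<Longrightarrow> span_cong R (c *\<^sub>C p) (c *\<^sub>C p')"
  using complex_vector.span_scale[of "p - p'" R c]
  by (simp add: span_cong_def complex_vector.scale_right_diff_distrib)

quotient_type (overloaded) ('a, 'b) tensor_product =
  "('a::complex_vector \<times> 'b::complex_vector) \<Rightarrow>\<^sub>0 complex" / "span_cong bilinearity_relations"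
  by (rule equivp_span_cong)

instantiation tensor_product :: (complex_vector, complex_vector) complex_vector
begin
lift_definition zero_tensor_product :: "('a, 'b) tensor_product" is 0 .
lift_definition plus_tensor_product ::
  "('a, 'b) tensor_product \<Rightarrow> ('a, 'b) tensor_product \<Rightarrow> ('a, 'b) tensor_product"
  is "(+)" by (rule span_cong_add)
lift_definition uminus_tensor_product :: "('a, 'b) tensor_product \<Rightarrow> ('a, 'b) tensor_product"
  is uminus by (rule span_cong_uminus)
lift_definition minus_tensor_product ::
  "('a, 'b) tensor_product \<Rightarrow> ('a, 'b) tensor_product \<Rightarrow> ('a, 'b) tensor_product"
  is "(-)" by (rule span_cong_diff)
lift_definition scaleC_tensor_product :: "complex \<Rightarrow> ('a, 'b) tensor_product \<Rightarrow> ('a, 'b) tensor_product"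
  is scaleC by (rule span_cong_scaleC)
instance
  by standard (transfer, (simp add: algebra_simps scaleC_add_right scaleC_add_left
        scaleC_scaleC scaleC_one equivp_reflp[OF equivp_span_cong]; fail))+
end

lift_definition pure_tensor ::
    "'a::complex_vector \<Rightarrow> 'b::complex_vector \<Rightarrow> ('a, 'b) tensor_product"  (infixr \<open>\<otimes>\<close> 73)
  is pair .

lemma pure_tensor_add_left: "(a + a') \<otimes> b = a \<otimes> b + a' \<otimes> b"
  by (transfer, unfold span_cong_def diff_diff_eq[symmetric], rule complex_vector.span_base)
    (unfold bilinearity_relations_def, blast)

lemma pure_tensor_add_right: "a \<otimes> (b + b') = a \<otimes> b + a \<otimes> b'"
  by (transfer, unfold span_cong_def diff_diff_eq[symmetric], rule complex_vector.span_base)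
    (unfold bilinearity_relations_def, blast)

lemma pure_tensor_scaleC_left: "(c *\<^sub>C a) \<otimes> b = c *\<^sub>C (a \<otimes> b)"
  by (transfer, unfold span_cong_def, rule complex_vector.span_base)
    (unfold bilinearity_relations_def, blast)

lemma pure_tensor_scaleC_right: "a \<otimes> (c *\<^sub>C b) = c *\<^sub>C (a \<otimes> b)"
  by (transfer, unfold span_cong_def, rule complex_vector.span_base)
    (unfold bilinearity_relations_def, blast)

definition m_word :: "nat \<Rightarrow> 'l::complex_lie_algebra list \<Rightarrow> ('l endo, 'l tensor_algebra) tensor_product"
  where "m_word n ys = prod_list (map ad (take n ys)) \<otimes> prod_list (map tensor_of (drop n ys))"

lemma multilinear_m_word: "multilinear (m_word n)"
  unfolding multilinear_def
proof (intro allI)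
  fix u v :: "'a list"
  note lin = clinear_add[OF clinear_ad] clinear_scale[OF clinear_ad]
    tensor_of_add tensor_of_scaleC distrib_left distrib_right endo_scaleC_mult
    scaleC_mult_left scaleC_mult_right pure_tensor_add_left pure_tensor_add_right
    pure_tensor_scaleC_left pure_tensor_scaleC_right
  show "clinear (\<lambda>x. m_word n (u @ [x] @ v))"
  proof (cases "length u < n")
    case True
    then obtain k where "n = length u + Suc k" using less_iff_Suc_add by auto
    then show ?thesis by (intro clinearI) (simp_all add: m_word_def lin)
  next
    case False
    then show ?thesis by (intro clinearI) (simp_all add: m_word_def lin)
  qed
qed

(* On S^k(g), n \<le> k, this is symmetrisation into g^{\<otimes>k} followed by
   y_1 \<otimes> ... \<otimes> y_k \<mapsto> ad(y_1) ... ad(y_n) \<otimes> (y_{n+1} \<otimes> ... \<otimes> y_k). *)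
definition m_map :: "nat \<Rightarrow> 'l::complex_lie_algebra sym_algebra \<Rightarrow> ('l endo, 'l tensor_algebra) tensor_product"
  where "m_map n H = tensor_ext (m_word n) (sym_to_tensor H)"

(* The inclusion of S^j(g) into gl(g) \<otimes> g^{\<otimes>(j-1)}, j \<ge> 1, given by symmetrisation into
   g^{\<otimes>j} = g \<otimes> g^{\<otimes>(j-1)} and ad on the first factor. *)
definition sym_into_gl :: "'l::complex_lie_algebra sym_algebra \<Rightarrow> ('l endo, 'l tensor_algebra) tensor_product"
  where "sym_into_gl F =
    tensor_ext (\<lambda>ys. ad (hd ys) \<otimes> prod_list (map tensor_of (tl ys))) (sym_to_tensor F)"

lemma multilinear_ad_hd: "multilinear (\<lambda>ys. ad (hd ys) \<otimes> prod_list (map tensor_of (tl ys)))"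
  unfolding multilinear_def
proof (intro allI)
  fix u v :: "'a list"
  note lin = clinear_add[OF clinear_ad] clinear_scale[OF clinear_ad]
    tensor_of_add tensor_of_scaleC distrib_left distrib_right
    scaleC_mult_left scaleC_mult_right pure_tensor_add_left pure_tensor_add_right
    pure_tensor_scaleC_left pure_tensor_scaleC_right
  show "clinear (\<lambda>x. ad (hd (u @ [x] @ v)) \<otimes> prod_list (map tensor_of (tl (u @ [x] @ v))))"
    by (cases u; intro clinearI) (simp_all add: lin)
qed

section \<open>Semisimple Lie algebras and the Killing form\<close>

definition lie_ideal :: "'l::complex_lie_algebra set \<Rightarrow> bool"
  where "lie_ideal I \<longleftrightarrow> complex_vector.subspace I \<and> (\<forall>x. \<forall>y\<in>I. bracket x y \<in> I)"

definition derived_algebra :: "'l::complex_lie_algebra set \<Rightarrow> 'l set"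
  where "derived_algebra I = complex_vector.span {bracket x y | x y. x \<in> I \<and> y \<in> I}"

definition solvable :: "'l::complex_lie_algebra set \<Rightarrow> bool"
  where "solvable I \<longleftrightarrow> (\<exists>n. (derived_algebra ^^ n) I = {0})"

definition semisimple_lie_algebra :: "'l::complex_lie_algebra itself \<Rightarrow> bool"
  where "semisimple_lie_algebra _ \<longleftrightarrow>
    (\<exists>B :: 'l set. finite B \<and> complex_vector.span B = UNIV) \<and>
    (\<forall>I :: 'l set. lie_ideal I \<and> solvable I \<longrightarrow> I = {0})"

(* Computed in the library's canonical choice of a basis. *)
definition endo_trace :: "'v::complex_vector endo \<Rightarrow> complex"
  where "endo_trace f = (let B = complex_vector.extend_basis {} in
    \<Sum>b\<in>B. complex_vector.representation B (apply_endo f b) b)"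

definition killing_form :: "'l::complex_lie_algebra \<Rightarrow> 'l \<Rightarrow> complex"
  where "killing_form x y = endo_trace (ad x * ad y)"

lemma basis_indep: "\<not> complex_vector.dependent (complex_vector.extend_basis {} :: 'v::complex_vector set)"
  and basis_span: "complex_vector.span (complex_vector.extend_basis {} :: 'v::complex_vector set) = UNIV"
  using complex_vector.independent_extend_basis[OF complex_vector.independent_empty]
    complex_vector.span_extend_basis[OF complex_vector.independent_empty] by auto

lemma endo_trace_add: "endo_trace (f + g) = endo_trace f + endo_trace g"
  unfolding endo_trace_def Let_def
  by (simp add: plus_endo.rep_eq complex_vector.representation_add basis_indep basis_span sum.distrib)

lemma endo_trace_diff: "endo_trace (f - g) = endo_trace f - endo_trace g"
  using endo_trace_add[of "f - g" g] by simp

lemma endo_trace_scaleC: "endo_trace (c *\<^sub>C f) = c * endo_trace f"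
  unfolding endo_trace_def Let_def
  by (simp add: scaleC_endo.rep_eq complex_vector.representation_scale basis_indep basis_span
      sum_distrib_left)

lemma endo_trace_mult_commute: "endo_trace (f * g) = endo_trace (g * f)"
proof (cases "finite (complex_vector.extend_basis {} :: 'a set)")
  case False
  then show ?thesis by (simp add: endo_trace_def Let_def)
next
  case True
  define B where "B = (complex_vector.extend_basis {} :: 'a set)"
  let ?r = "complex_vector.representation B"
  have ind: "\<not> complex_vector.dependent B" and span: "complex_vector.span B = UNIV"
    unfolding B_def by (rule basis_indep, rule basis_span)
  have fin: "finite B" using True by (simp add: B_def)
  have *: "?r (apply_endo f (apply_endo g b)) b =
      (\<Sum>c\<in>B. ?r (apply_endo g b) c * ?r (apply_endo f c) b)" for f g b
  proof -
    have l: "clinear (apply_endo f)" using apply_endo[of f] by simp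
    have "apply_endo g b = (\<Sum>c\<in>B. ?r (apply_endo g b) c *\<^sub>C c)"
      using complex_vector.sum_representation_eq[OF ind _ fin, of "apply_endo g b"] span by simp
    then have "apply_endo f (apply_endo g b) =
        apply_endo f (\<Sum>c\<in>B. ?r (apply_endo g b) c *\<^sub>C c)" by simp
    also have "\<dots> = (\<Sum>c\<in>B. ?r (apply_endo g b) c *\<^sub>C apply_endo f c)"
      using Vector_Spaces.linear.axioms(3)[OF l] l
      by (simp add: module_hom.sum module_hom.scale)
    finally show ?thesis
      by (simp add: complex_vector.representation_sum complex_vector.representation_scale ind span)
  qed
  show ?thesis
    unfolding endo_trace_def Let_def times_endo.rep_eq * B_def[symmetric]
    by (subst sum.swap) (simp add: mult.commute)
qed

lemma bracket_anti: "bracket a b = - bracket b a"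
proof -
  have "bracket (a + b) (a + b) = bracket a b + bracket b a"
    unfolding bracket_add_right bracket_add_left by (simp add: bracket_self)
  then show ?thesis by (simp add: bracket_self eq_neg_iff_add_eq_0)
qed

lemma bracket_minus_right: "bracket a (- b) = - bracket a b"
  using bracket_scaleC_right[of a "-1" b] by simp

lemma ad_bracket: "ad (bracket x y) = ad x * ad y - ad y * ad x"
proof (transfer, rule ext)
  fix x y z :: 'a
  have "bracket (bracket x y) z = - bracket z (bracket x y)" by (rule bracket_anti)
  also have "\<dots> = bracket x (bracket y z) + bracket y (bracket z x)"
    by (rule minus_unique) (use jacobi[of x y z] in \<open>simp add: add.commute add.left_commute\<close>)
  also have "bracket z x = - bracket x z" by (rule bracket_anti)
  finally show "bracket (bracket x y) z = bracket x (bracket y z) - bracket y (bracket x z)"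
    by (simp add: bracket_minus_right)
qed

lemma killing_form_invariant: "killing_form (bracket x y) z = killing_form x (bracket y z)"
  using endo_trace_mult_commute[of "ad y" "ad x * ad z"]
  by (simp add: killing_form_def ad_bracket algebra_simps endo_trace_diff mult.assoc)

lemma killing_form_commute: "killing_form x y = killing_form y x"
  unfolding killing_form_def by (rule endo_trace_mult_commute)

lemma killing_form_add_left: "killing_form (x + y) z = killing_form x z + killing_form y z"
  by (simp add: killing_form_def clinear_add[OF clinear_ad] distrib_right endo_trace_add)

lemma killing_form_scaleC_left: "killing_form (c *\<^sub>C x) z = c * killing_form x z"
  by (simp add: killing_form_def clinear_scale[OF clinear_ad] endo_scaleC_mult endo_trace_scaleC)

lemma killing_form_add_right: "killing_form x (y + z) = killing_form x y + killing_form x z"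
  by (simp add: killing_form_def clinear_add[OF clinear_ad] distrib_left endo_trace_add)

lemma killing_form_scaleC_right: "killing_form x (c *\<^sub>C z) = c * killing_form x z"
  by (simp add: killing_form_def clinear_scale[OF clinear_ad] endo_scaleC_mult endo_trace_scaleC)

section \<open>Affine Kac-Moody algebras at the critical level\<close>

definition pm_sum :: "('k \<Rightarrow> 'v::zero \<Rightarrow> 'w::comm_monoid_add) \<Rightarrow> ('k \<Rightarrow>\<^sub>0 'v) \<Rightarrow> 'w"
  where "pm_sum f p = (\<Sum>k\<in>Poly_Mapping.keys p. f k (Poly_Mapping.lookup p k))"

lemma pm_sum_superset:
  assumes "finite A" "Poly_Mapping.keys p \<subseteq> A" "\<And>k. f k 0 = 0"
  shows "pm_sum f p = (\<Sum>k\<in>A. f k (Poly_Mapping.lookup p k))"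
  unfolding pm_sum_def using assms
  by (intro sum.mono_neutral_left) (auto simp: in_keys_iff)

lemma pm_sum_zero [simp]: "pm_sum f 0 = 0"
  by (simp add: pm_sum_def)

lemma pm_sum_single: "f k 0 = 0 \<Longrightarrow> pm_sum f (Poly_Mapping.single k v) = f k v"
  by (cases "v = 0") (simp_all add: pm_sum_def)

lemma pm_sum_add:
  fixes p q :: "'k \<Rightarrow>\<^sub>0 'v::comm_monoid_add"
  assumes "\<And>k. f k 0 = 0" "\<And>k x y. f k (x + y) = f k x + f k y"
  shows "pm_sum f (p + q) = pm_sum f p + pm_sum f q"
proof -
  let ?A = "Poly_Mapping.keys p \<union> Poly_Mapping.keys q"
  have "Poly_Mapping.keys (p + q) \<subseteq> ?A" by (rule Poly_Mapping.keys_add)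
  then show ?thesis
    by (simp add: pm_sum_superset[of ?A] assms lookup_add sum.distrib)
qed

lemma pm_sum_scaleC:
  fixes p :: "'k \<Rightarrow>\<^sub>0 'v::complex_vector" and f :: "'k \<Rightarrow> 'v \<Rightarrow> 'w::complex_vector"
  assumes "\<And>k. f k 0 = 0" "\<And>k c x. f k (c *\<^sub>C x) = c *\<^sub>C f k x"
  shows "pm_sum f (c *\<^sub>C p) = c *\<^sub>C pm_sum f p"
proof -
  have "Poly_Mapping.keys (c *\<^sub>C p) \<subseteq> Poly_Mapping.keys p"
    by (auto simp: in_keys_iff lookup_scaleC)
  then show ?thesis
    by (simp add: pm_sum_superset[of "Poly_Mapping.keys p"] assms lookup_scaleC
        complex_vector.scale_sum_right)
qed

lemma pm_sum_plus_fun: "pm_sum (\<lambda>k x. f k x + g k x) p = pm_sum f p + pm_sum g p"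
  by (simp add: pm_sum_def sum.distrib)

lemma pm_sum_scaleC_fun: "pm_sum (\<lambda>k x. c *\<^sub>C f k x) p = c *\<^sub>C pm_sum f p"
  by (simp add: pm_sum_def complex_vector.scale_sum_right)

lemma bracket_zero [simp]: "bracket x 0 = 0" "bracket 0 x = 0"
  using bracket_scaleC_right[of x 0 0] bracket_scaleC_left[of 0 0 x] by simp_all

lemma add_triple_zero:
  fixes a :: "'a::ab_group_add"
  assumes "a + b + c = 0" "a' + b' + c' = 0"
  shows "(a + a') + (b + b') + (c + c') = 0"
proof -
  have "(a + a') + (b + b') + (c + c') = (a + b + c) + (a' + b' + c')"
    by (simp only: add.assoc add.commute add.left_commute)
  then show ?thesis using assms by simp
qed

(* For M = int this is the loop algebra g[t, t^{-1}]: single n x stands for x t^n, and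
   [x t^m, y t^n] = [x, y] t^{m+n}. *)
instantiation poly_mapping :: (comm_monoid_add, complex_lie_algebra) complex_lie_algebra
begin

definition bracket_poly_mapping :: "('a \<Rightarrow>\<^sub>0 'b) \<Rightarrow> ('a \<Rightarrow>\<^sub>0 'b) \<Rightarrow> 'a \<Rightarrow>\<^sub>0 'b"
  where "bracket_poly_mapping p q =
    pm_sum (\<lambda>m x. pm_sum (\<lambda>n y. Poly_Mapping.single (m + n) (bracket x y)) q) p"

lemma bracket_pm_add_right: "bracket p (q + r) = bracket p q + bracket p r" for p q r :: "'a \<Rightarrow>\<^sub>0 'b"
  unfolding bracket_poly_mapping_def
  by (simp add: pm_sum_add bracket_add_right single_add pm_sum_plus_fun)

lemma bracket_pm_add_left: "bracket (p + q) r = bracket p r + bracket q r" for p q r :: "'a \<Rightarrow>\<^sub>0 'b"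
  unfolding bracket_poly_mapping_def
  by (rule pm_sum_add)
    (simp_all add: bracket_add_left single_add pm_sum_plus_fun, simp add: pm_sum_def)

lemma bracket_pm_scaleC_right: "bracket p (c *\<^sub>C q) = c *\<^sub>C bracket p q" for p q :: "'a \<Rightarrow>\<^sub>0 'b"
  unfolding bracket_poly_mapping_def
  by (simp add: pm_sum_scaleC bracket_scaleC_right pm_sum_scaleC_fun flip: scaleC_single)

lemma bracket_pm_scaleC_left: "bracket (c *\<^sub>C p) q = c *\<^sub>C bracket p q" for p q :: "'a \<Rightarrow>\<^sub>0 'b"
  unfolding bracket_poly_mapping_def
  by (rule pm_sum_scaleC)
    (simp add: pm_sum_def, simp add: bracket_scaleC_left pm_sum_scaleC_fun flip: scaleC_single)

lemma bracket_pm_single: "bracket (Poly_Mapping.single m x) (Poly_Mapping.single n y) =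
    Poly_Mapping.single (m + n) (bracket x y)" for x y :: 'b and m n :: 'a
proof -
  have "pm_sum (\<lambda>m x. pm_sum (\<lambda>n y. Poly_Mapping.single (m + n) (bracket x y)) q) (Poly_Mapping.single m x)
      = pm_sum (\<lambda>n y. Poly_Mapping.single (m + n) (bracket x y)) q" for q :: "'a \<Rightarrow>\<^sub>0 'b"
    by (rule pm_sum_single) (simp add: pm_sum_def)
  then show ?thesis unfolding bracket_poly_mapping_def by (simp add: pm_sum_single)
qed

lemma bracket_pm_zero: "bracket p 0 = 0" "bracket 0 p = 0" for p :: "'a \<Rightarrow>\<^sub>0 'b"
  by (simp_all add: bracket_poly_mapping_def pm_sum_def)

lemma bracket_pm_anti: "bracket p q = - bracket q p" for p q :: "'a \<Rightarrow>\<^sub>0 'b"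
proof (induction p rule: poly_mapping_single_induct)
  case zero
  show ?case by (simp add: bracket_pm_zero)
next
  case (add k v p)
  have "bracket (Poly_Mapping.single k v) q = - bracket q (Poly_Mapping.single k v)"
  proof (induction q rule: poly_mapping_single_induct)
    case zero
    show ?case by (simp add: bracket_pm_zero)
  next
    case (add l w q)
    have "bracket (Poly_Mapping.single k v) (Poly_Mapping.single l w) =
        - bracket (Poly_Mapping.single l w) (Poly_Mapping.single k v)"
      using bracket_anti[of v w] by (simp add: bracket_pm_single add.commute single_uminus)
    with add show ?case by (simp add: bracket_pm_add_left bracket_pm_add_right)
  qed
  with add show ?case by (simp add: bracket_pm_add_left bracket_pm_add_right)
qed

instance
proof
  fix p q r :: "'a \<Rightarrow>\<^sub>0 'b" and c :: complex
  show "bracket (p + q) r = bracket p r + bracket q r" by (rule bracket_pm_add_left)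
  show "bracket p (q + r) = bracket p q + bracket p r" by (rule bracket_pm_add_right)
  show "bracket (c *\<^sub>C p) q = c *\<^sub>C bracket p q" by (rule bracket_pm_scaleC_left)
  show "bracket p (c *\<^sub>C q) = c *\<^sub>C bracket p q" by (rule bracket_pm_scaleC_right)
  have "bracket p p + bracket p p = 0" using bracket_pm_anti[of p p] by (simp add: eq_neg_iff_add_eq_0)
  then have "2 *\<^sub>C bracket p p = 0"
    using scaleC_add_left[of 1 1 "bracket p p"] by (simp add: scaleC_one)
  then show "bracket p p = 0" by (metis complex_vector.scale_eq_0_iff zero_neq_numeral)
  have 1: "bracket (Poly_Mapping.single i x) (bracket (Poly_Mapping.single j y) (Poly_Mapping.single k z)) +
      bracket (Poly_Mapping.single j y) (bracket (Poly_Mapping.single k z) (Poly_Mapping.single i x)) +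
      bracket (Poly_Mapping.single k z) (bracket (Poly_Mapping.single i x) (Poly_Mapping.single j y)) = 0"
    for i j k :: 'a and x y z :: 'b
    using jacobi[of x y z] by (simp add: bracket_pm_single ac_simps flip: single_add)
  note bil = bracket_pm_add_left bracket_pm_add_right bracket_pm_zero
  have 2: "bracket (Poly_Mapping.single i x) (bracket (Poly_Mapping.single j y) r) +
      bracket (Poly_Mapping.single j y) (bracket r (Poly_Mapping.single i x)) +
      bracket r (bracket (Poly_Mapping.single i x) (Poly_Mapping.single j y)) = 0"
    for i j and x y and r :: "'a \<Rightarrow>\<^sub>0 'b"
  proof (induction r rule: poly_mapping_single_induct)
    case (add k z r)
    from 1[of i x j y k z] add show ?case
      unfolding bil by (rule add_triple_zero)
  qed (simp add: bil)
  have 3: "bracket (Poly_Mapping.single i x) (bracket q r) +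
      bracket q (bracket r (Poly_Mapping.single i x)) +
      bracket r (bracket (Poly_Mapping.single i x) q) = 0"
    for i x and q r :: "'a \<Rightarrow>\<^sub>0 'b"
  proof (induction q rule: poly_mapping_single_induct)
    case (add k z q)
    from 2[of i x k z r] add show ?case
      unfolding bil by (rule add_triple_zero)
  qed (simp add: bil)
  show "bracket p (bracket q r) + bracket q (bracket r p) + bracket r (bracket p q) = 0"
  proof (induction p rule: poly_mapping_single_induct)
    case (add k z p)
    from 3[of k z q r] add show ?case
      unfolding bil by (rule add_triple_zero)
  qed (simp add: bil)
qed

end

(* \<omega>(x t^m, y t^n) = m \<delta>_{m,-n} K(x, y), with K the Killing form. *)
definition killing_cocycle :: "(int \<Rightarrow>\<^sub>0 'g::complex_lie_algebra) \<Rightarrow> (int \<Rightarrow>\<^sub>0 'g) \<Rightarrow> complex"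
  where "killing_cocycle p q =
    (\<Sum>m\<in>Poly_Mapping.keys p. of_int m * killing_form (Poly_Mapping.lookup p m) (Poly_Mapping.lookup q (- m)))"

lemma killing_form_zero [simp]: "killing_form 0 x = 0" "killing_form x 0 = 0"
  using killing_form_scaleC_left[of 0 0 x] killing_form_scaleC_right[of x 0 0] by simp_all

lemma killing_cocycle_pm_sum: "killing_cocycle p q =
    pm_sum (\<lambda>m x. of_int m * killing_form x (Poly_Mapping.lookup q (- m))) p"
  by (simp add: killing_cocycle_def pm_sum_def)

lemma killing_cocycle_add_left: "killing_cocycle (p + q) r = killing_cocycle p r + killing_cocycle q r"
  unfolding killing_cocycle_pm_sum
  by (rule pm_sum_add) (simp_all add: killing_form_add_left algebra_simps)

lemma killing_cocycle_add_right: "killing_cocycle p (q + r) = killing_cocycle p q + killing_cocycle p r"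
  by (simp add: killing_cocycle_def lookup_add killing_form_add_right sum.distrib algebra_simps)

lemma killing_cocycle_scaleC_left: "killing_cocycle (c *\<^sub>C p) q = c * killing_cocycle p q"
  using pm_sum_scaleC[of "\<lambda>m x. of_int m * killing_form x (Poly_Mapping.lookup q (- m))" c p]
  by (simp add: killing_cocycle_pm_sum killing_form_scaleC_left scaleC_complex_def algebra_simps)

lemma killing_cocycle_scaleC_right: "killing_cocycle p (c *\<^sub>C q) = c * killing_cocycle p q"
  by (simp add: killing_cocycle_def lookup_scaleC killing_form_scaleC_right sum_distrib_left
      algebra_simps)

lemma killing_cocycle_zero [simp]: "killing_cocycle p 0 = 0" "killing_cocycle 0 p = 0"
  by (simp_all add: killing_cocycle_def)

lemma killing_cocycle_single:
  "killing_cocycle (Poly_Mapping.single m x) (Poly_Mapping.single n y) =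
    (if m + n = 0 then of_int m * killing_form x y else 0)"
proof -
  have "killing_cocycle (Poly_Mapping.single m x) (Poly_Mapping.single n y) =
      of_int m * killing_form x (Poly_Mapping.lookup (Poly_Mapping.single n y) (- m))"
    unfolding killing_cocycle_pm_sum by (rule pm_sum_single) simp
  then show ?thesis by (auto simp: lookup_single when_def)
qed

lemma killing_cocycle_anti: "killing_cocycle p q = - killing_cocycle q p"
proof (induction p rule: poly_mapping_single_induct)
  case (add k v p)
  have "killing_cocycle (Poly_Mapping.single k v) q = - killing_cocycle q (Poly_Mapping.single k v)"
  proof (induction q rule: poly_mapping_single_induct)
    case (add l w q)
    have "killing_cocycle (Poly_Mapping.single k v) (Poly_Mapping.single l w) =
        - killing_cocycle (Poly_Mapping.single l w) (Poly_Mapping.single k v)"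
    proof (cases "k + l = 0")
      case True
      then have "k = - l" by simp
      then show ?thesis using killing_form_commute[of v w] by (simp add: killing_cocycle_single)
    next
      case False
      then show ?thesis by (simp add: killing_cocycle_single add.commute)
    qed
    with add show ?case by (simp add: killing_cocycle_add_left killing_cocycle_add_right)
  qed simp
  with add show ?case by (simp add: killing_cocycle_add_left killing_cocycle_add_right)
qed simp

lemma killing_cocycle_jacobi:
  "killing_cocycle p (bracket q r) + killing_cocycle q (bracket r p) + killing_cocycle r (bracket p q) = 0"
proof -
  note bil = bracket_add_left bracket_add_right killing_cocycle_add_left killing_cocycle_add_right
  have 1: "killing_cocycle (Poly_Mapping.single i x) (bracket (Poly_Mapping.single j y) (Poly_Mapping.single k z)) +
      killing_cocycle (Poly_Mapping.single j y) (bracket (Poly_Mapping.single k z) (Poly_Mapping.single i x)) +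
      killing_cocycle (Poly_Mapping.single k z) (bracket (Poly_Mapping.single i x) (Poly_Mapping.single j y)) = 0"
    for i j k and x y z :: 'a
  proof -
    have a: "killing_form y (bracket z x) = killing_form x (bracket y z)"
      using killing_form_invariant[of y z x] killing_form_commute[of "bracket y z" x] by simp
    have b: "killing_form z (bracket x y) = killing_form x (bracket y z)"
      using killing_form_invariant[of x y z] killing_form_commute[of "bracket x y" z] by simp
    show ?thesis
    proof (cases "i + j + k = 0")
      case True
      then have k: "k = - i - j" by simp
      show ?thesis by (simp add: bracket_pm_single killing_cocycle_single a b k algebra_simps)
    next
      case False
      then have "i + (j + k) \<noteq> 0" "j + (k + i) \<noteq> 0" "k + (i + j) \<noteq> 0" by presburger+
      then show ?thesis by (simp add: bracket_pm_single killing_cocycle_single)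
    qed
  qed
  have 2: "killing_cocycle (Poly_Mapping.single i x) (bracket (Poly_Mapping.single j y) r) +
      killing_cocycle (Poly_Mapping.single j y) (bracket r (Poly_Mapping.single i x)) +
      killing_cocycle r (bracket (Poly_Mapping.single i x) (Poly_Mapping.single j y)) = 0"
    for i j x y and r :: "int \<Rightarrow>\<^sub>0 'a"
  proof (induction r rule: poly_mapping_single_induct)
    case (add k z r)
    from 1[of i x j y k z] add show ?case unfolding bil by (rule add_triple_zero)
  qed simp
  have 3: "killing_cocycle (Poly_Mapping.single i x) (bracket q r) +
      killing_cocycle q (bracket r (Poly_Mapping.single i x)) +
      killing_cocycle r (bracket (Poly_Mapping.single i x) q) = 0"
    for i x and q r :: "int \<Rightarrow>\<^sub>0 'a"
  proof (induction q rule: poly_mapping_single_induct)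
    case (add k z q)
    from 2[of i x k z r] add show ?case unfolding bil by (rule add_triple_zero)
  qed simp
  show ?thesis
  proof (induction p rule: poly_mapping_single_induct)
    case (add k z p)
    from 3[of k z q r] add show ?case unfolding bil by (rule add_triple_zero)
  qed simp
qed

(* The central extension of g[t, t^{-1}] by C at the critical level: the invariant form
   defining the cocycle is -1/2 times the Killing form, which on each simple factor is minus the
   dual Coxeter number times the normalised form. Affine p a stands for p + a K, where the
   central element K acts as the identity on the vacuum module. *)
context
  notes [[typedef_overloaded]]
begin
datatype 'g affine_algebra = Affine (loop_part: "int \<Rightarrow>\<^sub>0 'g") (central_part: complex)
end

instantiation affine_algebra :: (complex_lie_algebra) complex_lie_algebra
begin
definition zero_affine_algebra :: "'a affine_algebra" where "0 = Affine 0 0"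
definition plus_affine_algebra :: "'a affine_algebra \<Rightarrow> 'a affine_algebra \<Rightarrow> 'a affine_algebra"
  where "x + y = Affine (loop_part x + loop_part y) (central_part x + central_part y)"
definition uminus_affine_algebra :: "'a affine_algebra \<Rightarrow> 'a affine_algebra"
  where "- x = Affine (- loop_part x) (- central_part x)"
definition minus_affine_algebra :: "'a affine_algebra \<Rightarrow> 'a affine_algebra \<Rightarrow> 'a affine_algebra"
  where "x - y = Affine (loop_part x - loop_part y) (central_part x - central_part y)"
definition scaleC_affine_algebra :: "complex \<Rightarrow> 'a affine_algebra \<Rightarrow> 'a affine_algebra"
  where "c *\<^sub>C x = Affine (c *\<^sub>C loop_part x) (c * central_part x)"
definition bracket_affine_algebra :: "'a affine_algebra \<Rightarrow> 'a affine_algebra \<Rightarrow> 'a affine_algebra"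
  where "bracket x y = Affine (bracket (loop_part x) (loop_part y))
    (- 1 / 2 * killing_cocycle (loop_part x) (loop_part y))"
instance
proof
  fix x y z :: "'a affine_algebra" and c d :: complex
  note defs = zero_affine_algebra_def plus_affine_algebra_def uminus_affine_algebra_def
    minus_affine_algebra_def scaleC_affine_algebra_def bracket_affine_algebra_def
  show "x + y + z = x + (y + z)" "x + y = y + x" "0 + x = x" "- x + x = 0" "x - y = x + - y"
    "c *\<^sub>C (x + y) = c *\<^sub>C x + c *\<^sub>C y" "(c + d) *\<^sub>C x = c *\<^sub>C x + d *\<^sub>C x"
    "c *\<^sub>C d *\<^sub>C x = (c * d) *\<^sub>C x" "1 *\<^sub>C x = x"
    by (simp_all add: defs algebra_simps scaleC_add_right scaleC_add_left scaleC_scaleC scaleC_one)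
  show "bracket (x + y) z = bracket x z + bracket y z" "bracket x (y + z) = bracket x y + bracket x z"
    "bracket (c *\<^sub>C x) y = c *\<^sub>C bracket x y" "bracket x (c *\<^sub>C y) = c *\<^sub>C bracket x y"
    by (simp_all add: defs bracket_add_left bracket_add_right bracket_scaleC_left
        bracket_scaleC_right killing_cocycle_add_left killing_cocycle_add_right
        killing_cocycle_scaleC_left killing_cocycle_scaleC_right field_simps)
  have "killing_cocycle (loop_part x) (loop_part x) = 0"
    using killing_cocycle_anti[of "loop_part x" "loop_part x"] by simp
  then show "bracket x x = 0" by (simp add: defs bracket_self)
  show "bracket x (bracket y z) + bracket y (bracket z x) + bracket z (bracket x y) = 0"
    unfolding defs affine_algebra.sel jacobi
    by (simp only: distrib_left[symmetric] killing_cocycle_jacobi mult_zero_right)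
qed
end

section \<open>The Feigin-Frenkel centre\<close>

(* t^{-1} g[t^{-1}] *)
typedef (overloaded) 'g negative_loop =
  "{p :: int \<Rightarrow>\<^sub>0 'g::complex_lie_algebra. \<forall>n\<in>Poly_Mapping.keys p. n < 0}"
  morphisms loop_of Negative_Loop
  by (rule exI[of _ 0]) simp

setup_lifting type_definition_negative_loop

lemma keys_bracket_negative:
  assumes "\<forall>n\<in>Poly_Mapping.keys p. n < 0" "\<forall>n\<in>Poly_Mapping.keys q. n < 0"
    "n \<in> Poly_Mapping.keys (bracket p q)"
  shows "n < (0::int)"
proof -
  have "Poly_Mapping.keys (bracket p q) \<subseteq>
      (\<Union>m\<in>Poly_Mapping.keys p. \<Union>l\<in>Poly_Mapping.keys q. {m + l})"
    unfolding bracket_poly_mapping_def pm_sum_def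
    by (rule order_trans[OF keys_sum] UN_mono order_refl)+ (auto split: if_splits)
  then show ?thesis using assms by fastforce
qed

instantiation negative_loop :: (complex_lie_algebra) complex_lie_algebra
begin
lift_definition zero_negative_loop :: "'a negative_loop" is 0 by simp
lift_definition plus_negative_loop :: "'a negative_loop \<Rightarrow> 'a negative_loop \<Rightarrow> 'a negative_loop"
  is "(+)" by (meson UnE in_mono Poly_Mapping.keys_add)
lift_definition uminus_negative_loop :: "'a negative_loop \<Rightarrow> 'a negative_loop"
  is uminus by (simp add: in_keys_iff)
lift_definition minus_negative_loop :: "'a negative_loop \<Rightarrow> 'a negative_loop \<Rightarrow> 'a negative_loop"
  is "(-)" by (meson UnE in_mono keys_diff)
lift_definition scaleC_negative_loop :: "complex \<Rightarrow> 'a negative_loop \<Rightarrow> 'a negative_loop"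
  is scaleC by (auto simp: in_keys_iff lookup_scaleC)
lift_definition bracket_negative_loop :: "'a negative_loop \<Rightarrow> 'a negative_loop \<Rightarrow> 'a negative_loop"
  is bracket by (rule keys_bracket_negative[rotated 2]) auto
instance
proof
  fix x y z :: "'a negative_loop" and c d :: complex
  show "x + y + z = x + (y + z)" by transfer (rule add.assoc)
  show "x + y = y + x" by transfer (rule add.commute)
  show "0 + x = x" by transfer simp
  show "- x + x = 0" by transfer simp
  show "x - y = x + - y" by transfer simp
  show "c *\<^sub>C (x + y) = c *\<^sub>C x + c *\<^sub>C y" by transfer (rule scaleC_add_right)
  show "(c + d) *\<^sub>C x = c *\<^sub>C x + d *\<^sub>C x" by transfer (rule scaleC_add_left)
  show "c *\<^sub>C d *\<^sub>C x = (c * d) *\<^sub>C x" by transfer (rule scaleC_scaleC)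
  show "1 *\<^sub>C x = x" by transfer (rule scaleC_one)
  show "bracket (x + y) z = bracket x z + bracket y z" by transfer (rule bracket_add_left)
  show "bracket (c *\<^sub>C x) y = c *\<^sub>C bracket x y" by transfer (rule bracket_scaleC_left)
  show "bracket x (y + z) = bracket x y + bracket x z" by transfer (rule bracket_add_right)
  show "bracket x (c *\<^sub>C y) = c *\<^sub>C bracket x y" by transfer (rule bracket_scaleC_right)
  show "bracket x x = 0" by transfer (rule bracket_self)
  show "bracket x (bracket y z) + bracket y (bracket z x) + bracket z (bracket x y) = 0"
    by transfer (rule jacobi)
qed
end

(* x \<mapsto> x[-1] *)
lift_definition at_minus_one :: "'g::complex_lie_algebra \<Rightarrow> 'g negative_loop"
  is "Poly_Mapping.single (- 1)" by (simp split: if_splits)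

lemma clinear_at_minus_one: "clinear at_minus_one"
  by (intro clinearI; transfer) (simp_all add: single_add scaleC_single)

(* The inclusion of U(t^{-1} g[t^{-1}]) into U of the affine algebra. *)
definition env_inclusion :: "'g::complex_lie_algebra negative_loop env_algebra \<Rightarrow> 'g affine_algebra env_algebra"
  where "env_inclusion = env_map (\<lambda>p. Affine (loop_of p) 0)"

lemma lie_multilinear_env_inclusion:
  "lie_multilinear (\<lambda>xs. prod_list (map (\<lambda>p. env_of (Affine (loop_of p) 0)) xs))"
proof (rule lie_multilinear_env_map)
  show "clinear (\<lambda>p :: 'a negative_loop. Affine (loop_of p) 0)"
    by (intro clinearI) (simp_all add: plus_affine_algebra_def scaleC_affine_algebra_def
        plus_negative_loop.rep_eq scaleC_negative_loop.rep_eq)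
  fix p q :: "'a negative_loop"
  have "killing_cocycle (loop_of p) (loop_of q) = 0"
    unfolding killing_cocycle_def
  proof (rule sum.neutral, rule ballI)
    fix m assume "m \<in> Poly_Mapping.keys (loop_of p)"
    then have "m < 0" using loop_of[of p] by simp
    then have "- m \<notin> Poly_Mapping.keys (loop_of q)" using loop_of[of q] by fastforce
    then show "of_int m * killing_form (Poly_Mapping.lookup (loop_of p) m)
        (Poly_Mapping.lookup (loop_of q) (- m)) = 0"
      by (simp add: in_keys_iff)
  qed
  then show "Affine (loop_of (bracket p q)) 0 = bracket (Affine (loop_of p) 0) (Affine (loop_of q) 0)"
    by (simp add: bracket_affine_algebra_def bracket_negative_loop.rep_eq)
qed

(* g[t] as a subalgebra of the affine algebra. *)
definition current_subalgebra :: "'g::complex_lie_algebra affine_algebra set"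
  where "current_subalgebra = {Affine p 0 | p. \<forall>n\<in>Poly_Mapping.keys p. 0 \<le> n}"

(* The vacuum module at the critical level is U(affine_algebra) modulo this left ideal. *)
definition vacuum_ideal :: "'g::complex_lie_algebra affine_algebra env_algebra set"
  where "vacuum_ideal = left_ideal (env_of ` current_subalgebra \<union> {env_of (Affine 0 1) - 1})"

(* S is identified with the vector S|0> of the vacuum module, which is required to be
   annihilated by g[t]. *)
definition feigin_frenkel_centre :: "'g::complex_lie_algebra negative_loop env_algebra set"
  where "feigin_frenkel_centre =
    {S. \<forall>x\<in>current_subalgebra. env_of x * env_inclusion S \<in> vacuum_ideal}"

section \<open>The elements \<open>\<varpi>(\<tau>\<^sup>r F[-1])\<cdot>1\<close>\<close>

(* \<tau> = -d/dt, i.e. x[n] \<mapsto> -n x[n-1]. *)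
definition loop_tau :: "(int \<Rightarrow>\<^sub>0 'g::complex_vector) \<Rightarrow> (int \<Rightarrow>\<^sub>0 'g)"
  where "loop_tau p =
    (\<Sum>n\<in>Poly_Mapping.keys p. Poly_Mapping.single (n - 1) (- of_int n *\<^sub>C Poly_Mapping.lookup p n))"

lemma loop_tau_pm_sum: "loop_tau p = pm_sum (\<lambda>n x. Poly_Mapping.single (n - 1) (- of_int n *\<^sub>C x)) p"
  by (simp add: loop_tau_def pm_sum_def)

lemma loop_tau_add: "loop_tau (p + q) = loop_tau p + loop_tau q"
  unfolding loop_tau_pm_sum by (rule pm_sum_add) (simp_all only: scaleC_add_right single_add complex_vector.scale_zero_right single_zero)

lemma loop_tau_scaleC: "loop_tau (c *\<^sub>C p) = c *\<^sub>C loop_tau p"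
  unfolding loop_tau_pm_sum
  by (rule pm_sum_scaleC) (simp_all add: scaleC_single scaleC_scaleC mult.commute)

lemma loop_tau_single: "loop_tau (Poly_Mapping.single n x) = Poly_Mapping.single (n - 1) (- of_int n *\<^sub>C x)"
  unfolding loop_tau_pm_sum by (rule pm_sum_single) simp

lemma loop_tau_bracket: "loop_tau (bracket p q) = bracket (loop_tau p) q + bracket p (loop_tau q)"
  for p q :: "int \<Rightarrow>\<^sub>0 'g::complex_lie_algebra"
proof -
  have z: "loop_tau 0 = (0 :: int \<Rightarrow>\<^sub>0 'g)" by (simp add: loop_tau_def)
  note bil = bracket_add_left bracket_add_right loop_tau_add
  have 1: "loop_tau (bracket (Poly_Mapping.single m x) (Poly_Mapping.single n y)) =
      bracket (loop_tau (Poly_Mapping.single m x)) (Poly_Mapping.single n y) +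
      bracket (Poly_Mapping.single m x) (loop_tau (Poly_Mapping.single n y))" for m n and x y :: 'g
  proof -
    have e: "m + n - 1 = m - 1 + n" "m + n - 1 = m + (n - 1)" by simp_all
    have "loop_tau (bracket (Poly_Mapping.single m x) (Poly_Mapping.single n y)) =
        Poly_Mapping.single (m + n - 1) ((- of_int m + - of_int n) *\<^sub>C bracket x y)"
      by (simp add: bracket_pm_single loop_tau_single)
    also have "\<dots> = Poly_Mapping.single (m - 1 + n) (- of_int m *\<^sub>C bracket x y) +
        Poly_Mapping.single (m + (n - 1)) (- of_int n *\<^sub>C bracket x y)"
      unfolding scaleC_add_left single_add e(1)[symmetric] e(2)[symmetric] by simp
    finally show ?thesis
      by (simp only: bracket_pm_single loop_tau_single bracket_scaleC_left bracket_scaleC_right)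
  qed
  have 2: "loop_tau (bracket (Poly_Mapping.single m x) q) =
      bracket (loop_tau (Poly_Mapping.single m x)) q + bracket (Poly_Mapping.single m x) (loop_tau q)"
    for m x and q :: "int \<Rightarrow>\<^sub>0 'g"
    by (induction q rule: poly_mapping_single_induct) (simp_all add: z bil 1)
  show ?thesis
    by (induction p rule: poly_mapping_single_induct) (simp_all add: z bil 2)
qed

lemma keys_loop_tau: "n \<in> Poly_Mapping.keys (loop_tau p) \<Longrightarrow> n + 1 \<in> Poly_Mapping.keys p"
proof (rule ccontr)
  assume n: "n \<in> Poly_Mapping.keys (loop_tau p)" and "n + 1 \<notin> Poly_Mapping.keys p"
  then have "Poly_Mapping.lookup (loop_tau p) n = 0"
    unfolding loop_tau_def lookup_sum
    by (intro sum.neutral) (auto simp: lookup_single when_def)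
  with n show False by (simp add: in_keys_iff)
qed

lift_definition tau :: "'g::complex_lie_algebra negative_loop \<Rightarrow> 'g negative_loop" is loop_tau
proof -
  show "n < 0" if "\<And>n. n \<in> Poly_Mapping.keys p \<Longrightarrow> n < 0" "n \<in> Poly_Mapping.keys (loop_tau p)"
    for p :: "int \<Rightarrow>\<^sub>0 'g" and n
    using that(1)[OF keys_loop_tau[OF that(2)]] by simp
qed

(* The derivation u \<mapsto> \<tau>u - u\<tau> of U(t^{-1} g[t^{-1}]). *)
definition env_tau :: "'g::complex_lie_algebra negative_loop env_algebra \<Rightarrow> 'g negative_loop env_algebra"
  where "env_tau = env_ext (leibniz env_of tau)"

lemma clinear_tau: "clinear tau"
  by (intro clinearI; transfer) (simp_all add: loop_tau_add loop_tau_scaleC)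

lemma lie_multilinear_tau: "lie_multilinear (leibniz env_of tau)"
  by (rule lie_multilinear_leibniz[OF clinear_tau]) (transfer, rule loop_tau_bracket)

lemma clinear_env_tau: "clinear env_tau"
  unfolding env_tau_def by (rule clinear_env_ext[OF lie_multilinear_tau])

lemma env_tau_prod_list: "env_tau (prod_list (map env_of ys)) = leibniz env_of tau ys"
  unfolding env_tau_def by (rule env_ext_prod_list[OF lie_multilinear_tau])

datatype 'l tau_letter = Tau | Elem 'l

(* Moving a \<tau> to the right past u and using \<tau>\<cdot>1 = 0 turns \<tau>u\<cdot>1 into \<tau>(u)\<cdot>1. *)
fun tau_word :: "'g::complex_lie_algebra negative_loop tau_letter list \<Rightarrow> 'g negative_loop env_algebra" where
  "tau_word [] = 1"
| "tau_word (Tau # w) = env_tau (tau_word w)"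
| "tau_word (Elem y # w) = env_of y * tau_word w"

(* \<varpi>(\<tau>\<^sup>r G)\<cdot>1 for G in S(t^{-1} g[t^{-1}]). *)
definition sym_tau :: "nat \<Rightarrow> 'g::complex_lie_algebra negative_loop sym_algebra \<Rightarrow> 'g negative_loop env_algebra"
  where "sym_tau r =
    sym_ext (\<lambda>ys. permutation_average tau_word (replicate r Tau @ map Elem ys))"

lemma clinear_tau_word: "clinear (\<lambda>x. tau_word (u @ [Elem x] @ v))"
proof (induction u)
  case Nil
  show ?case by (intro clinearI) (simp_all add: env_of_add env_of_scaleC distrib_right scaleC_mult_left)
next
  case (Cons a u)
  show ?case
  proof (cases a)
    case Tau
    then show ?thesis using clinear_compose[OF clinear_env_tau Cons.IH] by simp
  next
    case (Elem y)
    then show ?thesis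
      using clinear_add[OF Cons.IH] clinear_scale[OF Cons.IH]
      by (intro clinearI) (simp_all add: distrib_left scaleC_mult_right)
  qed
qed

lemma symmetric_multilinear_sym_tau:
  "symmetric_multilinear (\<lambda>ys. permutation_average tau_word (replicate r Tau @ map Elem ys))"
  unfolding symmetric_multilinear_def multilinear_def
proof (intro conjI allI impI)
  fix u v :: "'a negative_loop list"
  show "clinear (\<lambda>x. permutation_average tau_word (replicate r Tau @ map Elem (u @ [x] @ v)))"
    using clinear_permutation_average[of tau_word Elem "replicate r Tau @ map Elem u" "map Elem v",
        OF clinear_tau_word]
    by simp
next
  fix xs ys :: "'a negative_loop list" assume "mset xs = mset ys"
  then show "permutation_average tau_word (replicate r Tau @ map Elem xs) =
      permutation_average tau_word (replicate r Tau @ map Elem ys)"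
    by (intro permutation_average_mset) simp
qed

lemma clinear_sym_tau: "clinear (sym_tau r)"
  unfolding sym_tau_def by (rule clinear_sym_ext[OF symmetric_multilinear_sym_tau])

lemma sym_tau_prod_list:
  "sym_tau r (prod_list (map sym_of ys)) =
    permutation_average tau_word (replicate r Tau @ map Elem ys)"
  unfolding sym_tau_def by (rule sym_ext_prod_list[OF symmetric_multilinear_sym_tau])

section \<open>Segal-Sugawara vectors\<close>

(* The symbol of S in U_{\<le>k} / U_{<k}, identified with S^k via symmetrisation, is G. *)
definition has_leading_term :: "nat \<Rightarrow> 'l::complex_lie_algebra env_algebra \<Rightarrow> 'l sym_algebra \<Rightarrow> bool"
  where "has_leading_term k S G \<longleftrightarrow> G \<in> sym_power k \<and> S - sym_to_env G \<in> env_filtration_less k"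

end

theory Submission
  imports Defs "HOL-Computational_Algebra.Polynomial"
begin

text \<open>
  In the vacuum module the vector \<open>\<varpi>(\<tau>\<^sup>r y[-1]\<^sup>m)\<cdot>1\<close> is, up to the factor \<open>(m + r) choose m\<close>, the component of
  degree \<open>m\<close> in \<open>y\<close> of \<open>D\<^sup>m\<^sup>+\<^sup>r|0\<rangle>\<close> with \<open>D = \<tau> + y[-1]\<close>. Hence \<open>S\<close> is the sum over \<open>r\<close> of the evaluations of
  the polynomial map \<open>y \<mapsto> D\<^sup>k|0\<rangle>\<close> at the symmetric tensors \<open>H\<close> (for \<open>r = 0\<close>) and \<open>M r\<close>; no Rybnikov type
  theorem is needed, since \<open>x[m] D\<^sup>k|0\<rangle>\<close> can be computed for all \<open>m \<ge> 0\<close>. With \<open>A = ad y\<close> it consists of a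
  multiple of \<open>K(x, y) D\<^sup>k\<^sup>-\<^sup>m|0\<rangle>\<close>, which invariance turns into insertions of \<open>(A\<^sup>2 x)[-1]\<close> between powers of
  \<open>D\<close>, and of insertions of \<open>(A (1 - A) \<dots> (m - A) x)[-1]\<close>. The condition on \<open>m_map (2 * r + 1) H\<close> replaces the
  evaluation at \<open>M r\<close> by the evaluation at \<open>H\<close> with \<open>2 r\<close> further factors \<open>A\<close>, so that summing over \<open>r\<close> divides
  by \<open>1 - A\<^sup>2\<close>. Insertions with weights of total sum \<open>0\<close> are combinations of commutators with \<open>D\<close>, which act
  as \<open>1 + A\<close>; this clears the denominator, and the remaining terms vanish because their degree in \<open>y\<close> is
  less than \<open>k\<close>. For the evenly weighted insertions odd powers of \<open>A\<close> vanish by invariance, and the even ones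
  cancel against the Killing form at the critical level.
\<close>

text \<open>A symmetric tensor is not a point, so \<open>H\<close> and each \<open>M r\<close> are
  replaced by finite combinations of points that reproduce them in all degrees below a bound
  \<open>q\<close>; every polynomial map that is evaluated must keep its degree below
  \<open>q\<close>. The exchange of \<open>M r\<close> for \<open>H\<close> replaces one factor A,
  the one applied first to x, by 2 r + 1 such factors. Hence every insertion needs at least one A
  beforehand. The insertions made by moving x[m] carry the factor A, and for this reason the Killing
  term is rewritten with A^2 x before the exchange. The weights \<open>(e + m) choose m\<close> of
  the insertions are not constant, so they are split into their mean and a remainder of sum zero.
  Only the remainder supplies a factor 1 + A. For the mean, division by 1 + A leaves the remainder
  (m + 1)!/2, the value at A = -1 of (2 - A) ... (m - A). Multiplied by the mean
  \<open>(k choose m) / (m + 1)\<close>, it is \<open>m! (k choose m) / 2\<close>, which is exactly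
  the coefficient of the Killing term at the critical level.\<close>

section \<open>Linear maps and linear extension from finitely supported functions\<close>

lemma clinear_zero: "clinear f \<Longrightarrow> f 0 = 0"
  using clinear_scale[of f 0 0] by simp

lemma clinear_diff: "clinear f \<Longrightarrow> f (x - y) = f x - f y"
  using clinear_add[of f "x - y" y] by simp

lemma clinear_minus: "clinear f \<Longrightarrow> f (- x) = - f x"
  using clinear_diff[of f 0 x] by (simp add: clinear_zero)

lemma clinear_sum_distrib: "clinear f \<Longrightarrow> f (\<Sum>i\<in>A. g i) = (\<Sum>i\<in>A. f (g i))"
  by (induction A rule: infinite_finite_induct) (simp_all add: clinear_add clinear_zero)

lemma clinear_lin_ext_distrib: "clinear f \<Longrightarrow> f (lin_ext E p) = lin_ext (\<lambda>x. f (E x)) p"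
  by (simp add: lin_ext_def clinear_sum_distrib clinear_scale)

lemma lin_ext_plus_fun: "lin_ext (\<lambda>x. E x + G x) p = lin_ext E p + lin_ext G p"
  by (simp add: lin_ext_def scaleC_add_right sum.distrib)

lemma lin_ext_scaleC_fun: "lin_ext (\<lambda>x. c *\<^sub>C E x) p = c *\<^sub>C lin_ext E p"
  by (simp add: lin_ext_def complex_vector.scale_sum_right scaleC_scaleC mult.commute)

lemma lin_ext_uminus_fun: "lin_ext (\<lambda>x. - E x) p = - lin_ext E p"
  by (simp add: lin_ext_def sum_negf)

lemma lin_ext_diff_fun: "lin_ext (\<lambda>x. E x - G x) p = lin_ext E p - lin_ext G p"
  by (simp add: lin_ext_def complex_vector.scale_right_diff_distrib sum_subtractf)

lemma lin_ext_zero_fun [simp]: "lin_ext (\<lambda>x. 0) p = 0"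
  by (simp add: lin_ext_def)

lemma lin_ext_sum_fun: "lin_ext (\<lambda>x. \<Sum>i\<in>A. E i x) p = (\<Sum>i\<in>A. lin_ext (E i) p)"
  unfolding lin_ext_def complex_vector.scale_sum_right by (rule sum.swap)

lemma clinear_scaleC_left: "clinear (\<lambda>c :: complex. c *\<^sub>C w)"
  by (rule clinearI) (simp_all add: scaleC_add_left scaleC_scaleC scaleC_complex_def)

lemma clinear_scaleC_right: "clinear (\<lambda>x. c *\<^sub>C x)"
  by (rule clinear_scaled[OF clinearI]) simp_all

lemma clinear_functional_scale: "clinear f \<Longrightarrow> f (c *\<^sub>C x) = c * f x" for f :: "'a::complex_vector \<Rightarrow> complex"
  using clinear_scale[of f c x] by (simp only: scaleC_complex_def)

lemma clinear_id: "clinear (\<lambda>x. x)"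
  by (rule clinearI) simp_all

lemma clinear_apply_endo: "clinear (apply_endo f)"
  using apply_endo[of f] by simp

lemma clinear_apply_endo_left: "clinear (\<lambda>f. apply_endo f x)"
  by (rule clinearI) (simp_all add: plus_endo.rep_eq scaleC_endo.rep_eq)

section \<open>Interpolation and polarisation\<close>

text \<open>The nodes are the powers of a primitive \<open>q\<close>-th root of unity, so that
  orthogonality of characters gives the weights explicitly, as in the inverse discrete Fourier
  transform.\<close>

lemma interpolation:
  assumes "j < q"
  obtains a s :: "nat \<Rightarrow> complex"
  where "\<And>l. l < q \<Longrightarrow> (\<Sum>t<q. a t * s t ^ l) = (if l = j then 1 else 0)"
proof -
  define \<zeta> where "\<zeta> l = cis (2 * pi * real l / real q)" for l
  have q: "q > 0" using assms by simp
  have inj: "inj_on \<zeta> {..<q}"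
    using bij_betw_roots_unity[OF q] unfolding \<zeta>_def by (rule bij_betw_imp_inj_on)
  have pow: "\<zeta> l ^ q = 1" for l
    using q cis_multiple_2pi[of "real l"] by (simp add: \<zeta>_def DeMoivre)
  have \<zeta>: "\<zeta> 1 ^ l = \<zeta> l" for l
    by (simp add: \<zeta>_def DeMoivre field_simps)
  have "(\<Sum>t<q. inverse (\<zeta> j) ^ t / of_nat q * (\<zeta> 1 ^ t) ^ l) = (if l = j then 1 else 0)" if l: "l < q" for l
  proof -
    have e: "inverse (\<zeta> j) ^ t / of_nat q * (\<zeta> 1 ^ t) ^ l = (\<zeta> l / \<zeta> j) ^ t / of_nat q" for t
    proof -
      have "(\<zeta> 1 ^ t) ^ l = \<zeta> l ^ t" by (metis \<zeta> power_mult mult.commute)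
      then show ?thesis by (simp add: field_simps power_divide)
    qed
    show ?thesis
    proof (cases "l = j")
      case True
      then show ?thesis unfolding e using q by (simp add: \<zeta>_def)
    next
      case False
      then have "\<zeta> l \<noteq> \<zeta> j" using inj l assms by (auto simp: inj_on_def)
      then have z: "\<zeta> l / \<zeta> j \<noteq> 1" by (simp add: \<zeta>_def)
      have "(\<Sum>t<q. (\<zeta> l / \<zeta> j) ^ t) = 0"
        unfolding geometric_sum[OF z] by (simp add: power_divide pow)
      then show ?thesis unfolding e using False by (simp flip: sum_divide_distrib)
    qed
  qed
  then show ?thesis by (rule that)
qed

text \<open>The weights depend on \<open>j\<close> and \<open>n\<close> alone: a coefficient of a
  vector-valued polynomial in \<open>s\<close> is a fixed linear combination of its values.\<close>

lemma coefficient_extraction: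
  assumes "j \<le> n"
  obtains a s :: "nat \<Rightarrow> complex"
  where "\<And>w :: nat \<Rightarrow> 'a::complex_vector. w j = (\<Sum>t\<le>n. a t *\<^sub>C (\<Sum>l\<le>n. s t ^ l *\<^sub>C w l))"
proof -
  from assms have "j < Suc n" by simp
  from interpolation[OF this] obtain a s where
    as: "\<And>l. l < Suc n \<Longrightarrow> (\<Sum>t<Suc n. a t * s t ^ l) = (if l = j then 1 else (0::complex))" by blast
  have "(\<Sum>t\<le>n. a t *\<^sub>C (\<Sum>l\<le>n. s t ^ l *\<^sub>C w l)) = w j" for w :: "nat \<Rightarrow> 'a"
  proof -
    have "(\<Sum>t\<le>n. a t *\<^sub>C (\<Sum>l\<le>n. s t ^ l *\<^sub>C w l)) = (\<Sum>l\<le>n. (\<Sum>t\<le>n. a t * s t ^ l) *\<^sub>C w l)"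
      unfolding complex_vector.scale_sum_right scaleC_scaleC complex_vector.scale_sum_left
      by (rule sum.swap)
    also have "\<dots> = (\<Sum>l\<le>n. if l = j then w l else 0)"
      using as by (intro sum.cong refl) (simp add: lessThan_Suc_atMost scaleC_one)
    also have "\<dots> = w j" using assms by simp
    finally show ?thesis .
  qed
  then show ?thesis by (intro that) (rule sym)
qed

lemma coefficient_in_subspace:
  fixes w :: "nat \<Rightarrow> 'a::complex_vector"
  assumes "complex_vector.subspace W" "\<And>s. (\<Sum>l\<le>n. s ^ l *\<^sub>C w l) \<in> W" "j \<le> n"
  shows "w j \<in> W"
proof -
  obtain a s where as: "\<And>w :: nat \<Rightarrow> 'a. w j = (\<Sum>t\<le>n. a t *\<^sub>C (\<Sum>l\<le>n. s t ^ l *\<^sub>C w l))"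
    using coefficient_extraction[OF assms(3)] by blast
  have "w j = (\<Sum>t\<le>n. a t *\<^sub>C (\<Sum>l\<le>n. s t ^ l *\<^sub>C w l))" by (rule as)
  also have "\<dots> \<in> W"
    by (intro complex_vector.subspace_sum[OF assms(1)] complex_vector.subspace_scale[OF assms(1)] assms(2))
  finally show ?thesis .
qed

lemma coefficients_unique:
  assumes "\<And>s. (\<Sum>l\<le>n. s ^ l *\<^sub>C v l) = (\<Sum>l\<le>n. s ^ l *\<^sub>C w l)" "j \<le> n"
  shows "v j = w j"
proof -
  have "(\<Sum>l\<le>n. s ^ l *\<^sub>C (v l - w l)) \<in> {0}" for s
    using assms(1)[of s] by (simp add: complex_vector.scale_right_diff_distrib sum_subtractf)
  from coefficient_in_subspace[OF complex_vector.subspace_single_0 this assms(2)] show ?thesis by simp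
qed

text \<open>\<open>h y\<close> and \<open>h (d y)\<close> need not commute, hence the Leibniz sum as
  coefficient of \<open>s\<close>. The range runs to \<open>Suc n\<close> so that index 1 exists for
  \<open>n = 0\<close>.\<close>

lemma power_first_order:
  fixes h :: "'l \<Rightarrow> 'a::complex_algebra_1"
  shows "\<exists>w. w 0 = h y ^ n \<and> w 1 = leibniz h d (replicate n y) \<and>
    (\<forall>s. (h y + s *\<^sub>C h (d y)) ^ n = (\<Sum>l\<le>Suc n. s ^ l *\<^sub>C w l))"
proof (induction n)
  case 0
  show ?case
    by (intro exI[of _ "\<lambda>l. if l = 0 then 1 else 0"]) (simp add: scaleC_one)
next
  case (Suc n)
  then obtain w where w: "w 0 = h y ^ n" "w 1 = leibniz h d (replicate n y)"
    "\<And>s. (h y + s *\<^sub>C h (d y)) ^ n = (\<Sum>l\<le>Suc n. s ^ l *\<^sub>C w l)" by blast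
  \<comment> \<open>Values of \<open>w\<close> above \<open>Suc n\<close> are arbitrary, hence the
    cut-off in the first term.\<close>
  define w' where "w' l = (if l \<le> Suc n then h y * w l else 0) + (if l > 0 then h (d y) * w (l - 1) else 0)"
      for l
  have pl: "prod_list (map h (replicate n y)) = h y ^ n" by (induction n) simp_all
  have "(h y + s *\<^sub>C h (d y)) ^ Suc n = (\<Sum>l\<le>Suc (Suc n). s ^ l *\<^sub>C w' l)" for s
  proof -
    have "(\<Sum>l\<le>Suc (Suc n). s ^ l *\<^sub>C w' l) = (\<Sum>l\<le>Suc (Suc n). s ^ l *\<^sub>C (if l \<le> Suc n then h y * w l else 0))
        + (\<Sum>l\<le>Suc (Suc n). s ^ l *\<^sub>C (if l > 0 then h (d y) * w (l - 1) else 0))"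
      unfolding w'_def by (simp only: scaleC_add_right sum.distrib)
    also have "(\<Sum>l\<le>Suc (Suc n). s ^ l *\<^sub>C (if l \<le> Suc n then h y * w l else 0)) =
        h y * (\<Sum>l\<le>Suc n. s ^ l *\<^sub>C w l)"
      unfolding sum_distrib_left scaleC_mult_right[symmetric]
      by (subst sum.atMost_Suc) (auto simp: scaleC_mult_right intro!: sum.cong)
    also have "(\<Sum>l\<le>Suc (Suc n). s ^ l *\<^sub>C (if l > 0 then h (d y) * w (l - 1) else 0)) =
        (s *\<^sub>C h (d y)) * (\<Sum>l\<le>Suc n. s ^ l *\<^sub>C w l)"
      unfolding sum_distrib_left
      by (subst sum.atMost_Suc_shift) (simp add: scaleC_mult_right scaleC_mult_left scaleC_scaleC mult.commute)
    finally show ?thesis unfolding power_Suc w(3) by (simp only: distrib_right)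
  qed
  moreover have "w' 0 = h y ^ Suc n" "w' 1 = leibniz h d (replicate (Suc n) y)"
    using w(1,2) by (simp_all add: w'_def pl add.commute)
  ultimately show ?case by blast
qed

lemma prod_list_replicate: "prod_list (map h (replicate n y)) = h y ^ n"
  by (induction n) simp_all

lemma permute_list_replicate: "\<sigma> permutes {..<n} \<Longrightarrow> permute_list \<sigma> (replicate n y) = replicate n y"
  by (rule nth_equalityI) (auto simp: permute_list_nth permutes_in_image[THEN iffD2, of \<sigma> "{..<n}", simplified])

lemma permutation_average_replicate: "permutation_average f (replicate n y) = f (replicate n y)"
proof -
  have "(\<Sum>\<sigma> | \<sigma> permutes {..<n}. f (permute_list \<sigma> (replicate n y))) =
      (\<Sum>\<sigma> | \<sigma> permutes {..<n}. f (replicate n y))"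
    by (intro sum.cong refl) (simp add: permute_list_replicate)
  also have "\<dots> = of_nat (fact n) *\<^sub>C f (replicate n y)"
    by (simp add: card_permutations complex_vector.sum_constant_scale)
  finally show ?thesis
    by (simp add: permutation_average_def scaleC_scaleC scaleC_one)
qed

lemma sym_to_tensor_power: "sym_to_tensor (sym_of y ^ n) = tensor_of y ^ n"
  using sym_to_tensor_prod_list[of "replicate n y"]
  by (simp only: prod_list_replicate permutation_average_replicate)

text \<open>Symmetrisation sends powers to powers. Comparing the terms linear in \<open>s\<close> of
  the \<open>n\<close>-th power of \<open>y + s *\<^sub>C d y\<close> on both sides shows that it
  matches the Leibniz sums as well.\<close>

lemma sym_to_tensor_leibniz:
  "sym_to_tensor (leibniz sym_of d (replicate n y)) = leibniz tensor_of d (replicate n y)"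
proof -
  obtain v where v: "v 1 = leibniz sym_of d (replicate n y)"
    "\<And>s. (sym_of y + s *\<^sub>C sym_of (d y)) ^ n = (\<Sum>l\<le>Suc n. s ^ l *\<^sub>C v l)"
    using power_first_order[of sym_of y n d] by blast
  obtain w where w: "w 1 = leibniz tensor_of d (replicate n y)"
    "\<And>s. (tensor_of y + s *\<^sub>C tensor_of (d y)) ^ n = (\<Sum>l\<le>Suc n. s ^ l *\<^sub>C w l)"
    using power_first_order[of tensor_of y n d] by blast
  have "(\<Sum>l\<le>Suc n. s ^ l *\<^sub>C sym_to_tensor (v l)) = (\<Sum>l\<le>Suc n. s ^ l *\<^sub>C w l)" for s
  proof -
    have "(\<Sum>l\<le>Suc n. s ^ l *\<^sub>C sym_to_tensor (v l)) = sym_to_tensor ((sym_of (y + s *\<^sub>C d y)) ^ n)"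
      by (simp only: sym_of_add sym_of_scaleC v(2) clinear_sum_distrib[OF clinear_sym_to_tensor]
          clinear_scale[OF clinear_sym_to_tensor])
    then show ?thesis by (simp only: sym_to_tensor_power tensor_of_add tensor_of_scaleC w(2))
  qed
  from coefficients_unique[OF this, of 1] show ?thesis by (simp add: v(1)[symmetric] w(1)[symmetric])
qed

text \<open>The term linear in \<open>s\<close> of the given elements of \<open>W\<close> is
  \<open>Suc n\<close> times the desired one.\<close>

lemma polarisation_step:
  fixes x :: "'v::complex_vector sym_algebra"
  assumes W: "complex_vector.subspace W"
    and pow: "\<And>s. (x + s *\<^sub>C z) ^ Suc n * u \<in> W"
  shows "x ^ n * (z * u) \<in> W"
proof -
  have "(\<Sum>l\<le>Suc n. s ^ l *\<^sub>C (of_nat (Suc n choose l) *\<^sub>C (z ^ l * x ^ (Suc n - l) * u))) \<in> W" for s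
  proof -
    have "(s *\<^sub>C z) ^ l = s ^ l *\<^sub>C z ^ l" for l
      by (induction l) (simp_all add: scaleC_mult_left scaleC_mult_right scaleC_scaleC scaleC_one mult.commute)
    moreover have "of_nat m * v = of_nat m *\<^sub>C v" for m and v :: "'v sym_algebra"
      by (induction m) (simp_all add: scaleC_add_left scaleC_one distrib_right)
    ultimately have "(x + s *\<^sub>C z) ^ Suc n * u =
        (\<Sum>l\<le>Suc n. s ^ l *\<^sub>C (of_nat (Suc n choose l) *\<^sub>C (z ^ l * x ^ (Suc n - l) * u)))"
      unfolding add.commute[of x] binomial_ring sum_distrib_right
      by (intro sum.cong refl) (simp add: mult.assoc scaleC_mult_left scaleC_mult_right
          complex_vector.scale_left_commute)
    then show ?thesis using pow by metis
  qed
  from coefficient_in_subspace[OF W this, of 1]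
  have "of_nat (Suc n) *\<^sub>C (x ^ n * (z * u)) \<in> W" by (simp add: ac_simps)
  from complex_vector.subspace_scale[OF W this, of "1 / of_nat (Suc n)"] show ?thesis
    by (simp add: scaleC_scaleC scaleC_one del: of_nat_Suc)
qed

text \<open>Polarisation absorbs the factors of a product into a single power, one factor at a
  time.\<close>

lemma sym_power_powers: "sym_power k = complex_vector.span (range (\<lambda>y. sym_of y ^ k))"
proof
  let ?W = "complex_vector.span (range (\<lambda>y :: 'a. sym_of y ^ k))"
  have W: "complex_vector.subspace ?W" by (rule complex_vector.subspace_span)
  have "sym_of y ^ n * prod_list (map sym_of zs) \<in> ?W" if "n + length zs = k" for n y zs
    using that
  proof (induction zs arbitrary: n y)
    case Nil
    then show ?case by (auto intro: complex_vector.span_base)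
  next
    case (Cons z zs)
    have "(sym_of y + s *\<^sub>C sym_of z) ^ Suc n * prod_list (map sym_of zs) \<in> ?W" for s
      using Cons.IH[of "Suc n" "y + s *\<^sub>C z"] Cons.prems by (simp add: sym_of_add sym_of_scaleC)
    from polarisation_step[OF W this] show ?case by simp
  qed
  from this[of 0] show "sym_power k \<subseteq> ?W"
    unfolding sym_power_def by (intro complex_vector.span_minimal W) auto
  show "?W \<subseteq> sym_power k"
    unfolding sym_power_def
  proof (intro complex_vector.span_mono image_subsetI CollectI exI conjI)
    show "sym_of y ^ k = prod_list (map sym_of (replicate k y))" "length (replicate k y) = k" for y :: 'a
      by (simp_all only: prod_list_replicate length_replicate)
  qed
qed

text \<open>A finitely supported \<open>P\<close> stands for the evaluation functional
  \<open>E \<mapsto> lin_ext E P = \<Sum>\<^sub>y P\<^sub>y E(y)\<close> on polynomial maps. When it represents \<open>F \<in> S\<^sup>l\<close>, it extracts the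
  component of degree \<open>l\<close> of \<open>E\<close> and applies the corresponding multilinear map to \<open>F\<close>.\<close>
definition represents :: "nat \<Rightarrow> nat \<Rightarrow> 'v::complex_vector sym_algebra \<Rightarrow> ('v \<Rightarrow>\<^sub>0 complex) \<Rightarrow> bool"
  where "represents q l F P \<longleftrightarrow> (\<forall>j<q. lin_ext (\<lambda>y. sym_of y ^ j) P = (if j = l then F else 0))"

lemma represents_exists:
  fixes F :: "'v::complex_vector sym_algebra"
  assumes "F \<in> sym_power l" "l < q"
  shows "\<exists>P. represents q l F P"
proof -
  let ?W = "{F :: 'v sym_algebra. \<exists>P. represents q l F P}"
  have "complex_vector.subspace ?W"
  proof (rule complex_vector.subspaceI)
    show "0 \<in> ?W" by (auto simp: represents_def intro!: exI[of _ 0])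
    show "F + G \<in> ?W" if FG: "F \<in> ?W" "G \<in> ?W" for F G
    proof -
      obtain P Q where "represents q l F P" "represents q l G Q" using FG by auto
      then have "represents q l (F + G) (P + Q)" by (simp add: represents_def lin_ext_add)
      then show ?thesis by blast
    qed
    show "c *\<^sub>C F \<in> ?W" if "F \<in> ?W" for c and F :: "'v sym_algebra"
    proof -
      obtain P where "represents q l F P" using \<open>F \<in> ?W\<close> by auto
      then have "represents q l (c *\<^sub>C F) (c *\<^sub>C P)" by (simp add: represents_def lin_ext_scaleC)
      then show ?thesis by blast
    qed
  qed
  moreover have "sym_of y ^ l \<in> ?W" for y :: 'v
  proof -
    obtain a s where as: "\<And>j. j < q \<Longrightarrow> (\<Sum>t<q. a t * s t ^ j) = (if j = l then 1 else (0::complex))"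
      using interpolation[OF assms(2)] by blast
    \<comment> \<open>The interpolation weights on multiples of \<open>y\<close> remove every degree
      below \<open>q\<close> except \<open>l\<close>.\<close>
    define P where "P = (\<Sum>t<q. Poly_Mapping.single (s t *\<^sub>C y) (a t))"
    have "lin_ext (\<lambda>y. sym_of y ^ j) P = (if j = l then sym_of y ^ l else 0)" if "j < q" for j
    proof -
      have p: "(c *\<^sub>C x) ^ j = c ^ j *\<^sub>C x ^ j" for c and x :: "'v sym_algebra"
        by (induction j) (simp_all add: scaleC_mult_left scaleC_mult_right scaleC_scaleC scaleC_one
            mult.commute)
      have "lin_ext (\<lambda>y. sym_of y ^ j) P = (\<Sum>t<q. (a t * s t ^ j) *\<^sub>C sym_of y ^ j)"
        by (simp add: P_def clinear_sum_distrib[OF clinear_lin_ext] sym_of_scaleC p scaleC_scaleC)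
      also have "\<dots> = (if j = l then sym_of y ^ l else 0)"
        using as[OF that] by (simp add: scaleC_one flip: complex_vector.scale_sum_left)
      finally show ?thesis .
    qed
    then have "represents q l (sym_of y ^ l) P" by (simp add: represents_def)
    then show ?thesis by blast
  qed
  ultimately have "sym_power l \<subseteq> ?W"
    unfolding sym_power_powers by (intro complex_vector.span_minimal) auto
  with assms(1) show ?thesis by blast
qed

lemma represents_linear:
  assumes "represents q l F P" "j < q" "clinear f"
  shows "lin_ext (\<lambda>y. f (sym_of y ^ j)) P = (if j = l then f F else 0)"
  using assms clinear_lin_ext_distrib[OF assms(3), of "\<lambda>y. sym_of y ^ j" P]
  by (auto simp: represents_def clinear_zero)

lemma represents_tensor:
  assumes "represents q l F P" "j < q"
  shows "lin_ext (\<lambda>y. tensor_of y ^ j) P = (if j = l then sym_to_tensor F else 0)"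
  using represents_linear[OF assms clinear_sym_to_tensor] by (simp add: sym_to_tensor_power)

section \<open>Polynomial maps\<close>

abbreviation eval_all :: "('g \<Rightarrow> complex) list \<Rightarrow> 'g \<Rightarrow> complex"
  where "eval_all \<mu>s y \<equiv> prod_list (map (\<lambda>\<mu>. \<mu> y) \<mu>s)"

fun eval_all_deriv :: "('g \<Rightarrow> complex) list \<Rightarrow> 'g \<Rightarrow> 'g \<Rightarrow> complex" where
  "eval_all_deriv [] y z = 0"
| "eval_all_deriv (\<mu> # \<mu>s) y z = \<mu> z * eval_all \<mu>s y + \<mu> y * eval_all_deriv \<mu>s y z"

text \<open>\<open>polymap A E E'\<close>: \<open>E\<close> is a polynomial map whose homogeneous components have degrees in \<open>A\<close>,
  and \<open>E' y z\<close> is its derivative at \<open>y\<close> in the direction \<open>z\<close>.\<close>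
inductive polymap :: "nat set \<Rightarrow> ('g::complex_vector \<Rightarrow> 'w::complex_vector) \<Rightarrow> ('g \<Rightarrow> 'g \<Rightarrow> 'w) \<Rightarrow> bool"
  for A where
  zero: "polymap A (\<lambda>y. 0) (\<lambda>y z. 0)"
| add: "polymap A E E' \<Longrightarrow> length \<mu>s \<in> A \<Longrightarrow> \<forall>\<mu>\<in>set \<mu>s. clinear \<mu> \<Longrightarrow>
    polymap A (\<lambda>y. eval_all \<mu>s y *\<^sub>C w + E y) (\<lambda>y z. eval_all_deriv \<mu>s y z *\<^sub>C w + E' y z)"

lemma polymap_monomial:
  assumes "length \<mu>s \<in> A" "\<forall>\<mu>\<in>set \<mu>s. clinear \<mu>"
  shows "polymap A (\<lambda>y. eval_all \<mu>s y *\<^sub>C w) (\<lambda>y z. eval_all_deriv \<mu>s y z *\<^sub>C w)"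
  using polymap.add[OF polymap.zero assms, of w] by simp

lemma polymap_plus:
  assumes "polymap A E E'" "polymap A G G'"
  shows "polymap A (\<lambda>y. E y + G y) (\<lambda>y z. E' y z + G' y z)"
  using assms
proof induction
  case (add E E' \<mu>s w)
  from polymap.add[OF add.IH[OF add.prems] add.hyps(2,3), of w] show ?case by (simp add: add.assoc)
qed simp

lemma polymap_sum:
  "(\<And>i. i \<in> I \<Longrightarrow> polymap A (E i) (E' i)) \<Longrightarrow> polymap A (\<lambda>y. \<Sum>i\<in>I. E i y) (\<lambda>y z. \<Sum>i\<in>I. E' i y z)"
  by (induction I rule: infinite_finite_induct) (simp_all add: polymap_plus polymap.zero)

lemma polymap_mono: "polymap A E E' \<Longrightarrow> A \<subseteq> B \<Longrightarrow> polymap B E E'"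
  by (induction rule: polymap.induct) (auto intro: polymap.intros)

lemma polymap_linear_image:
  assumes "polymap A E E'" "clinear L"
  shows "polymap A (\<lambda>y. L (E y)) (\<lambda>y z. L (E' y z))"
  using assms(1)
proof induction
  case zero
  show ?case by (simp add: clinear_zero[OF assms(2)] polymap.zero)
next
  case (add E E' \<mu>s w)
  from polymap.add[OF add.IH add.hyps(2,3), of "L w"] show ?case
    by (simp add: clinear_add[OF assms(2)] clinear_scale[OF assms(2)])
qed

lemma polymap_const: "0 \<in> A \<Longrightarrow> polymap A (\<lambda>y. w) (\<lambda>y z. 0)"
  using polymap_monomial[of "[]" A w] by (simp add: scaleC_one)

lemma polymap_functional:
  fixes \<mu> :: "'g::complex_vector \<Rightarrow> complex"
  shows "clinear \<mu> \<Longrightarrow> 1 \<in> A \<Longrightarrow> polymap A \<mu> (\<lambda>y z. \<mu> z)"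
  using polymap_monomial[of "[\<mu>]" A "1 :: complex"] by (simp add: scaleC_complex_def)

lemma eval_all_deriv_append:
  "eval_all_deriv (\<mu>s @ \<nu>s) y z = eval_all_deriv \<mu>s y z * eval_all \<nu>s y + eval_all \<mu>s y * eval_all_deriv \<nu>s y z"
  by (induction \<mu>s) (simp_all add: algebra_simps)

lemma polymap_bilinear:
  assumes E: "polymap A E E'" and G: "polymap B G G'"
    and left: "\<And>v. clinear (\<lambda>u. b u v)" and right: "\<And>u. clinear (b u)"
    and C: "\<And>i j. i \<in> A \<Longrightarrow> j \<in> B \<Longrightarrow> i + j \<in> C"
  shows "polymap C (\<lambda>y. b (E y) (G y)) (\<lambda>y z. b (E' y z) (G y) + b (E y) (G' y z))"
  using E
proof induction
  case zero
  show ?case using clinear_zero[OF left] by (simp add: polymap.zero)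
next
  case (add E E' \<mu>s w)
  have "polymap C (\<lambda>y. eval_all \<mu>s y *\<^sub>C b w (G y))
      (\<lambda>y z. eval_all_deriv \<mu>s y z *\<^sub>C b w (G y) + eval_all \<mu>s y *\<^sub>C b w (G' y z))"
    using G
  proof induction
    case zero
    show ?case by (simp add: clinear_zero[OF right] polymap.zero)
  next
    case (add G G' \<nu>s w')
    from polymap.add[OF add.IH, of "\<mu>s @ \<nu>s" "b w w'"] add.hyps(2,3) \<open>length \<mu>s \<in> A\<close> C \<open>\<forall>\<mu>\<in>set \<mu>s. clinear \<mu>\<close>
    show ?case
      by (simp add: ball_Un clinear_add[OF right] clinear_scale[OF right] eval_all_deriv_append
          scaleC_add_left scaleC_add_right scaleC_scaleC ac_simps)
  qed
  from polymap_plus[OF this add.IH] show ?case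
    by (simp add: clinear_add[OF left] clinear_scale[OF left] ac_simps)
qed

lemma polymap_scaleC:
  assumes "polymap A E E'" "polymap B G G'" "\<And>i j. i \<in> A \<Longrightarrow> j \<in> B \<Longrightarrow> i + j \<in> C"
  shows "polymap C (\<lambda>y. E y *\<^sub>C G y) (\<lambda>y z. E' y z *\<^sub>C G y + E y *\<^sub>C G' y z)"
  by (rule polymap_bilinear[OF assms(1,2) clinear_scaleC_left clinear_scaleC_right assms(3)])

lemma polymap_endo_mult:
  assumes "polymap A E E'" "polymap B G G'" "\<And>i j. i \<in> A \<Longrightarrow> j \<in> B \<Longrightarrow> i + j \<in> C"
  shows "polymap C (\<lambda>y. E y * G y :: 'w::complex_vector endo) (\<lambda>y z. E' y z * G y + E y * G' y z)"
  by (rule polymap_bilinear[OF assms(1,2) _ _ assms(3)])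
    (intro clinearI; simp add: distrib_left distrib_right endo_scaleC_mult)+

text \<open>In each monomial one factor \<open>y\<close> is replaced by \<open>d y\<close>, which is
  again linear in \<open>y\<close>; the degree is preserved.\<close>

lemma polymap_deriv:
  assumes "polymap A E E'" "clinear d"
  shows "\<exists>E''. polymap A (\<lambda>y. E' y (d y)) E''"
  using assms(1)
proof induction
  case zero
  show ?case by (blast intro: polymap.zero)
next
  case (add E E' \<mu>s w)
  have "\<exists>D. polymap {length \<mu>s} (\<lambda>y. eval_all_deriv \<mu>s y (d y)) D"
    using add.hyps(3)
  proof (induction \<mu>s)
    case Nil
    show ?case by (auto intro: polymap.zero)
  next
    case (Cons \<mu> \<mu>s)
    then obtain D where D: "polymap {length \<mu>s} (\<lambda>y. eval_all_deriv \<mu>s y (d y)) D" by auto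
    have "polymap {Suc (length \<mu>s)} (\<lambda>y. eval_all ((\<lambda>y. \<mu> (d y)) # \<mu>s) y *\<^sub>C 1)
        (\<lambda>y z. eval_all_deriv ((\<lambda>y. \<mu> (d y)) # \<mu>s) y z *\<^sub>C (1 :: complex))"
      using Cons.prems clinear_compose[OF _ assms(2)] by (intro polymap_monomial) auto
    moreover have "polymap {Suc (length \<mu>s)} (\<lambda>y. \<mu> y *\<^sub>C eval_all_deriv \<mu>s y (d y))
        (\<lambda>y z. \<mu> z *\<^sub>C eval_all_deriv \<mu>s y (d y) + \<mu> y *\<^sub>C D y z)"
      using Cons.prems by (intro polymap_scaleC[OF polymap_functional[of _ "{1}"] D]) auto
    ultimately have "polymap {Suc (length \<mu>s)}
        (\<lambda>y. eval_all ((\<lambda>y. \<mu> (d y)) # \<mu>s) y *\<^sub>C 1 + \<mu> y *\<^sub>C eval_all_deriv \<mu>s y (d y))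
            (\<lambda>y z. eval_all_deriv ((\<lambda>y. \<mu> (d y)) # \<mu>s) y z *\<^sub>C 1 + (\<mu> z *\<^sub>C eval_all_deriv \<mu>s y (d y) +
            \<mu> y *\<^sub>C D y z))"
      by (rule polymap_plus)
    then show ?case by (auto simp: scaleC_complex_def)
  qed
  then obtain D where D: "polymap {length \<mu>s} (\<lambda>y. eval_all_deriv \<mu>s y (d y)) D" by blast
  obtain E'' where "polymap A (\<lambda>y. E' y (d y)) E''" using add.IH by blast
  from polymap_plus[OF polymap_linear_image[OF polymap_mono[OF D], of A "\<lambda>c. c *\<^sub>C w"] this] add.hyps(2)
  show ?case using clinear_scaleC_left by auto
qed

section \<open>Coordinates and polynomiality of linear maps\<close>

text \<open>The basis that underlies \<open>endo_trace\<close>, so that the Killing form expands in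
  the functionals \<open>coord b\<close>.\<close>

definition basis :: "'v::complex_vector set"
  where "basis = complex_vector.extend_basis {}"

definition coord :: "'v::complex_vector \<Rightarrow> 'v \<Rightarrow> complex"
  where "coord b x = complex_vector.representation basis x b"

lemma clinear_coord: "clinear (coord b)"
  unfolding coord_def basis_def
  by (intro clinearI)
    (simp_all add: complex_vector.representation_add complex_vector.representation_scale basis_indep basis_span
      scaleC_complex_def)

lemma sum_coord:
  fixes x :: "'v::complex_vector"
  shows "finite (basis :: 'v set) \<Longrightarrow> (\<Sum>b\<in>basis. coord b x *\<^sub>C b) = x"
  unfolding coord_def basis_def
  by (rule complex_vector.sum_representation_eq) (simp_all add: basis_indep basis_span)

lemma clinear_sum_coord:
  fixes L :: "'v::complex_vector \<Rightarrow> 'w::complex_vector"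
  assumes "finite (basis :: 'v set)" "clinear L"
  shows "(\<Sum>b\<in>basis. coord b x *\<^sub>C L b) = L x"
proof -
  have "L x = L (\<Sum>b\<in>basis. coord b x *\<^sub>C b)" using sum_coord[OF assms(1), of x] by simp
  then show ?thesis by (simp add: clinear_sum_distrib[OF assms(2)] clinear_scale[OF assms(2)])
qed

lemma polymap_linear:
  fixes L :: "'v::complex_vector \<Rightarrow> 'w::complex_vector"
  assumes "finite (basis :: 'v set)" "clinear L" "1 \<in> A"
  shows "polymap A L (\<lambda>y z. L z)"
proof -
  have "polymap A (\<lambda>y. \<Sum>b\<in>basis. coord b y *\<^sub>C L b) (\<lambda>y z. \<Sum>b\<in>basis. coord b z *\<^sub>C L b)"
    using polymap_monomial[of "[coord b]" A "L b" for b] assms(3)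
        by (intro polymap_sum) (simp add: clinear_coord)
  then show ?thesis by (simp only: clinear_sum_coord[OF assms(1,2)])
qed

section \<open>Evaluating polynomial maps at symmetric tensors\<close>

text \<open>A product functional, extended by zero to words of any other length, so that it sees a
  single tensor degree.\<close>

fun tensor_functional :: "('g \<Rightarrow> complex) list \<Rightarrow> 'g list \<Rightarrow> complex" where
  "tensor_functional [] [] = 1"
| "tensor_functional (\<mu> # \<mu>s) (u # us) = \<mu> u * tensor_functional \<mu>s us"
| "tensor_functional _ _ = 0"

lemma multilinear_tensor_functional:
  "\<forall>\<mu>\<in>set \<mu>s. clinear \<mu> \<Longrightarrow> multilinear (tensor_functional \<mu>s)"
  unfolding multilinear_def
proof (intro allI)
  fix u v
  show "\<forall>\<mu>\<in>set \<mu>s. clinear \<mu> \<Longrightarrow> clinear (\<lambda>x. tensor_functional \<mu>s (u @ [x] @ v))"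
  proof (induction \<mu>s arbitrary: u)
    case Nil
    have "(\<lambda>x. tensor_functional [] (u @ [x] @ v)) = (\<lambda>x. 0)" by (cases u) auto
    then show ?case by (simp only:) (intro clinearI, simp_all)
  next
    case (Cons \<mu> \<mu>s)
    then have \<mu>: "clinear \<mu>" and lin: "clinear (\<lambda>x. tensor_functional \<mu>s (u @ [x] @ v))" for u by auto
    show ?case
    proof (cases u)
      case Nil
      then show ?thesis
        by (simp only: append_Nil append_Cons tensor_functional.simps)
          (intro clinearI, simp_all add: clinear_add[OF \<mu>] clinear_functional_scale[OF \<mu>] algebra_simps
              scaleC_complex_def)
    next
      case (Cons a list)
      show ?thesis
        using clinear_add[OF lin[of list]] clinear_functional_scale[OF lin[of list]]
        by (intro clinearI) (simp_all add: Cons distrib_left mult.left_commute scaleC_complex_def)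
    qed
  qed
qed

lemma tensor_functional_replicate:
  "tensor_functional \<mu>s (replicate j y) = (if j = length \<mu>s then eval_all \<mu>s y else 0)"
proof (induction \<mu>s arbitrary: j)
  case Nil
  show ?case by (cases j) simp_all
next
  case (Cons \<mu> \<mu>s)
  then show ?case by (cases j) simp_all
qed

lemma tensor_ext_power: "multilinear f \<Longrightarrow> tensor_ext f (tensor_of y ^ j) = f (replicate j y)"
  using tensor_ext_prod_list[of f "replicate j y"] by (simp only: prod_list_replicate)

lemma tensor_ext_functional_Cons:
  assumes "\<forall>\<mu>\<in>set (\<mu> # \<mu>s). clinear \<mu>"
  shows "tensor_ext (tensor_functional (\<mu> # \<mu>s)) (tensor_of u * t) = \<mu> u * tensor_ext (tensor_functional \<mu>s) t"
proof (induction t rule: tensor_algebra_induct)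
  case zero
  show ?case using assms by (simp add: clinear_zero[OF clinear_tensor_ext[OF multilinear_tensor_functional]])
next
  case (add c xs t)
  note lin = clinear_tensor_ext[OF multilinear_tensor_functional]
  note m = multilinear_tensor_functional[OF assms] multilinear_tensor_functional[of \<mu>s]
  have "tensor_ext (tensor_functional (\<mu> # \<mu>s)) (tensor_of u * prod_list (map tensor_of xs)) =
      \<mu> u * tensor_ext (tensor_functional \<mu>s) (prod_list (map tensor_of xs))"
    using tensor_ext_prod_list[OF m(1), of "u # xs"] tensor_ext_prod_list[OF m(2), of xs] assms by simp
  with add assms show ?case
    by (simp add: distrib_left scaleC_mult_right clinear_add[OF lin] clinear_scale[OF lin] algebra_simps)
qed

lemma tensor_ext_functional_leibniz:
  assumes "\<forall>\<mu>\<in>set \<mu>s. clinear \<mu>"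
  shows "tensor_ext (tensor_functional \<mu>s) (leibniz tensor_of d (replicate (length \<mu>s) y)) =
      eval_all_deriv \<mu>s y (d y)"
  using assms
proof (induction \<mu>s)
  case Nil
  show ?case by (simp add: clinear_zero[OF clinear_tensor_ext[OF multilinear_tensor_functional]])
next
  case (Cons \<mu> \<mu>s)
  then show ?case
    using tensor_ext_power[OF multilinear_tensor_functional, of \<mu>s y "length \<mu>s"]
      clinear_add[OF clinear_tensor_ext[OF multilinear_tensor_functional[OF Cons.prems]]]
    by (simp add: tensor_ext_functional_Cons[OF Cons.prems] prod_list_replicate tensor_functional_replicate)
qed

lemma lin_ext_scaleC_left: "lin_ext (\<lambda>y. f y *\<^sub>C w) P = lin_ext f P *\<^sub>C w"
  by (rule clinear_lin_ext_distrib[symmetric]) (rule clinear_scaleC_left)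

text \<open>A monomial of degree j factors through the j-th tensor power of the point, on which the
  evaluation vanishes unless j = \<open>l\<close>.\<close>

lemma represents_polymap_zero:
  assumes "represents q l F P" "polymap A E E'" "A \<subseteq> {..<q}" "l \<notin> A"
  shows "lin_ext E P = 0"
  using assms(2)
proof induction
  case (add E E' \<mu>s w)
  have f: "multilinear (tensor_functional \<mu>s)" by (rule multilinear_tensor_functional) fact
  have "lin_ext (eval_all \<mu>s) P = tensor_ext (tensor_functional \<mu>s) (lin_ext (\<lambda>y. tensor_of y ^ length \<mu>s) P)"
    by (simp add: clinear_lin_ext_distrib[OF clinear_tensor_ext[OF f]] tensor_ext_power[OF f]
        tensor_functional_replicate)
  also have "\<dots> = 0"
    using represents_tensor[OF assms(1), of "length \<mu>s"] add.hyps(2) assms(3,4) clinear_zero[OF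
        clinear_tensor_ext[OF f]]
    by auto
  finally show ?case by (simp add: lin_ext_plus_fun lin_ext_scaleC_left add.IH)
qed simp

text \<open>The infinitesimal form of \<open>\<gg>\<close>-invariance.\<close>
definition invariant_points :: "nat \<Rightarrow> ('g::complex_lie_algebra \<Rightarrow>\<^sub>0 complex) \<Rightarrow> bool"
  where "invariant_points q P \<longleftrightarrow> (\<forall>b \<mu>s. length \<mu>s < q \<longrightarrow> (\<forall>\<mu>\<in>set \<mu>s. clinear \<mu>) \<longrightarrow>
    lin_ext (\<lambda>y. eval_all_deriv \<mu>s y (bracket b y)) P = 0)"

lemma invariant_points_polymap:
  assumes "invariant_points q P" "polymap A E E'" "A \<subseteq> {..<q}"
  shows "lin_ext (\<lambda>y. E' y (bracket b y)) P = 0"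
  using assms(2)
proof induction
  case (add E E' \<mu>s w)
  have "lin_ext (\<lambda>y. eval_all_deriv \<mu>s y (bracket b y)) P = 0"
    using assms(1,3) add.hyps unfolding invariant_points_def by blast
  then show ?case using add.IH by (simp add: lin_ext_plus_fun lin_ext_scaleC_left)
qed simp

lemma clinear_lie_action: "clinear (lie_action x)"
  unfolding lie_action_def
  by (rule clinear_sym_ext)
    (auto simp: symmetric_multilinear_def intro: multilinear_leibniz clinear_sym_of
      clinear_bracket leibniz_mset)

text \<open>In degree \<open>k\<close> the derivation of tensor powers is the symmetrised action on
  \<open>H\<close>, which vanishes. In every other degree the evaluation of tensor powers is already
  zero.\<close>

lemma invariant_points_invariants:
  assumes H: "H \<in> sym_invariants k" and P: "represents q k H P"
  shows "invariant_points q P"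
  unfolding invariant_points_def
proof (intro allI impI)
  fix b :: 'a and \<mu>s :: "('a \<Rightarrow> complex) list"
  assume l: "length \<mu>s < q" and lin: "\<forall>\<mu>\<in>set \<mu>s. clinear \<mu>"
  let ?d = "bracket b" and ?n = "length \<mu>s"
  let ?act = "tensor_ext (leibniz tensor_of ?d)"
  have m: "multilinear (leibniz tensor_of ?d)"
    by (rule multilinear_leibniz[OF clinear_tensor_of clinear_bracket])
  have "lin_ext (\<lambda>y. leibniz tensor_of ?d (replicate ?n y)) P = 0"
  proof (cases "?n = k")
    case True
    have "lin_ext (\<lambda>y. leibniz tensor_of ?d (replicate ?n y)) P =
        lin_ext (\<lambda>y. sym_to_tensor (lie_action b (sym_of y ^ k))) P"
      using lie_action_prod_list[of b "replicate k y" for y] True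
      by (simp add: sym_to_tensor_leibniz prod_list_replicate)
    also have "\<dots> = sym_to_tensor (lie_action b (lin_ext (\<lambda>y. sym_of y ^ k) P))"
      by (simp add: clinear_lin_ext_distrib[OF clinear_sym_to_tensor] clinear_lin_ext_distrib[OF
          clinear_lie_action])
    also have "lin_ext (\<lambda>y. sym_of y ^ k) P = H"
      using P l True by (simp add: represents_def)
    finally show ?thesis
      using H by (simp add: sym_invariants_def clinear_zero[OF clinear_sym_to_tensor])
  next
    case False
    have "lin_ext (\<lambda>y. leibniz tensor_of ?d (replicate ?n y)) P = ?act (lin_ext (\<lambda>y. tensor_of y ^ ?n) P)"
      by (simp add: clinear_lin_ext_distrib[OF clinear_tensor_ext[OF m]] tensor_ext_power[OF m])
    then show ?thesis
      using represents_tensor[OF P l] False by (simp add: clinear_zero[OF clinear_tensor_ext[OF m]])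
  qed
  then have "tensor_ext (tensor_functional \<mu>s) (lin_ext (\<lambda>y. leibniz tensor_of ?d (replicate ?n y)) P) = 0"
    by (simp add: clinear_zero[OF clinear_tensor_ext[OF multilinear_tensor_functional[OF lin]]])
  then show "lin_ext (\<lambda>y. eval_all_deriv \<mu>s y (bracket b y)) P = 0"
    by (simp add: clinear_lin_ext_distrib[OF clinear_tensor_ext[OF multilinear_tensor_functional[OF lin]]]
        tensor_ext_functional_leibniz[OF lin])
qed

section \<open>The condition on the maps m\<close>

text \<open>Allows the identity between \<open>m_map n H\<close> and \<open>sym_into_gl M\<close> to
  be paired with a functional on each tensor factor.\<close>

lemma tensor_product_universal:
  fixes B :: "'a::complex_vector \<Rightarrow> 'b::complex_vector \<Rightarrow> 'c::complex_vector"
  assumes left: "\<And>b. clinear (\<lambda>a. B a b)" and right: "\<And>a. clinear (B a)"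
  obtains L where "clinear L" "\<And>a b. L (a \<otimes> b) = B a b"
proof -
  define f where "f = lin_ext (\<lambda>(a, b). B a b)"
  have f: "clinear f" unfolding f_def by (rule clinear_lin_ext)
  have p: "f (pair a b) = B a b" for a b
    by (simp add: f_def pair_def scaleC_one)
  have "f x = 0" if "x \<in> bilinearity_relations" for x
    using that unfolding bilinearity_relations_def
    by (auto simp: clinear_diff[OF f] clinear_scale[OF f] p clinear_add[OF left] clinear_scale[OF left]
        clinear_add[OF right] clinear_scale[OF right])
  then have "bilinearity_relations \<subseteq> {x. f x = 0}" by blast
  moreover have "complex_vector.subspace {x. f x = 0}"
    by (rule complex_vector.subspaceI)
      (simp_all add: clinear_zero[OF f] clinear_add[OF f] clinear_scale[OF f])
  ultimately have "complex_vector.span bilinearity_relations \<subseteq> {x. f x = 0}"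
    by (rule complex_vector.span_minimal)
  then have cong: "f x = f y" if "span_cong bilinearity_relations x y" for x y
    using that clinear_diff[OF f, of x y] by (auto simp: span_cong_def)
  define L where "L t = f (rep_tensor_product t)" for t
  have abs: "L (abs_tensor_product x) = f x" for x
    unfolding L_def
    by (intro cong Quotient3_rep_abs[OF Quotient3_tensor_product] equivp_reflp[OF equivp_span_cong])
  have surj: "\<exists>x. t = abs_tensor_product x" for t :: "('a, 'b) tensor_product"
    by (metis Quotient3_abs_rep[OF Quotient3_tensor_product])
  have "clinear L"
  proof (rule clinearI)
    fix s t :: "('a, 'b) tensor_product" and c
    obtain x y where "s = abs_tensor_product x" "t = abs_tensor_product y" using surj by blast
    then show "L (s + t) = L s + L t" "L (c *\<^sub>C s) = c *\<^sub>C L s"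
      by (simp_all add: plus_tensor_product.abs_eq scaleC_tensor_product.abs_eq abs clinear_add[OF f]
          clinear_scale[OF f])
  qed
  moreover have "L (a \<otimes> b) = B a b" for a b
    by (simp add: pure_tensor.abs_eq abs p)
  ultimately show ?thesis by (rule that)
qed

lemma m_map_represents:
  assumes "represents q k H P" "k < q" "n \<le> k"
  shows "m_map n H = lin_ext (\<lambda>y. ad y ^ n \<otimes> tensor_of y ^ (k - n)) P"
proof -
  have "m_map n H = tensor_ext (m_word n) (lin_ext (\<lambda>y. tensor_of y ^ k) P)"
    using represents_tensor[OF assms(1,2)] by (simp add: m_map_def)
  then show ?thesis using assms(3)
    by (simp add: clinear_lin_ext_distrib[OF clinear_tensor_ext[OF multilinear_m_word]]
        tensor_ext_power[OF multilinear_m_word] m_word_def prod_list_replicate min_def)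
qed

lemma sym_into_gl_represents:
  assumes "represents q l M P" "l < q" "0 < l"
  shows "sym_into_gl M = lin_ext (\<lambda>y. ad y \<otimes> tensor_of y ^ (l - 1)) P"
proof -
  have "sym_into_gl M = tensor_ext (\<lambda>ys. ad (hd ys) \<otimes> prod_list (map tensor_of (tl ys))) (lin_ext
      (\<lambda>y. tensor_of y ^ l) P)"
    using represents_tensor[OF assms(1,2)] by (simp add: sym_into_gl_def)
  moreover have "hd (replicate l y) = y" "tl (replicate l y) = replicate (l - 1) y" for y :: 'a
    using assms(3) by (cases l; simp)+
  ultimately show ?thesis
    by (simp add: clinear_lin_ext_distrib[OF clinear_tensor_ext[OF multilinear_ad_hd]]
        tensor_ext_power[OF multilinear_ad_hd] prod_list_replicate)
qed

text \<open>As \<open>ad\<close> is a representation, moving \<open>y\<close> in the direction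
  \<open>bracket b y\<close> conjugates \<open>ad y\<close> infinitesimally; the derivative of the
  power in these directions is therefore a commutator.\<close>

lemma polymap_ad_power:
  assumes "finite (basis :: 'g::complex_lie_algebra set)" "n \<in> A"
  shows "\<exists>D. polymap A (\<lambda>y :: 'g. ad y ^ n) D \<and> (\<forall>y b. D y (bracket b y) = ad b * ad y ^ n - ad y ^ n * ad b)"
  using assms(2)
proof (induction n arbitrary: A)
  case 0
  then show ?case using polymap_const[of A 1] by fastforce
next
  case (Suc n)
  from Suc.IH[of "{n}"] obtain D where D: "polymap {n} (\<lambda>y :: 'g. ad y ^ n) D"
    "\<And>y b. D y (bracket b y) = ad b * ad y ^ n - ad y ^ n * ad b" by auto
  have "polymap A (\<lambda>y :: 'g. ad y * ad y ^ n) (\<lambda>y z. ad z * ad y ^ n + ad y * D y z)"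
    using Suc.prems by (intro polymap_endo_mult[OF polymap_linear[OF assms(1) clinear_ad, of "{1}"] D(1)]) auto
  then show ?case
    by (intro exI[of _ "\<lambda>y z. ad z * ad y ^ n + ad y * D y z"]) (simp add: D(2) ad_bracket algebra_simps)
qed

text \<open>Both sides of \<open>m\<close> are evaluations of pure tensors. Pairing with
  \<open>\<chi>\<close> on the endomorphism factor and with a product functional on the tensor
  factor gives the claim for monomials of degree \<open>k - n\<close>.\<close>

lemma m_map_polymap:
  fixes H M :: "'g::complex_lie_algebra sym_algebra"
  assumes fin: "finite (basis :: 'g set)"
    and H: "represents q k H P\<^sub>0" and M: "represents q (k + 1 - n) M P"
    and n: "0 < n" "n \<le> k" "k < q" and m: "m_map n H = sym_into_gl M"
    and \<chi>: "clinear \<chi>" and G: "polymap A G G'" and A: "\<And>i. i \<in> A \<Longrightarrow> i + n < q"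
  shows "lin_ext (\<lambda>v. \<chi> (ad v) *\<^sub>C G v) P = lin_ext (\<lambda>y. \<chi> (ad y ^ n) *\<^sub>C G y) P\<^sub>0"
  using G
proof induction
  case (add E E' \<mu>s w)
  let ?f = "tensor_functional \<mu>s"
  have f: "multilinear ?f" by (rule multilinear_tensor_functional) fact
  have "lin_ext (\<lambda>v. \<chi> (ad v) * eval_all \<mu>s v) P = lin_ext (\<lambda>y. \<chi> (ad y ^ n) * eval_all \<mu>s y) P\<^sub>0"
  proof (cases "length \<mu>s = k - n")
    case True
    have left: "clinear (\<lambda>\<phi>. \<chi> \<phi> * tensor_ext ?f t)" for t
      using clinear_scaled[OF \<chi>, of "tensor_ext ?f t"] by (simp only: scaleC_complex_def mult.commute)
    have right: "clinear (\<lambda>t. \<chi> \<phi> * tensor_ext ?f t)" for \<phi>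
      using clinear_scaled[OF clinear_tensor_ext[OF f], of "\<chi> \<phi>"] by (simp only: scaleC_complex_def)
    obtain L where L: "clinear L" "\<And>\<phi> t. L (\<phi> \<otimes> t) = \<chi> \<phi> * tensor_ext ?f t"
      using tensor_product_universal[of "\<lambda>\<phi> t. \<chi> \<phi> * tensor_ext ?f t", OF left right] by blast
    have l: "k + 1 - n = Suc (k - n)" using n by simp
    have "L (sym_into_gl M) = L (m_map n H)" by (simp add: m)
    then show ?thesis
      using True n sym_into_gl_represents[OF M] m_map_represents[OF H]
      by (simp add: l clinear_lin_ext_distrib[OF L(1)] L(2) tensor_ext_power[OF f] tensor_functional_replicate)
  next
    \<comment> \<open>Both sides vanish for reasons of degree: the left integrand has degree
      \<open>length \<mu>s + 1\<close>, which is not that of \<open>M\<close>, and the right one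
      degree \<open>length \<mu>s + n\<close>, which is not \<open>k\<close>.\<close>
    case False
    have "polymap {Suc (length \<mu>s)} (\<lambda>v. eval_all ((\<lambda>v. \<chi> (ad v)) # \<mu>s) v *\<^sub>C 1)
        (\<lambda>y z. eval_all_deriv ((\<lambda>v. \<chi> (ad v)) # \<mu>s) y z *\<^sub>C (1 :: complex))"
      using add.hyps(3) clinear_compose[OF \<chi> clinear_ad] by (intro polymap_monomial) auto
    from represents_polymap_zero[OF M this] False A[OF add.hyps(2)] n
    have 1: "lin_ext (\<lambda>v. \<chi> (ad v) * eval_all \<mu>s v) P = 0" by (auto simp: scaleC_complex_def Suc_diff_le)
    obtain D where D: "polymap {n} (\<lambda>y :: 'g. ad y ^ n) D" using polymap_ad_power[OF fin, of n "{n}"] by auto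
    have mon: "polymap {length \<mu>s} (\<lambda>y. eval_all \<mu>s y *\<^sub>C 1) (\<lambda>y z. eval_all_deriv \<mu>s y z *\<^sub>C (1 :: complex))"
      using add.hyps(3) by (intro polymap_monomial) auto
    have "polymap {n + length \<mu>s} (\<lambda>y. \<chi> (ad y ^ n) *\<^sub>C eval_all \<mu>s y *\<^sub>C 1)
        (\<lambda>y z. \<chi> (D y z) *\<^sub>C eval_all \<mu>s y *\<^sub>C 1 + \<chi> (ad y ^ n) *\<^sub>C eval_all_deriv \<mu>s y z *\<^sub>C (1 :: complex))"
      by (rule polymap_scaleC[OF polymap_linear_image[OF D \<chi>] mon]) simp
    from represents_polymap_zero[OF H this] False A[OF add.hyps(2)] n
    have 2: "lin_ext (\<lambda>y. \<chi> (ad y ^ n) * eval_all \<mu>s y) P\<^sub>0 = 0" by (auto simp: scaleC_complex_def)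
    show ?thesis by (simp only: 1 2)
  qed
  then show ?case
    using add.IH by (simp add: scaleC_add_right lin_ext_plus_fun scaleC_scaleC lin_ext_scaleC_left)
qed simp

text \<open>Injectivity of \<open>ad\<close> turns every functional on \<open>\<gg>\<close> into one on \<open>\<gg>\<ll>(\<gg>)\<close>, so that invariance
  passes from \<open>H\<close> to \<open>M\<close>.\<close>
lemma invariant_points_m_map:
  fixes H M :: "'g::complex_lie_algebra sym_algebra"
  assumes fin: "finite (basis :: 'g set)" and inj: "inj (ad :: 'g \<Rightarrow> 'g endo)"
    and H: "represents q k H P\<^sub>0" and M: "represents q (k + 1 - n) M P"
    and n: "0 < n" "n \<le> k" "k < q" and m: "m_map n H = sym_into_gl M"
    and inv: "invariant_points q P\<^sub>0" and q': "q' + n < q"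
  shows "invariant_points q' P"
  unfolding invariant_points_def
proof (intro allI impI)
  fix b :: 'g and \<mu>s :: "('g \<Rightarrow> complex) list"
  assume l: "length \<mu>s < q'" and lin: "\<forall>\<mu>\<in>set \<mu>s. clinear \<mu>"
  show "lin_ext (\<lambda>v. eval_all_deriv \<mu>s v (bracket b v)) P = 0"
  proof (cases \<mu>s)
    case (Cons \<mu> \<nu>s)
    have "vector_space_pair (scaleC :: complex \<Rightarrow> 'g \<Rightarrow> 'g) (scaleC :: complex \<Rightarrow> 'g endo \<Rightarrow> 'g endo)"
      by (simp add: vector_space_pair_def complex_vector.vector_space_axioms)
    from vector_space_pair.linear_injective_left_inverse[OF this clinear_ad inj]
    obtain \<rho> where \<rho>: "clinear \<rho>" "\<rho> \<circ> ad = (id :: 'g \<Rightarrow> 'g)" by blast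
    define \<chi> where "\<chi> \<phi> = \<mu> (\<rho> \<phi>)" for \<phi>
    have \<chi>: "clinear \<chi>" unfolding \<chi>_def using lin Cons by (intro clinear_compose[OF _ \<rho>(1)]) simp
    have \<chi>ad: "\<chi> (ad v) = \<mu> v" for v using \<rho>(2) by (simp add: \<chi>_def fun_eq_iff)
    \<comment> \<open>This accounts for the derivative of \<open>ad y ^ n\<close> along
      \<open>bracket b y\<close>. On \<open>ad v\<close> it returns
      \<open>\<mu> (bracket b v)\<close>, so that the invariance identity for \<open>H\<close> turns
      into the one for \<open>M\<close>.\<close>
    define \<chi>' where "\<chi>' \<phi> = \<chi> (ad b * \<phi> - \<phi> * ad b)" for \<phi>
    have \<chi>': "clinear \<chi>'"
      unfolding \<chi>'_def by (rule clinear_compose[OF \<chi>], rule clinearI)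
        (simp_all add: algebra_simps endo_scaleC_mult complex_vector.scale_right_diff_distrib)
    let ?G = "\<lambda>y. eval_all \<nu>s y *\<^sub>C (1 :: complex)" and ?G' = "\<lambda>y z. eval_all_deriv \<nu>s y z *\<^sub>C (1 :: complex)"
    have G: "polymap {length \<nu>s} ?G ?G'" using lin Cons by (intro polymap_monomial) auto
    obtain G'' where G'': "polymap {length \<nu>s} (\<lambda>y. ?G' y (bracket b y)) G''"
      using polymap_deriv[OF G clinear_bracket] by blast
    obtain D where D: "polymap {n} (\<lambda>y :: 'g. ad y ^ n) D"
      "\<And>y b. D y (bracket b y) = ad b * ad y ^ n - ad y ^ n * ad b"
      using polymap_ad_power[OF fin, of n "{n}"] by auto
    have "polymap {n + length \<nu>s} (\<lambda>y. \<chi> (ad y ^ n) *\<^sub>C ?G y) (\<lambda>y z. \<chi> (D y z) *\<^sub>C ?G y +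
        \<chi> (ad y ^ n) *\<^sub>C ?G' y z)"
      by (rule polymap_scaleC[OF polymap_linear_image[OF D(1) \<chi>] G]) simp
    from invariant_points_polymap[OF inv this, of b] l Cons q'
    have "lin_ext (\<lambda>y. \<chi>' (ad y ^ n) *\<^sub>C ?G y + \<chi> (ad y ^ n) *\<^sub>C ?G' y (bracket b y)) P\<^sub>0 = 0"
      by (simp add: D(2) \<chi>'_def)
    moreover have "lin_ext (\<lambda>v. \<chi>' (ad v) *\<^sub>C ?G v) P = lin_ext (\<lambda>y. \<chi>' (ad y ^ n) *\<^sub>C ?G y) P\<^sub>0"
      using l Cons q' by (intro m_map_polymap[OF fin H M n m \<chi>' G]) auto
    moreover have "lin_ext (\<lambda>v. \<chi> (ad v) *\<^sub>C ?G' v (bracket b v)) P = lin_ext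
        (\<lambda>y. \<chi> (ad y ^ n) *\<^sub>C ?G' y (bracket b y)) P\<^sub>0"
      using l Cons q' by (intro m_map_polymap[OF fin H M n m \<chi> G'']) auto
    ultimately have "lin_ext (\<lambda>v. \<chi>' (ad v) *\<^sub>C ?G v + \<chi> (ad v) *\<^sub>C ?G' v (bracket b v)) P = 0"
      by (simp only: lin_ext_plus_fun)
    moreover have "\<chi>' (ad v) = \<mu> (bracket b v)" for v
      by (simp add: \<chi>'_def \<chi>ad flip: ad_bracket)
    ultimately show ?thesis by (simp add: Cons \<chi>ad scaleC_complex_def)
  qed simp
qed

section \<open>Combinations indexed by polynomials\<close>

text \<open>Umbral evaluation: the i-th power of the variable becomes \<open>f i\<close>. For
  \<open>f i = (bracket y ^^ i) x\<close> this is p(ad y) x; after evaluation at \<open>H\<close>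
  only a sequence indexed by the exponent is left.\<close>

definition poly_comb :: "(nat \<Rightarrow> 'a::complex_vector) \<Rightarrow> complex poly \<Rightarrow> 'a"
  where "poly_comb f p = (\<Sum>i\<le>degree p. coeff p i *\<^sub>C f i)"

lemma poly_comb_superset: "degree p \<le> n \<Longrightarrow> poly_comb f p = (\<Sum>i\<le>n. coeff p i *\<^sub>C f i)"
  unfolding poly_comb_def by (rule sum.mono_neutral_left) (auto simp: coeff_eq_0)

lemma poly_comb_add: "poly_comb f (p + q) = poly_comb f p + poly_comb f q"
proof -
  define n where "n = max (degree p) (degree q)"
  have "degree p \<le> n" "degree q \<le> n" "degree (p + q) \<le> n"
    by (simp_all add: n_def degree_add_le_max)
  then show ?thesis by (simp add: poly_comb_superset[of _ n] scaleC_add_left sum.distrib)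
qed

lemma poly_comb_smult: "poly_comb f (smult c p) = c *\<^sub>C poly_comb f p"
  using poly_comb_superset[OF degree_smult_le, of f c p]
  by (simp add: poly_comb_def complex_vector.scale_sum_right scaleC_scaleC)

lemma poly_comb_minus: "poly_comb f (- p) = - poly_comb f p"
  by (simp add: poly_comb_def sum_negf)

lemma poly_comb_diff: "poly_comb f (p - q) = poly_comb f p - poly_comb f q"
  using poly_comb_add[of f p "- q"] by (simp add: poly_comb_minus)

lemma poly_comb_0 [simp]: "poly_comb f 0 = 0"
  by (simp add: poly_comb_def)

lemma poly_comb_1: "poly_comb f 1 = f 0"
  by (simp add: poly_comb_def scaleC_one)

lemma poly_comb_pCons: "poly_comb f (pCons c p) = c *\<^sub>C f 0 + poly_comb (\<lambda>i. f (Suc i)) p"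
proof -
  have "poly_comb f (pCons c p) = (\<Sum>i\<le>Suc (degree p). coeff (pCons c p) i *\<^sub>C f i)"
    by (rule poly_comb_superset) (rule degree_pCons_le)
  also have "\<dots> = c *\<^sub>C f 0 + poly_comb (\<lambda>i. f (Suc i)) p"
    unfolding sum.atMost_Suc_shift by (simp add: poly_comb_def)
  finally show ?thesis .
qed

lemma poly_comb_monom_mult: "poly_comb f (monom 1 n * p) = poly_comb (\<lambda>i. f (i + n)) p"
  by (induction n arbitrary: f) (simp_all add: monom_Suc poly_comb_pCons)

lemma poly_comb_plus_fun: "poly_comb (\<lambda>i. f i + g i) p = poly_comb f p + poly_comb g p"
  by (simp add: poly_comb_def scaleC_add_right sum.distrib)

lemma poly_comb_scaleC_fun: "poly_comb (\<lambda>i. c *\<^sub>C f i) p = c *\<^sub>C poly_comb f p"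
  by (simp add: poly_comb_def complex_vector.scale_sum_right scaleC_scaleC mult.commute)

lemma poly_comb_mult_linear:
  "poly_comb f (p * [:a, b:]) = poly_comb (\<lambda>i. a *\<^sub>C f i + b *\<^sub>C f (Suc i)) p"
proof -
  have "p * [:a, b:] = smult a p + smult b (monom 1 1 * p)"
    by (simp add: mult_pCons_right monom_altdef mult.commute)
  then have "poly_comb f (p * [:a, b:]) = a *\<^sub>C poly_comb f p + b *\<^sub>C poly_comb (\<lambda>i. f (i + 1)) p"
    by (simp only: poly_comb_add poly_comb_smult poly_comb_monom_mult)
  then show ?thesis by (simp add: poly_comb_plus_fun poly_comb_scaleC_fun)
qed

lemma poly_comb_linear: "clinear L \<Longrightarrow> L (poly_comb f p) = poly_comb (\<lambda>i. L (f i)) p"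
  by (simp add: poly_comb_def clinear_sum_distrib clinear_scale)

lemma poly_comb_eq_0: "(\<And>i. i \<le> degree p \<Longrightarrow> f i = 0) \<Longrightarrow> poly_comb f p = 0"
  by (simp add: poly_comb_def)

lemma poly_comb_cong: "(\<And>i. i \<le> degree p \<Longrightarrow> f i = g i) \<Longrightarrow> poly_comb f p = poly_comb g p"
  by (simp add: poly_comb_def)

lemma lin_ext_poly_comb_fun: "lin_ext (\<lambda>y. poly_comb (\<lambda>i. f i y) p) P = poly_comb (\<lambda>i. lin_ext (f i) P) p"
  by (simp add: poly_comb_def lin_ext_sum_fun lin_ext_scaleC_fun)

lemma poly_comb_sum: "poly_comb f (\<Sum>i\<in>I. p i) = (\<Sum>i\<in>I. poly_comb f (p i))"
  by (induction I rule: infinite_finite_induct) (simp_all add: poly_comb_add)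

lemma poly_comb_sum_fun: "poly_comb (\<lambda>i. \<Sum>e\<in>I. f e i) p = (\<Sum>e\<in>I. poly_comb (f e) p)"
  unfolding poly_comb_def complex_vector.scale_sum_right by (rule sum.swap)

section \<open>Falling factorials and cancellation of the denominator\<close>

definition falling_poly :: "nat \<Rightarrow> complex poly"
  where "falling_poly m = (\<Prod>j=1..m. [:of_nat j, - 1:])"

lemma falling_poly_0 [simp]: "falling_poly 0 = 1"
  by (simp add: falling_poly_def)

lemma falling_poly_Suc: "falling_poly (Suc m) = falling_poly m * [:of_nat (Suc m), - 1:]"
  by (simp add: falling_poly_def)

lemma degree_falling_poly: "degree (falling_poly m) \<le> m"
  unfolding falling_poly_def by (rule order.trans[OF degree_prod_sum_le]) simp_all

text \<open>The factor 1 - X cancels one factor of 1 - X^2; the value of the cofactor at -1 is its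
  remainder modulo the other factor 1 + X.\<close>

lemma falling_poly_factor:
  obtains p where "falling_poly (Suc m) = [:1, - 1:] * p" "degree p \<le> m"
    "poly p (- 1) = fact (Suc (Suc m)) / 2"
proof
  let ?p = "\<Prod>j=2..Suc m. [:of_nat j, - 1 :: complex:]"
  show "falling_poly (Suc m) = [:1, - 1:] * ?p"
    unfolding falling_poly_def
    by (subst prod.atLeast_Suc_atMost) (simp_all only: numeral_2_eq_2 One_nat_def of_nat_1 le0 Suc_le_mono
        of_nat_Suc of_nat_0 add_0_right)
  show "degree ?p \<le> m"
    by (rule order.trans[OF degree_prod_sum_le]) simp_all
  have "poly ?p (- 1) = (\<Prod>j=2..Suc m. of_nat (Suc j))"
    unfolding poly_prod by (intro prod.cong) simp_all
  also have "\<dots> = fact (Suc (Suc m)) / 2"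
  proof (induction m)
    case (Suc m)
    have "(\<Prod>j=2..Suc (Suc m). of_nat (Suc j)) =
        of_nat (Suc (Suc (Suc m))) * (\<Prod>j=2..Suc m. of_nat (Suc j) :: complex)"
      by (rule prod.nat_ivl_Suc') simp
    then show ?case by (simp only: Suc.IH fact_Suc[of "Suc (Suc m)"] times_divide_eq_right)
  qed simp
  finally show "poly ?p (- 1) = fact (Suc (Suc m)) / 2" .
qed

lemma geometric_even_monom:
  "(\<Sum>r\<le>k. monom 1 (2 * r)) * [:1, - 1:] * [:1, 1:] = (1 - monom 1 (2 * k + 2) :: complex poly)"
proof (induction k)
  case (Suc k)
  have "monom 1 (2 * Suc k) * [:1, - 1:] * [:1, 1:] = monom 1 (2 * Suc k) - (monom 1 (2 * Suc k +
      2) :: complex poly)"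
    by (simp add: monom_Suc numeral_eq_Suc)
  with Suc show ?case unfolding sum.atMost_Suc distrib_right by simp
qed (simp add: monom_Suc numeral_eq_Suc one_pCons)

text \<open>In the application the index \<open>i\<close> counts factors \<open>ad y\<close>, so that the sum over \<open>r\<close> amounts to
  multiplication by \<open>1 / (1 - (ad y)\<^sup>2)\<close>; its denominator cancels against the factor \<open>1 - ad y\<close>
  of the falling factorial and the factor \<open>1 + ad y\<close> coming from commutators.\<close>
lemma alternating_cancellation:
  fixes f :: "nat \<Rightarrow> 'a::complex_vector"
  assumes low: "\<And>i. i \<le> Suc (Suc m) \<Longrightarrow> f i = 0" and high: "\<And>i. k < i \<Longrightarrow> f i = 0"
  shows "(\<Sum>r\<le>k. poly_comb (\<lambda>i. f i + f (Suc i)) (monom 1 (2 * r) * (monom 1 1 * falling_poly (Suc m)))) = 0"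
    (is ?A)
proof -
  obtain p where fp: "falling_poly (Suc m) = [:1, - 1:] * p" and dp: "degree p \<le> m"
    by (rule falling_poly_factor)
  let ?g = "\<Sum>r\<le>k. monom 1 (2 * r) :: complex poly"
  note g = geometric_even_monom[of k]
  have "(\<Sum>r\<le>k. poly_comb (\<lambda>i. f i + f (Suc i)) (monom 1 (2 * r) * (monom 1 1 * falling_poly (Suc m)))) =
      poly_comb (\<lambda>i. f i + f (Suc i)) (?g * (monom 1 1 * falling_poly (Suc m)))"
    by (simp add: poly_comb_sum sum_distrib_right)
  also have "\<dots> = poly_comb f (?g * (monom 1 1 * falling_poly (Suc m)) * [:1, 1:])"
    unfolding poly_comb_mult_linear by (simp add: scaleC_one)
  also have "?g * (monom 1 1 * falling_poly (Suc m)) * [:1, 1:] =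
      (?g * [:1, - 1:] * [:1, 1:]) * (monom 1 1 * p)"
    by (simp only: fp ac_simps)
  \<comment> \<open>The first term has indices at most \<open>Suc m\<close>, the second at least
    \<open>2 * k + 3\<close>; \<open>low\<close> and \<open>high\<close> remove them.\<close>
  also have "\<dots> = monom 1 1 * p - monom 1 (2 * k + 2) * (monom 1 1 * p)"
    unfolding g by (simp only: left_diff_distrib mult_1_left)
  finally show ?A
    using dp low high by (simp add: poly_comb_diff poly_comb_monom_mult poly_comb_eq_0)
qed

text \<open>Modulo high powers, \<open>g\<close> inverts 1 - X^2. For c = p(-1) the polynomial X p +
  c is divisible by 1 + X, with quotient v, so X (1 - X) p g = v - c (1 - X) g. Adding c X^2 g
  leaves v - c + c X g, where v and c are of low degree and X g is odd.\<close>

lemma parity_cancellation: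
  fixes f :: "nat \<Rightarrow> 'a::complex_vector"
  assumes low: "\<And>i. i \<le> Suc m \<Longrightarrow> f i = 0" and high: "\<And>i. k < i \<Longrightarrow> f i = 0"
    and odd: "\<And>i. odd i \<Longrightarrow> f i = 0"
  shows "(\<Sum>r\<le>k. poly_comb f (monom 1 (2 * r) * (monom 1 1 * falling_poly (Suc m))) +
      (fact (Suc (Suc m)) / 2) *\<^sub>C f (2 * r + 2)) = 0"
proof -
  define c where "c = (fact (Suc (Suc m)) / 2 :: complex)"
  obtain p where fp: "falling_poly (Suc m) = [:1, - 1:] * p" and dp: "degree p \<le> m" and "poly p (- 1) = c"
    unfolding c_def by (rule falling_poly_factor)
  define g where "g = (\<Sum>r\<le>k. monom 1 (2 * r) :: complex poly)"
  have g: "g * [:1, - 1:] * [:1, 1:] = 1 - monom 1 (2 * k + 2)"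
    unfolding g_def by (rule geometric_even_monom)
  from \<open>poly p (- 1) = c\<close> have "poly (monom 1 1 * p + [:c:]) (- 1) = 0" by (simp add: poly_monom)
  then obtain v where v: "monom 1 1 * p + [:c:] = [:1, 1:] * v"
    unfolding poly_eq_0_iff_dvd by (auto simp: dvd_def)
  have dv: "degree v \<le> m"
  proof (cases "v = 0")
    case False
    have "degree ([:1, 1:] * v) = Suc (degree v)"
      using False by (subst degree_mult_eq) auto
    moreover have "degree (monom 1 1 * p + [:c:]) \<le> Suc m"
    proof (rule degree_add_le)
      show "degree (monom 1 1 * p) \<le> Suc m"
        using order.trans[OF degree_mult_le, of "monom (1 :: complex) 1" p "Suc m"] dp
            by (simp add: degree_monom_eq)
    qed simp
    ultimately show ?thesis unfolding v by simp
  qed simp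
  have gp: "g * (monom 1 1 * falling_poly (Suc m)) + smult c (monom 1 2 * g) =
      v - monom 1 (2 * k + 2) * v + smult c (monom 1 1 * g) - [:c:] + smult c (monom 1 (2 * k + 2))"
  proof -
    have "[:1, 1:] * (g * (monom 1 1 * falling_poly (Suc m))) = (g * [:1, - 1:] * [:1, 1:]) * (monom 1 1 * p)"
      by (simp only: fp ac_simps)
    also have "monom 1 1 * p = [:1, 1:] * v - [:c:]" using v by (simp add: eq_diff_eq)
    also have "(g * [:1, - 1:] * [:1, 1:]) * ([:1, 1:] * v - [:c:]) =
        [:1, 1:] * ((g * [:1, - 1:] * [:1, 1:]) * v) - [:1, 1:] * (g * [:1, - 1:] * [:c:])"
      by (simp only: right_diff_distrib ac_simps)
    finally have "[:1, 1:] * (g * (monom 1 1 * falling_poly (Suc m))) = [:1, 1:] * ((1 - monom 1 (2 * k +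
        2)) * v - g * [:1, - 1:] * [:c:])"
      by (simp only: g right_diff_distrib)
    then have e: "g * (monom 1 1 * falling_poly (Suc m)) = (1 - monom 1 (2 * k +
        2)) * v - g * [:1, - 1:] * [:c:]"
      by (subst (asm) mult_cancel_left) simp
    have X: "monom 1 1 = [:0, 1 :: complex:]" "monom 1 2 = [:0, 1:] * [:0, 1 :: complex:]"
      by (simp_all add: monom_altdef numeral_eq_Suc)
    have s: "smult c q = q * [:c:]" for q by simp
    have "monom 1 2 * g = g - (1 - monom 1 (2 * k + 2))"
      unfolding g[symmetric] X by (simp add: algebra_simps)
    then have "g * (monom 1 1 * falling_poly (Suc m)) + smult c (monom 1 2 * g) =
       (1 - monom 1 (2 * k + 2)) * v - g * [:1, - 1:] * [:c:] + (g - (1 - monom 1 (2 * k + 2))) * [:c:]"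
      by (simp only: e s)
    also have "[:1, - 1 :: complex:] = 1 - monom 1 1" by (simp only: X) (simp add: one_pCons)
    finally have "g * (monom 1 1 * falling_poly (Suc m)) + smult c (monom 1 2 * g) =
      (1 - monom 1 (2 * k + 2)) * v - g * (1 - monom 1 1) * [:c:] + (g - (1 - monom 1 (2 * k + 2))) * [:c:]" .
    moreover have "(1 - a) * v - g * (1 - b) * d + (g - (1 - a)) * d = v - a * v + b * g * d - d + a * d"
      for a b d :: "complex poly" by (simp add: algebra_simps)
    ultimately show ?thesis unfolding s by (rule trans)
  qed
  have "(\<Sum>r\<le>k. poly_comb f (monom 1 (2 * r) * (monom 1 1 * falling_poly (Suc m))) + c *\<^sub>C f (2 * r + 2)) =
      poly_comb f (g * (monom 1 1 * falling_poly (Suc m)) + smult c (monom 1 2 * g))"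
  proof -
    have "poly_comb f (monom 1 2 * g) = (\<Sum>r\<le>k. f (2 * r + 2))"
      using poly_comb_monom_mult[of "\<lambda>i. f (i + 2)" _ 1]
      by (simp add: g_def poly_comb_monom_mult poly_comb_sum poly_comb_1)
    then show ?thesis
      by (simp add: g_def sum.distrib poly_comb_add poly_comb_smult poly_comb_sum sum_distrib_right
          complex_vector.scale_sum_right)
  qed
  also have "\<dots> = 0"
  proof -
    have "poly_comb f v = 0" using dv low by (intro poly_comb_eq_0) simp
    moreover have "poly_comb f (monom 1 (2 * k + 2) * v) = 0"
      unfolding poly_comb_monom_mult using high by (intro poly_comb_eq_0) simp
    moreover have "poly_comb f (monom 1 1 * g) = 0"
      using poly_comb_monom_mult[of "\<lambda>i. f (i + 1)" _ 1] odd
      by (simp add: g_def poly_comb_monom_mult poly_comb_sum poly_comb_1)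
    moreover have "poly_comb f [:c:] = 0" using low by (simp add: poly_comb_def)
    moreover have "poly_comb f (monom 1 (2 * k + 2)) = 0"
      using poly_comb_monom_mult[of f "2 * k + 2" 1] high by (simp add: poly_comb_1)
    ultimately show ?thesis unfolding gp by (simp add: poly_comb_diff poly_comb_add poly_comb_smult)
  qed
  finally show ?thesis unfolding c_def .
qed

section \<open>Vacuum modules at the critical level\<close>

lemma clinear_bracket_left: "clinear (\<lambda>u. bracket u x)"
  by (intro clinearI bracket_add_left bracket_scaleC_left)

lemma sum_binomial_diagonal: "(\<Sum>e<n. (e + m) choose m) = (n + m) choose Suc m"
  by (induction n) simp_all

text \<open>The right-hand side is the diagonal sum of the \<open>n - m\<close> weights
  \<open>(e + m) choose m\<close>, so that \<open>(n choose m) / Suc m\<close> is their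
  mean.\<close>

lemma binomial_sum_average: "of_nat (n - m) * (of_nat (n choose m) / of_nat (Suc m)) =
    (of_nat (n choose Suc m) :: complex)"
proof -
  have "(n - m) * (n choose m) = Suc m * (n choose Suc m)"
    using binomial_absorb_comp[of n m] binomial_absorption[of m n] by simp
  then have "of_nat (n - m) * of_nat (n choose m) = of_nat (Suc m) * (of_nat (n choose Suc m) :: complex)"
    by (metis of_nat_mult)
  then show ?thesis by (simp add: divide_simps mult.commute del: of_nat_Suc)
qed

lemma summation_by_parts:
  fixes W :: "nat \<Rightarrow> 'v::complex_vector"
  shows "(\<Sum>e\<le>n. w e *\<^sub>C W e) =
    (\<Sum>e\<le>n. w e) *\<^sub>C W n - (\<Sum>a<n. (\<Sum>e\<le>a. w e) *\<^sub>C (W (Suc a) - W a))"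
  by (induction n) (simp_all add: scaleC_add_left complex_vector.scale_right_diff_distrib algebra_simps)

text \<open>Pascal's rule. The first sum collects insertions standing behind one more
  \<open>D\<close>, the second those of the commutator, which has lowered the mode by one.\<close>

lemma binomial_sum_step:
  fixes W :: "nat \<Rightarrow> nat \<Rightarrow> 'v::complex_vector"
  shows "(\<Sum>e<N - Suc m. of_nat ((e + Suc m) choose Suc m) *\<^sub>C W (Suc e) (N - Suc m - 1 - e)) +
      (\<Sum>e<N - m. of_nat ((e + m) choose m) *\<^sub>C W e (N - m - 1 - e)) =
    (\<Sum>e<Suc N - Suc m. of_nat ((e + Suc m) choose Suc m) *\<^sub>C W e (Suc N - Suc m - 1 - e))"
proof (cases "N \<le> m")
  case False
  define n where "n = N - Suc m"
  have n: "N - Suc m = n" "N - m = Suc n" "Suc N - Suc m = Suc n" using False by (simp_all add: n_def)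
  show ?thesis
    unfolding n sum.lessThan_Suc_shift
    by (simp add: scaleC_add_left sum.distrib algebra_simps)
qed simp

text \<open>Isolating the relations of the vacuum module places the computation in an algebra of
  endomorphisms. The coefficient \<open>- (of_int m / 2)\<close> of the Killing form is the critical
  level.\<close>

locale critical_vacuum =
  fixes X :: "int \<Rightarrow> 'g::complex_lie_algebra \<Rightarrow> 'v::complex_vector endo" and T :: "'v endo" and vac :: 'v
  assumes fin: "finite (basis :: 'g set)"
    and clinear_X: "clinear (X n)"
    and X_commutator: "X m x * X n y - X n y * X m x =
      X (m + n) (bracket x y) + (if m + n = 0 then - (of_int m / 2) * killing_form x y else 0) *\<^sub>C 1"
    and T_commutator: "T * X n x - X n x * T = - of_int n *\<^sub>C X (n - 1) x"
    and X_vac: "0 \<le> n \<Longrightarrow> apply_endo (X n x) vac = 0"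
    and T_vac: "apply_endo T vac = 0"
begin

definition D :: "'g \<Rightarrow> 'v endo"
  where "D y = T + X (- 1) y"

definition insertion :: "int \<Rightarrow> nat \<Rightarrow> nat \<Rightarrow> 'g \<Rightarrow> 'g \<Rightarrow> 'v"
  where "insertion n e d z y = apply_endo (D y ^ e * X n z * D y ^ d) vac"

lemma clinear_insertion: "clinear (\<lambda>z. insertion n e d z y)"
  unfolding insertion_def
  by (intro clinearI) (simp_all add: clinear_add[OF clinear_X] clinear_scale[OF clinear_X] algebra_simps
      endo_scaleC_mult plus_endo.rep_eq scaleC_endo.rep_eq)

lemma D_X_commutator: "D y * X (- 1) z - X (- 1) z * D y = X (- 2) (z + bracket y z)"
  using T_commutator[of "- 1" z] X_commutator[of "- 1" y "- 1" z]
  by (simp add: D_def algebra_simps scaleC_one clinear_add[OF clinear_X])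

lemma X_D_commutator:
  "X (int m) x * D y = D y * X (int m) x + X (int m - 1) (of_nat m *\<^sub>C x - bracket y x) +
    (if m = 1 then - (1 / 2) * killing_form x y else 0) *\<^sub>C 1"
proof -
  have "X (int m) x * T = T * X (int m) x + of_nat m *\<^sub>C X (int m - 1) x"
    using T_commutator[of "int m" x] by (simp add: algebra_simps)
  moreover have "X (int m) x * X (- 1) y = X (- 1) y * X (int m) x + X (int m - 1) (bracket x y) +
      (if m = 1 then - (1 / 2) * killing_form x y else 0) *\<^sub>C 1"
    using X_commutator[of "int m" x "- 1" y] by (auto simp: algebra_simps split: if_splits)
  moreover have "X (int m - 1) (of_nat m *\<^sub>C x - bracket y x) = of_nat m *\<^sub>C X (int m - 1) x +
      X (int m - 1) (bracket x y)"
    using bracket_anti[of y x] by (simp add: clinear_add[OF clinear_X] clinear_scale[OF clinear_X])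
  ultimately show ?thesis by (simp add: D_def algebra_simps)
qed

text \<open>Moving \<open>x[m]\<close> to the right through \<open>D y ^ N\<close>, where \<open>\<tau> + y[-1]\<close> replaces \<open>x[j]\<close> by
  \<open>((j - ad y) x)[j - 1]\<close>.\<close>
lemma X_D_power_vac:
  "apply_endo (X (int m) x * D y ^ N) vac =
    (if m = 0 then 0 else of_nat (fact m * (N choose m)) * (- (1 / 2) * killing_form x y)) *\<^sub>C apply_endo (D
        y ^ (N - m)) vac -
    (\<Sum>e<N - m. of_nat ((e + m) choose m) *\<^sub>C
      insertion (- 1) e (N - m - 1 - e) (poly_comb (\<lambda>i. (bracket y ^^ i) x) (monom 1 1 * falling_poly m)) y)"
proof (induction N arbitrary: m x)
  case 0
  show ?case using X_vac[of "int m" x] by (simp add: times_endo.rep_eq)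
next
  case (Suc N)
  let ?v = "\<lambda>N. apply_endo (D y ^ N) vac"
  have step: "apply_endo (X (int m) x * D y ^ Suc N) vac =
      apply_endo (D y) (apply_endo (X (int m) x * D y ^ N) vac) +
      apply_endo (X (int m - 1) (of_nat m *\<^sub>C x - bracket y x) * D y ^ N) vac +
      (if m = 1 then - (1 / 2) * killing_form x y else 0) *\<^sub>C ?v N"
  proof -
    have "X (int m) x * D y ^ Suc N = (X (int m) x * D y) * D y ^ N"
      by (simp add: mult.assoc)
    then show ?thesis
      unfolding X_D_commutator
      by (simp add: distrib_right mult.assoc endo_scaleC_mult plus_endo.rep_eq scaleC_endo.rep_eq
          times_endo.rep_eq)
  qed
  have Dins: "apply_endo (D y) (insertion (- 1) e d z y) = insertion (- 1) (Suc e) d z y" for e d z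
    by (simp add: insertion_def times_endo.rep_eq)
  have Dv: "apply_endo (D y) (?v n) = ?v (Suc n)" for n
    by (simp add: times_endo.rep_eq)
  note lin = clinear_add[OF clinear_apply_endo] clinear_diff[OF clinear_apply_endo]
    clinear_scale[OF clinear_apply_endo] clinear_sum_distrib[OF clinear_apply_endo]
  show ?case
  proof (cases m)
    case 0
    have Z: "poly_comb (\<lambda>i. (bracket y ^^ i) x) (monom 1 1 * falling_poly 0) = bracket y x"
      by (simp only: falling_poly_0 poly_comb_monom_mult poly_comb_1) simp
    have "apply_endo (D y) (apply_endo (X (int 0) x * D y ^ N) vac) =
        - (\<Sum>e<N. insertion (- 1) (Suc e) (N - 1 - e) (bracket y x) y)"
      unfolding Suc.IH Z lin Dins by (simp add: scaleC_one)
    moreover have "apply_endo (X (int 0 - 1) (of_nat 0 *\<^sub>C x - bracket y x) * D y ^ N) vac =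
        - insertion (- 1) 0 N (bracket y x) y"
      using clinear_minus[OF clinear_insertion, of "- 1" 0 N "bracket y x" y] by (simp add: insertion_def)
    moreover have "(\<Sum>e<Suc N. insertion (- 1) e (N - e) (bracket y x) y) =
        insertion (- 1) 0 N (bracket y x) y + (\<Sum>e<N. insertion (- 1) (Suc e) (N - 1 - e) (bracket y x) y)"
      unfolding sum.lessThan_Suc_shift by simp
    ultimately show ?thesis
      unfolding step[unfolded 0] 0 Z by (simp add: scaleC_one del: sum.lessThan_Suc)
  next
    case (Suc m')
    let ?z = "of_nat m *\<^sub>C x - bracket y x"
    let ?W = "\<lambda>e d. insertion (- 1) e d (poly_comb (\<lambda>i. (bracket y ^^ i) x) (monom 1 1 * falling_poly m)) y"
    \<comment> \<open>The new factor \<open>m - ad y\<close> commutes with the earlier ones and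
      completes \<open>falling_poly m\<close>.\<close>
    have p: "poly_comb (\<lambda>i. (bracket y ^^ i) ?z) (monom 1 1 * falling_poly m') =
        poly_comb (\<lambda>i. (bracket y ^^ i) x) (monom 1 1 * falling_poly m)"
    proof -
      have lin: "clinear (\<lambda>x. (bracket y ^^ i) x)" for i
      proof (induction i)
        case 0
        show ?case by (simp add: clinear_id)
      next
        case (Suc i)
        from clinear_compose[OF clinear_bracket Suc] show ?case by simp
      qed
      have "(bracket y ^^ i) ?z = of_nat m *\<^sub>C (bracket y ^^ i) x + (- 1) *\<^sub>C (bracket y ^^ Suc i) x" for i
        by (simp add: clinear_diff[OF lin] clinear_scale[OF lin] funpow_swap1)
      with poly_comb_mult_linear[of "\<lambda>i. (bracket y ^^ i) x" "monom 1 1 * falling_poly m'" "of_nat m" "- 1"]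
      show ?thesis by (simp only: Suc falling_poly_Suc mult.assoc)
    qed
    \<comment> \<open>The Killing form with \<open>y\<close> sees only the scalar part of
      \<open>m - ad y\<close>, since it vanishes on \<open>bracket y x\<close> and \<open>y\<close>.
      Over all steps these scalars multiply to m!.\<close>
    have K: "killing_form ?z y = of_nat m * killing_form x y"
    proof -
      have "killing_form (bracket y x) y = killing_form y (bracket x y)" by (rule killing_form_invariant)
      also have "bracket x y = - bracket y x" by (rule bracket_anti)
      also have "killing_form y (- bracket y x) = - killing_form (bracket y x) y"
        using killing_form_scaleC_right[of y "- 1" "bracket y x"] by (simp add: killing_form_commute)
      finally have "killing_form (bracket y x) y = 0" by simp
      then show ?thesis
        using killing_form_add_left[of ?z "bracket y x" y] by (simp add: killing_form_scaleC_left)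
    qed
    have E1: "apply_endo (D y) (apply_endo (X (int m) x * D y ^ N) vac) =
        (of_nat (fact m * (N choose m)) * (- (1 / 2) * killing_form x y)) *\<^sub>C ?v (Suc N - m) -
        (\<Sum>e<N - m. of_nat ((e + m) choose m) *\<^sub>C ?W (Suc e) (N - m - 1 - e))"
    proof -
      \<comment> \<open>The truncated exponents differ only for \<open>N < m\<close>, where the
        binomial coefficient is zero.\<close>
      have "of_nat (N choose m) *\<^sub>C ?v (Suc (N - m)) = of_nat (N choose m) *\<^sub>C ?v (Suc N - m)"
        by (cases "m \<le> N") (simp_all add: Suc_diff_le)
      then have "(of_nat (fact m * (N choose m)) * c) *\<^sub>C ?v (Suc (N - m)) =
          (of_nat (fact m * (N choose m)) * c) *\<^sub>C ?v (Suc N - m)" for c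
        by (cases "m \<le> N") (simp_all add: Suc_diff_le)
      then show ?thesis
        unfolding Suc.IH lin Dins Dv using Suc by simp
    qed
    have E2: "apply_endo (X (int m - 1) ?z * D y ^ N) vac =
        (if m' = 0 then 0 else of_nat (fact m' * (N choose m')) * (- (1 / 2) * (of_nat m * killing_form x
            y))) *\<^sub>C ?v (Suc N - m) -
        (\<Sum>e<N - m'. of_nat ((e + m') choose m') *\<^sub>C ?W e (N - m' - 1 - e))"
      using Suc.IH[of m' ?z] unfolding p K by (simp add: Suc)
    have E3: "(if m = 1 then - (1 / 2) * killing_form x y else 0) *\<^sub>C ?v N =
        (if m = 1 then - (1 / 2) * killing_form x y else 0) *\<^sub>C ?v (Suc N - m)" by simp
    have S: "(\<Sum>e<N - m. of_nat ((e + m) choose m) *\<^sub>C ?W (Suc e) (N - m - 1 - e)) +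
        (\<Sum>e<N - m'. of_nat ((e + m') choose m') *\<^sub>C ?W e (N - m' - 1 - e)) =
        (\<Sum>e<Suc N - m. of_nat ((e + m) choose m) *\<^sub>C ?W e (Suc N - m - 1 - e))"
      using binomial_sum_step[where N = N and m = m' and W = ?W] by (simp only: Suc)
    have comb: "(u - s) + (v - t) + w = u + v + w - (s + t)" for u v w s t :: 'v
      by (simp add: algebra_simps)
    have "apply_endo (X (int m) x * D y ^ Suc N) vac =
        (of_nat (fact m * (N choose m)) * (- (1 / 2) * killing_form x y) +
          (if m' = 0 then 0 else of_nat (fact m' * (N choose m')) * (- (1 / 2) * (of_nat m * killing_form x
              y))) +
          (if m = 1 then - (1 / 2) * killing_form x y else 0)) *\<^sub>C ?v (Suc N - m) -
        (\<Sum>e<Suc N - m. of_nat ((e + m) choose m) *\<^sub>C ?W e (Suc N - m - 1 - e))"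
      unfolding step E1 E2 E3 comb S scaleC_add_left by (rule refl)
    moreover have "of_nat (fact m * (N choose m)) * (- (1 / 2) * killing_form x y) +
          (if m' = 0 then 0 else of_nat (fact m' * (N choose m')) * (- (1 / 2) * (of_nat m * killing_form x
              y))) +
          (if m = 1 then - (1 / 2) * killing_form x y else 0) =
        of_nat (fact m * (Suc N choose m)) * (- (1 / 2) * killing_form x y)"
      by (simp add: Suc field_simps)
    ultimately show ?thesis using Suc by simp
  qed
qed

section \<open>Insertions as polynomial maps\<close>

lemma polymap_D_power:
  "polymap {..N} (\<lambda>y. D y ^ N) (\<lambda>y z. \<Sum>e<N. D y ^ e * X (- 1) z * D y ^ (N - 1 - e))"
proof (induction N)
  case 0
  show ?case by (simp add: polymap_const)
next
  case (Suc N)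
  have "polymap {..1} D (\<lambda>y z. 0 + X (- 1) z)"
    unfolding D_def by (intro polymap_plus polymap_const polymap_linear fin clinear_X) simp_all
  from polymap_endo_mult[OF this Suc, of "{..Suc N}"]
  have "polymap {..Suc N} (\<lambda>y. D y * D y ^ N)
      (\<lambda>y z. (0 + X (- 1) z) * D y ^ N + D y * (\<Sum>e<N. D y ^ e * X (- 1) z * D y ^ (N - 1 - e)))" by simp
  moreover have "(0 + X (- 1) z) * D y ^ N + D y * (\<Sum>e<N. D y ^ e * X (- 1) z * D y ^ (N - 1 - e)) =
      (\<Sum>e<Suc N. D y ^ e * X (- 1) z * D y ^ (Suc N - 1 - e))" for y z
  proof -
    have "D y * (\<Sum>e<N. g e) = (\<Sum>e<N. D y * g e)" for g :: "nat \<Rightarrow> 'v endo"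
      by (induction N) (simp_all add: distrib_left)
    then show ?thesis unfolding sum.lessThan_Suc_shift by (simp add: mult.assoc)
  qed
  ultimately show ?case by simp
qed

lemma polymap_D_power_vac:
  "polymap {..N} (\<lambda>y. apply_endo (D y ^ N) vac) (\<lambda>y z. \<Sum>e<N. insertion (- 1) e (N - 1 - e) z y)"
proof -
  have "apply_endo (\<Sum>e<N. g e) vac = (\<Sum>e<N. apply_endo (g e) vac)" for g
    by (rule clinear_sum_distrib[OF clinear_apply_endo_left])
  then show ?thesis
    using polymap_linear_image[OF polymap_D_power clinear_apply_endo_left[of vac], of N]
        by (simp add: insertion_def)
qed

text \<open>The brackets contribute exactly \<open>i\<close> to the degree and each
  \<open>D y\<close> at most 1. Both ends of the range matter: degree \<open>k\<close> is missed if
  \<open>i > k\<close> and if \<open>i + e + d < k\<close>.\<close>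

lemma polymap_insertion:
  "\<exists>E'. polymap {i..i + e + d} (\<lambda>y. insertion n e d ((bracket y ^^ i) x) y) E'"
proof -
  have "\<exists>E'. polymap {i} (\<lambda>y. (bracket y ^^ i) x) E'"
  proof (induction i)
    case 0
    show ?case using polymap_const[of "{0}" x] by auto
  next
    case (Suc i)
    then obtain E' where E': "polymap {i} (\<lambda>y. (bracket y ^^ i) x) E'" by blast
    have lin: "polymap {1} (\<lambda>y :: 'g. y) (\<lambda>y z. z)" by (rule polymap_linear[OF fin clinear_id]) simp
    have "polymap {Suc i} (\<lambda>y. bracket y ((bracket y ^^ i) x))
        (\<lambda>y z. bracket z ((bracket y ^^ i) x) + bracket y (E' y z))"
      by (rule polymap_bilinear[OF lin E' clinear_bracket_left clinear_bracket]) simp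
    then show ?case by auto
  qed
  then obtain E' where "polymap {i} (\<lambda>y. (bracket y ^^ i) x) E'" by blast
  from polymap_linear_image[OF this clinear_X] have "\<exists>E'. polymap {i}
      (\<lambda>y. X n ((bracket y ^^ i) x)) E'" by blast
  then obtain E' where E': "polymap {i} (\<lambda>y. X n ((bracket y ^^ i) x)) E'" by blast
  have "polymap {i..i + e} (\<lambda>y. D y ^ e * X n ((bracket y ^^ i) x)) (\<lambda>y z.
      (\<Sum>a<e. D y ^ a * X (- 1) z * D y ^ (e - 1 - a)) * X n ((bracket y ^^ i) x) + D y ^ e * E' y z)"
    by (rule polymap_endo_mult[OF polymap_D_power E']) auto
  from polymap_endo_mult[OF this polymap_D_power, of d "{i..i + e + d}"]
  show ?thesis
    unfolding insertion_def using polymap_linear_image[OF _ clinear_apply_endo_left[of vac]] by fastforce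
qed

lemma insertion_coord:
  "insertion n e d ((bracket y ^^ i) x) y = (\<Sum>b\<in>basis. coord b x *\<^sub>C insertion n e d ((bracket y ^^ i) b) y)"
proof -
  have "clinear (\<lambda>x. insertion n e d ((bracket y ^^ i) x) y)"
  proof (induction i)
    case 0
    show ?case by (simp add: clinear_insertion)
  next
    case (Suc i)
    from clinear_compose[OF Suc clinear_bracket[of y]] show ?case by (simp add: funpow_swap1)
  qed
  from clinear_sum_coord[OF fin this] show ?thesis by simp
qed

lemma ad_power: "apply_endo (ad y ^ n) x = (bracket y ^^ n) x" for y :: 'g
  by (induction n) (simp_all add: one_endo.rep_eq times_endo.rep_eq ad.rep_eq)

text \<open>The factor \<open>ad v\<close> applied first to \<open>x\<close> is read off in
  coordinates, which are functionals of \<open>ad v\<close>; the other \<open>i\<close> brackets and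
  the powers of \<open>D v\<close> make up the polynomial map. One factor must be available for the
  exchange, hence \<open>Suc i\<close>.\<close>

lemma lin_ext_insertion_shift:
  fixes H M :: "'g sym_algebra"
  assumes H: "represents q k H P\<^sub>0" and M: "represents q (k + 1 - n) M P"
    and n: "0 < n" "n \<le> k" "k < q" and m: "m_map n H = sym_into_gl M"
    and q: "i + e + d + n < q"
  shows "lin_ext (\<lambda>v. insertion c e d ((bracket v ^^ Suc i) x) v) P =
    lin_ext (\<lambda>y. insertion c e d ((bracket y ^^ (i + n)) x) y) P\<^sub>0"
proof -
  have 1: "insertion c e d ((bracket y ^^ (i + j)) x) y =
      (\<Sum>b\<in>basis. coord b (apply_endo (ad y ^ j) x) *\<^sub>C insertion c e d ((bracket y ^^ i) b) y)" for j y
    by (simp add: funpow_add ad_power insertion_coord[where x = "(bracket y ^^ j) x"])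
  have "lin_ext (\<lambda>v. coord b (apply_endo (ad v) x) *\<^sub>C insertion c e d ((bracket v ^^ i) b) v) P =
      lin_ext (\<lambda>y. coord b (apply_endo (ad y ^ n) x) *\<^sub>C insertion c e d ((bracket y ^^ i) b) y) P\<^sub>0" for b
  proof -
    obtain E' where "polymap {i..i + e + d} (\<lambda>y. insertion c e d ((bracket y ^^ i) b) y) E'"
      using polymap_insertion by blast
    from m_map_polymap[OF fin H M n m clinear_compose[OF clinear_coord clinear_apply_endo_left] this] q
    show ?thesis by simp
  qed
  then show ?thesis
    using 1[where j = 1] by (simp add: 1[where j = n] lin_ext_sum_fun)
qed

section \<open>Consequences of invariance\<close>

text \<open>Up to sign, the unweighted sum is the derivative of \<open>D y ^ N\<close> on the vacuum
  in the direction \<open>bracket x y\<close>, which invariance annihilates.\<close>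

lemma lin_ext_insertion_1:
  assumes P: "invariant_points q P" and N: "N < q"
  shows "lin_ext (\<lambda>y. \<Sum>e<N. insertion (- 1) e (N - 1 - e) (bracket y x) y) P = 0"
proof -
  have "insertion (- 1) e d (bracket y x) y = - insertion (- 1) e d (bracket x y) y" for e d y
    using clinear_minus[OF clinear_insertion] bracket_anti[of y x] by metis
  then have "lin_ext (\<lambda>y. \<Sum>e<N. insertion (- 1) e (N - 1 - e) (bracket y x) y) P =
      - lin_ext (\<lambda>y. \<Sum>e<N. insertion (- 1) e (N - 1 - e) (bracket x y) y) P"
    by (simp add: sum_negf lin_ext_uminus_fun)
  also have "\<dots> = 0"
    using invariant_points_polymap[OF P polymap_D_power_vac, of N x] N by fastforce
  finally show ?thesis .
qed

text \<open>Expanding the trace in a basis and moving one factor by invariance cancels the Killing form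
  against two factors \<open>ad y\<close>; this is where the critical level enters.\<close>
lemma lin_ext_killing_form:
  assumes P: "invariant_points q P" and N: "Suc N < q"
  shows "lin_ext (\<lambda>y. killing_form x y *\<^sub>C apply_endo (D y ^ N) vac) P =
    lin_ext (\<lambda>y. \<Sum>e<N. insertion (- 1) e (N - 1 - e) (bracket y (bracket y x)) y) P"
proof -
  have K: "killing_form x y = (\<Sum>b\<in>basis. - coord b (bracket x (bracket b y)))" for y
  proof -
    have "killing_form x y = (\<Sum>b\<in>basis. coord b (bracket x (bracket y b)))"
      by (simp add: killing_form_def endo_trace_def Let_def basis_def coord_def times_endo.rep_eq ad.rep_eq)
    also have "\<dots> = (\<Sum>b\<in>basis. - coord b (bracket x (bracket b y)))"
    proof (rule sum.cong[OF refl])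
      fix b
      show "coord b (bracket x (bracket y b)) = - coord b (bracket x (bracket b y))"
        using bracket_anti[of y b] by (simp add: bracket_minus_right clinear_minus[OF clinear_coord])
    qed
    finally show ?thesis .
  qed
  have ins: "(\<Sum>b\<in>basis. coord b (bracket x y) *\<^sub>C insertion (- 1) e d (bracket b y) y) =
      insertion (- 1) e d (bracket y (bracket y x)) y" for e d y
  proof -
    have "clinear (\<lambda>b. insertion (- 1) e d (bracket b y) y)"
      by (rule clinear_compose[OF clinear_insertion clinear_bracket_left])
    then have "(\<Sum>b\<in>basis. coord b (bracket x y) *\<^sub>C insertion (- 1) e d (bracket b y) y) =
        insertion (- 1) e d (bracket (bracket x y) y) y"
      by (rule clinear_sum_coord[OF fin])
    also have "bracket (bracket x y) y = bracket y (bracket y x)"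
      using bracket_anti[of "bracket x y" y] bracket_anti[of x y] by (simp add: bracket_minus_right)
    finally show ?thesis .
  qed
  \<comment> \<open>Invariance under each basis vector \<open>b\<close> is applied to
    \<open>coord b (bracket x y)\<close> times the power of \<open>D y\<close>. The derivatives of
    the first factor add up to minus the Killing form.\<close>
  have "lin_ext (\<lambda>y. coord b (bracket x (bracket b y)) *\<^sub>C apply_endo (D y ^ N) vac +
      coord b (bracket x y) *\<^sub>C (\<Sum>e<N. insertion (- 1) e (N - 1 - e) (bracket b y) y)) P = 0" for b
  proof -
    have "polymap {..Suc N} (\<lambda>y. coord b (bracket x y) *\<^sub>C apply_endo (D y ^ N) vac)
        (\<lambda>y z. coord b (bracket x z) *\<^sub>C apply_endo (D y ^ N) vac +
          coord b (bracket x y) *\<^sub>C (\<Sum>e<N. insertion (- 1) e (N - 1 - e) z y))"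
      by (rule polymap_scaleC[OF polymap_functional[of _ "{1}"] polymap_D_power_vac])
        (auto intro: clinear_compose[OF clinear_coord clinear_bracket])
    moreover have "{..Suc N} \<subseteq> {..<q}" using N by auto
    ultimately show ?thesis by (rule invariant_points_polymap[OF P])
  qed
  then have "(\<Sum>b\<in>basis. lin_ext (\<lambda>y. coord b (bracket x (bracket b y)) *\<^sub>C apply_endo (D y ^ N) vac +
      coord b (bracket x y) *\<^sub>C (\<Sum>e<N. insertion (- 1) e (N - 1 - e) (bracket b y) y)) P) = 0" by simp
  then have "lin_ext (\<lambda>y. - (killing_form x y *\<^sub>C apply_endo (D y ^ N) vac) +
      (\<Sum>b\<in>basis. coord b (bracket x y) *\<^sub>C (\<Sum>e<N. insertion (- 1) e (N - 1 - e) (bracket b y) y))) P = 0"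
    by (simp add: K lin_ext_sum_fun[symmetric] sum.distrib complex_vector.scale_sum_left sum_negf)
  moreover have "(\<Sum>b\<in>basis. coord b (bracket x y) *\<^sub>C (\<Sum>e<N. insertion (- 1) e (N - 1 - e) (bracket b y) y)) =
      (\<Sum>e<N. insertion (- 1) e (N - 1 - e) (bracket y (bracket y x)) y)" for y
    unfolding complex_vector.scale_sum_right by (subst sum.swap) (simp only: ins)
  ultimately show ?thesis by (simp add: lin_ext_diff_fun)
qed

text \<open>Summation by parts leaves differences of neighbouring insertions, and each of them
  inserts a commutator with \<open>D y\<close>.\<close>

lemma insertion_zero_sum:
  assumes "(\<Sum>e<Suc n. w e) = 0"
  shows "(\<Sum>e<Suc n. w e *\<^sub>C insertion (- 1) e (n - e) z y) =
    (\<Sum>a<n. - (\<Sum>e\<le>a. w e) *\<^sub>C insertion (- 2) a (n - 1 - a) (z + bracket y z) y)"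
proof -
  have "insertion (- 1) (Suc a) (n - Suc a) z y - insertion (- 1) a (n - a) z y =
      insertion (- 2) a (n - 1 - a) (z + bracket y z) y" if a: "a < n" for a
  proof -
    obtain d where d: "n = Suc (a + d)" using less_imp_Suc_add[OF a] by blast
    have "D y ^ a * X (- 2) (z + bracket y z) * D y ^ d =
        D y ^ Suc a * X (- 1) z * D y ^ d - D y ^ a * X (- 1) z * D y ^ Suc d"
      unfolding D_X_commutator[symmetric]
      by (simp only: right_diff_distrib left_diff_distrib mult.assoc power_Suc2[of _ a] power_Suc[of _ d])
    then show ?thesis by (simp add: insertion_def d minus_endo.rep_eq)
  qed
  then show ?thesis
    using summation_by_parts[of w "\<lambda>e. insertion (- 1) e (n - e) z y" n] assms
    by (simp add: lessThan_Suc_atMost sum_negf)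
qed

text \<open>Writing \<open>A = ad y\<close>, the commutator with \<open>D y\<close> acts on \<open>z[-1]\<close> as \<open>1 + A\<close>. The condition on
  \<open>m_map (2 * r + 1) H\<close> trades the \<open>r\<close>-th summand for \<open>2 r\<close> additional factors \<open>A\<close> evaluated at \<open>H\<close>.\<close>
theorem X_annihilates_sum:
  fixes H :: "'g sym_algebra" and M :: "nat \<Rightarrow> 'g sym_algebra"
  assumes inj: "inj (ad :: 'g \<Rightarrow> 'g endo)" and k: "0 < k"
    and H: "H \<in> sym_invariants k" and M0: "M 0 = H"
    and rep: "\<And>r. 2 * r + 1 \<le> k \<Longrightarrow> represents q (k - 2 * r) (M r) (P r)"
    and mm: "\<And>r. 1 \<le> r \<Longrightarrow> 2 * r + 1 \<le> k \<Longrightarrow> m_map (2 * r + 1) H = sym_into_gl (M r)"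
    and q: "5 * k + 5 * m + 10 \<le> q"
  shows "(\<Sum>r | 2 * r + 1 \<le> k. lin_ext (\<lambda>y. apply_endo (X (int m) x * D y ^ k) vac) (P r)) = 0"
proof -
  have rep0: "represents q k H (P 0)" using rep[of 0] M0 k by simp
  have rep': "represents q (k + 1 - (2 * r + 1)) (M r) (P r)" if "2 * r + 1 \<le> k" for r
    using rep[OF that] by simp
  \<comment> \<open>For \<open>r = 0\<close> the condition is automatic: both sides apply
    \<open>ad\<close> to the first factor of the symmetrised \<open>H\<close>.\<close>
  have mm': "m_map (2 * r + 1) H = sym_into_gl (M r)" if r: "2 * r + 1 \<le> k" for r
  proof (cases "r = 0")
    case True
    then show ?thesis
      using m_map_represents[OF rep0, of 1] sym_into_gl_represents[OF rep0] k q M0 by simp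
  qed (use mm r in simp)
  have inv: "invariant_points (k + m + 3) (P r)" if r: "2 * r + 1 \<le> k" for r
    using r q by (intro invariant_points_m_map[OF fin inj rep0 rep'[OF r] _ r _ mm'[OF r]
        invariant_points_invariants[OF H rep0]]) auto
  have shift: "lin_ext (\<lambda>y. insertion c e d ((bracket y ^^ Suc i) x) y) (P r) =
      lin_ext (\<lambda>y. insertion c e d ((bracket y ^^ (i + (2 * r + 1))) x) y) (P 0)"
    if "2 * r + 1 \<le> k" "i \<le> m" "e + d \<le> k" for c e d i r
    using that q by (intro lin_ext_insertion_shift[OF rep0 rep'[OF that(1)] _ that(1) _ mm'[OF that(1)]]) auto
  have zero: "lin_ext (\<lambda>y. insertion c e d ((bracket y ^^ i) x) y) (P 0) = 0"
    if "i + e + d < q" "k < i \<or> i + e + d < k" for c e d i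
  proof -
    obtain E' where "polymap {i..i + e + d} (\<lambda>y. insertion c e d ((bracket y ^^ i) x) y) E'"
      using polymap_insertion by blast
    moreover have "{i..i + e + d} \<subseteq> {..<q}" "k \<notin> {i..i + e + d}" using that by auto
    ultimately show ?thesis by (rule represents_polymap_zero[OF rep0])
  qed
  have fin_R: "finite {r. 2 * r + 1 \<le> k}" by (rule finite_subset[of _ "{..k}"]) auto
  show ?thesis
  proof (cases m)
    case 0
    have "lin_ext (\<lambda>y. apply_endo (X (int m) x * D y ^ k) vac) (P r) = 0" if r: "2 * r + 1 \<le> k" for r
    proof -
      have "poly_comb (\<lambda>i. (bracket y ^^ i) x) (monom 1 1 * falling_poly 0) = bracket y x" for y
        by (simp only: falling_poly_0 poly_comb_monom_mult poly_comb_1) simp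
      then have "apply_endo (X (int m) x * D y ^ k) vac = -
          (\<Sum>e<k. insertion (- 1) e (k - 1 - e) (bracket y x) y)" for y
        unfolding X_D_power_vac unfolding 0 by (simp add: scaleC_one)
      then show ?thesis
        using lin_ext_insertion_1[OF inv[OF r], of k x] by (simp add: lin_ext_uminus_fun)
    qed
    then show ?thesis by (intro sum.neutral) simp
  next
    case (Suc m')
    define n where "n = k - m"
    \<comment> \<open>Cut off at \<open>k\<close> by definition: \<open>zero\<close> covers only
      degrees below \<open>q\<close>, whereas the cancellation lemmas ask for vanishing at every
      index above \<open>k\<close>.\<close>
    define l where "l w i = (if i \<le> k then \<Sum>e<n. w e *\<^sub>C
      lin_ext (\<lambda>y. insertion (- 1) e (n - 1 - e) ((bracket y ^^ i) x) y) (P 0) else 0)" for w i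
    define w where "w e = (of_nat ((e + m) choose m) :: complex)" for e
    \<comment> \<open>\<open>p\<close> is the mean of the weights \<open>w\<close>, and
      \<open>p * c\<close> is half of m! times \<open>k choose m\<close>, as in the Killing
      term.\<close>
    define p where "p = (of_nat (k choose m) / of_nat (Suc m) :: complex)"
    define c where "c = (fact (Suc m) / 2 :: complex)"
    let ?F = "\<lambda>r. monom 1 (2 * r) * (monom 1 1 * falling_poly m) :: complex poly"
    have l: "(\<Sum>e<n. w e *\<^sub>C lin_ext (\<lambda>y. insertion (- 1) e (n - 1 - e) ((bracket y ^^ i) x) y) (P 0)) = l w i"
      if "i + k < q" for w i
      using zero[of i _ _ "- 1"] that by (auto simp: l_def n_def intro!: sum.neutral)
    have summand: "lin_ext (\<lambda>y. apply_endo (X (int m) x * D y ^ k) vac) (P r) =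
        - (p *\<^sub>C c *\<^sub>C l (\<lambda>_. 1) (2 * r + 2) + poly_comb (l w) (?F r))" if r: "2 * r + 1 \<le> k" for r
    proof -
      let ?I = "\<lambda>e i y. insertion (- 1) e (n - 1 - e) ((bracket y ^^ i) x) y"
      have "apply_endo (X (int m) x * D y ^ k) vac =
          (- (p * c)) *\<^sub>C (killing_form x y *\<^sub>C apply_endo (D y ^ n) vac) -
          (\<Sum>e<n. w e *\<^sub>C poly_comb (\<lambda>i. ?I e i y) (monom 1 1 * falling_poly m))" for y
      proof -
        have "p * c = of_nat (k choose m) * fact m / 2"
          unfolding p_def c_def fact_Suc[of m] by (simp del: of_nat_Suc)
        then have "of_nat (fact m * (k choose m)) * (- (1 / 2) * killing_form x y) =
            (- (p * c)) * killing_form x y"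
          by (simp only: of_nat_mult of_nat_fact) (simp add: mult.commute)
        then show ?thesis
          unfolding X_D_power_vac using Suc
          by (simp add: n_def w_def scaleC_scaleC poly_comb_linear[OF clinear_insertion])
      qed
      then have "lin_ext (\<lambda>y. apply_endo (X (int m) x * D y ^ k) vac) (P r) =
          (- (p * c)) *\<^sub>C lin_ext (\<lambda>y. killing_form x y *\<^sub>C apply_endo (D y ^ n) vac) (P r) -
          (\<Sum>e<n. w e *\<^sub>C poly_comb (\<lambda>i. lin_ext (?I e i) (P r)) (monom 1 1 * falling_poly m))"
        by (simp only: lin_ext_diff_fun lin_ext_scaleC_fun lin_ext_sum_fun lin_ext_poly_comb_fun)
      \<comment> \<open>The Killing term yields two factors \<open>ad\<close>; one of them is
        exchanged for \<open>2 * r + 1\<close>, whence the index \<open>2 * r + 2\<close>.\<close>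
      also have "lin_ext (\<lambda>y. killing_form x y *\<^sub>C apply_endo (D y ^ n) vac) (P r) = l (\<lambda>_. 1) (2 * r + 2)"
      proof -
        have "lin_ext (\<lambda>y. killing_form x y *\<^sub>C apply_endo (D y ^ n) vac) (P r) =
            lin_ext (\<lambda>y. \<Sum>e<n. ?I e (Suc 1) y) (P r)"
          using lin_ext_killing_form[OF inv[OF r], of n x] by (simp add: n_def)
        also have "\<dots> = (\<Sum>e<n. lin_ext (?I e (1 + (2 * r + 1))) (P 0))"
          unfolding lin_ext_sum_fun by (intro sum.cong refl shift[OF r]) (auto simp: n_def Suc)
        also have "\<dots> = l (\<lambda>_. 1) (2 * r + 2)"
          using l[of "2 * r + 2" "\<lambda>_. 1"] r q by (simp add: scaleC_one)
        finally show ?thesis .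
      qed
      also have "(\<Sum>e<n. w e *\<^sub>C poly_comb (\<lambda>i. lin_ext (?I e i) (P r)) (monom 1 1 * falling_poly m)) =
          (\<Sum>e<n. w e *\<^sub>C poly_comb (\<lambda>i. lin_ext (?I e (i + (2 * r + 1))) (P 0)) (falling_poly m))"
        unfolding poly_comb_monom_mult
        using order.trans[OF _ degree_falling_poly[of m]]
        by (intro sum.cong refl arg_cong[of _ _ "\<lambda>v. _ *\<^sub>C v"] poly_comb_cong)
          (rule shift[OF r, unfolded Suc_eq_plus1], auto simp: n_def)
      also have "\<dots> = poly_comb (\<lambda>i. \<Sum>e<n. w e *\<^sub>C lin_ext (?I e (i + (2 * r + 1))) (P 0)) (falling_poly m)"
        by (simp only: poly_comb_sum_fun poly_comb_scaleC_fun)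
      also have "\<dots> = poly_comb (\<lambda>i. l w (i + (2 * r + 1))) (falling_poly m)"
        using order.trans[OF _ degree_falling_poly[of m]] r q by (intro poly_comb_cong l) fastforce
      also have "\<dots> = poly_comb (l w) (?F r)"
        unfolding poly_comb_monom_mult by (simp add: add.assoc add.commute)
      finally show ?thesis by (simp add: scaleC_scaleC)
    qed
    have "(\<Sum>r | 2 * r + 1 \<le> k. lin_ext (\<lambda>y. apply_endo (X (int m) x * D y ^ k) vac) (P r)) =
        - (\<Sum>r | 2 * r + 1 \<le> k. p *\<^sub>C c *\<^sub>C l (\<lambda>_. 1) (2 * r + 2) + poly_comb (l w) (?F r))"
      unfolding sum_negf[symmetric] by (intro sum.cong refl summand) simp
    \<comment> \<open>The additional values of \<open>r\<close> contribute only indices above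
      \<open>k\<close>.\<close>
    also have "(\<Sum>r | 2 * r + 1 \<le> k. p *\<^sub>C c *\<^sub>C l (\<lambda>_. 1) (2 * r + 2) + poly_comb (l w) (?F r)) =
        (\<Sum>r\<le>k. p *\<^sub>C c *\<^sub>C l (\<lambda>_. 1) (2 * r + 2) + poly_comb (l w) (?F r))"
    proof (rule sum.mono_neutral_left)
      show "\<forall>r\<in>{..k} - {r. 2 * r + 1 \<le> k}. p *\<^sub>C c *\<^sub>C l (\<lambda>_. 1) (2 * r + 2) + poly_comb (l w) (?F r) = 0"
        by (auto simp: l_def poly_comb_monom_mult intro!: poly_comb_eq_0)
    qed auto
    also have "\<dots> = 0"
    proof (cases "k \<le> m")
      case True
      then have "l u i = 0" for u i by (simp add: l_def n_def)
      then show ?thesis by (simp add: poly_comb_eq_0)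
    next
      case False
      then obtain n' where n': "n = Suc n'" "k = Suc (n' + m)"
        using less_imp_Suc_add[of m k] by (auto simp: n_def add.commute)
      \<comment> \<open>The deviation from the mean; its partial sums become the coefficients of the
        commutators.\<close>
      define w' where "w' e = w e - p" for e
      define c' where "c' a = - (\<Sum>e\<le>a. w' e)" for a
      define l' where "l' i = (if i \<le> k then \<Sum>a<n'. c' a *\<^sub>C
        lin_ext (\<lambda>y. insertion (- 2) a (n' - 1 - a) ((bracket y ^^ i) x) y) (P 0) else 0)" for i
      have "(\<Sum>e<n. w e) = of_nat (k choose Suc m)"
        using sum_binomial_diagonal[of m n] n' by (simp add: w_def flip: of_nat_sum)
      moreover have "of_nat n * p = of_nat (k choose Suc m)"
        using binomial_sum_average[of k m] by (simp add: p_def n_def)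
      ultimately have w': "(\<Sum>e<Suc n'. w' e) = 0"
        unfolding w'_def sum_subtractf n'(1)[symmetric] by simp
      have lw: "l w i = l w' i + p *\<^sub>C l (\<lambda>_. 1) i" for i
        by (simp add: l_def w'_def scaleC_one complex_vector.scale_left_diff_distrib
            complex_vector.scale_sum_right sum_subtractf)
      have l': "l w' i = l' i + l' (Suc i)" for i
      proof (cases "i \<le> k")
        case True
        let ?J = "\<lambda>a i y. insertion (- 2) a (n' - 1 - a) ((bracket y ^^ i) x) y"
        have "l w' i = lin_ext (\<lambda>y. \<Sum>e<Suc n'. w' e *\<^sub>C insertion (- 1) e (n' - e) ((bracket y ^^ i) x) y)
            (P 0)"
          using True by (simp add: l_def n' lin_ext_sum_fun lin_ext_scaleC_fun del: sum.lessThan_Suc)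
        also have "\<dots> = lin_ext (\<lambda>y. \<Sum>a<n'. c' a *\<^sub>C (?J a i y + ?J a (Suc i) y)) (P 0)"
          unfolding insertion_zero_sum[OF w'] clinear_add[OF clinear_insertion] by (simp add: c'_def)
        also have "\<dots> = (\<Sum>a<n'. c' a *\<^sub>C lin_ext (?J a i) (P 0)) +
            (\<Sum>a<n'. c' a *\<^sub>C lin_ext (?J a (Suc i)) (P 0))"
          by (simp only: lin_ext_sum_fun lin_ext_scaleC_fun lin_ext_plus_fun scaleC_add_right sum.distrib)
        \<comment> \<open>For \<open>i = k\<close> the sum is zero because \<open>Suc i\<close>
          brackets exceed the degree of \<open>H\<close>, which agrees with the cut-off in
          \<open>l'\<close>.\<close>
        also have "(\<Sum>a<n'. c' a *\<^sub>C lin_ext (?J a (Suc i)) (P 0)) = l' (Suc i)"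
          using zero[of "Suc i" _ _ "- 2"] True q n' by (auto simp: l'_def intro!: sum.neutral)
        finally show ?thesis using True by (simp add: l'_def)
      qed (simp add: l_def l'_def)
      have "(\<Sum>r\<le>k. poly_comb (\<lambda>i. l' i + l' (Suc i)) (?F r)) = 0"
        unfolding Suc
      \<comment> \<open>Each insertion contains \<open>n' - 1\<close> factors \<open>D\<close>, and
        \<open>n' + m = k - 1\<close>; for \<open>i\<close> up to \<open>Suc m\<close> the degree
        stays below \<open>k\<close>.\<close>
      proof (rule alternating_cancellation)
        show "l' i = 0" if "i \<le> Suc (Suc m')" for i
          using zero[of i _ _ "- 2"] that q n' Suc by (auto simp: l'_def intro!: sum.neutral)
      qed (simp add: l'_def)
      then have 1: "(\<Sum>r\<le>k. poly_comb (l w') (?F r)) = 0" by (simp only: l'[symmetric])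
      have 2: "(\<Sum>r\<le>k. poly_comb (l (\<lambda>_. 1)) (?F r) + c *\<^sub>C l (\<lambda>_. 1) (2 * r + 2)) = 0"
        unfolding c_def Suc
      proof (rule parity_cancellation)
        show "l (\<lambda>_. 1) i = 0" if "i \<le> Suc m'" for i
          using zero[of i _ _ "- 1"] that q n' Suc by (auto simp: l_def intro!: sum.neutral)
        show "l (\<lambda>_. 1) i = 0" if "odd i" for i
        proof (cases "i \<le> k")
          case True
          \<comment> \<open>The exchange is used backwards: an odd power of \<open>ad\<close> at
            \<open>H\<close> is a single \<open>ad\<close> at \<open>M r\<close>, to which
            invariance applies.\<close>
          obtain r where r: "i = 2 * r + 1" using \<open>odd i\<close> by (rule oddE)
          have "l (\<lambda>_. 1) i = (\<Sum>e<n. lin_ext (\<lambda>y. insertion (- 1) e (n - 1 - e) ((bracket y ^^ (0 + (2 * r +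
              1))) x) y) (P 0))"
            using True by (simp add: l_def r scaleC_one)
          also have "\<dots> = (\<Sum>e<n. lin_ext (\<lambda>y. insertion (- 1) e (n - 1 - e) ((bracket y ^^ Suc 0) x) y) (P r))"
            using True r n' by (intro sum.cong refl shift[symmetric]) auto
          also have "\<dots> = 0"
            using lin_ext_insertion_1[OF inv, of r n x] True r by (simp add: lin_ext_sum_fun n_def)
          finally show ?thesis .
        qed (simp add: l_def)
      qed (simp add: l_def)
      have "(\<Sum>r\<le>k. p *\<^sub>C c *\<^sub>C l (\<lambda>_. 1) (2 * r + 2) + poly_comb (l w) (?F r)) =
          (\<Sum>r\<le>k. poly_comb (l w') (?F r)) +
          p *\<^sub>C (\<Sum>r\<le>k. poly_comb (l (\<lambda>_. 1)) (?F r) + c *\<^sub>C l (\<lambda>_. 1) (2 * r + 2))"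
        unfolding lw poly_comb_plus_fun poly_comb_scaleC_fun
        by (simp add: sum.distrib complex_vector.scale_sum_right scaleC_add_right)
      then show ?thesis unfolding 1 2 by simp
    qed
    finally show ?thesis by simp
  qed
qed

end

section \<open>Construction of the vacuum module\<close>

lemma env_algebra_induct [case_names zero add]:
  assumes "P 0" "\<And>c xs u. P u \<Longrightarrow> P (c *\<^sub>C prod_list (map env_of xs) + u)"
  shows "P u"
proof -
  have "P (abs_env_algebra t)" for t
  proof (induction t rule: tensor_algebra_induct)
    case zero
    show ?case using assms(1) by (simp add: zero_env_algebra.abs_eq)
  next
    case (add c xs t)
    then show ?case
      using assms(2)[of "abs_env_algebra t" c xs]
      by (simp add: prod_list_env_of plus_env_algebra.abs_eq scaleC_env_algebra.abs_eq)
  qed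
  then show ?thesis by (metis Quotient3_abs_rep[OF Quotient3_env_algebra])
qed

lemma left_ideal_gen: "r \<in> R \<Longrightarrow> r \<in> left_ideal R"
  using left_ideal.add[OF _ left_ideal.zero, of r R 1] by simp

lemma left_ideal_plus: "x \<in> left_ideal R \<Longrightarrow> y \<in> left_ideal R \<Longrightarrow> x + y \<in> left_ideal R"
  by (induction rule: left_ideal.induct) (auto simp: add.assoc intro: left_ideal.intros)

lemma left_ideal_lmult: "x \<in> left_ideal R \<Longrightarrow> a * x \<in> left_ideal R"
proof (induction rule: left_ideal.induct)
  case (add r s b)
  then show ?case using left_ideal.add[of r R "a * s" "a * b"] by (simp add: algebra_simps)
qed (simp add: left_ideal.zero)

lemma left_ideal_minus: "x \<in> left_ideal R \<Longrightarrow> - x \<in> left_ideal R"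
  using left_ideal_lmult[of x R "- 1"] by simp

lemma left_ideal_scaleC: "x \<in> left_ideal R \<Longrightarrow> c *\<^sub>C x \<in> left_ideal R" for x :: "'r::complex_algebra_1"
  using left_ideal_lmult[of x R "c *\<^sub>C 1"] by (simp add: scaleC_mult_left)

definition vacuum_cong :: "'g::complex_lie_algebra affine_algebra env_algebra \<Rightarrow> 'g affine_algebra
    env_algebra \<Rightarrow> bool"
  where "vacuum_cong u v \<longleftrightarrow> u - v \<in> vacuum_ideal"

lemma equivp_vacuum_cong: "equivp vacuum_cong"
proof (rule equivpI)
  show "reflp vacuum_cong" by (auto simp: reflp_def vacuum_cong_def vacuum_ideal_def left_ideal.zero)
  show "symp vacuum_cong"
    unfolding symp_def vacuum_cong_def vacuum_ideal_def using left_ideal_minus by fastforce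
  show "transp vacuum_cong"
    unfolding transp_def vacuum_cong_def vacuum_ideal_def using left_ideal_plus by fastforce
qed

quotient_type (overloaded) 'g vacuum_module = "'g::complex_lie_algebra affine_algebra env_algebra" / vacuum_cong
  by (rule equivp_vacuum_cong)

instantiation vacuum_module :: (complex_lie_algebra) complex_vector
begin
lift_definition zero_vacuum_module :: "'a vacuum_module" is 0 .
lift_definition plus_vacuum_module :: "'a vacuum_module \<Rightarrow> 'a vacuum_module \<Rightarrow> 'a vacuum_module" is "(+)"
proof -
  fix u u' v v' :: "'a affine_algebra env_algebra"
  assume "vacuum_cong u u'" "vacuum_cong v v'"
  then show "vacuum_cong (u + v) (u' + v')"
    using left_ideal_plus[of "u - u'" _ "v - v'"] by (simp add: vacuum_cong_def vacuum_ideal_def algebra_simps)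
qed
lift_definition uminus_vacuum_module :: "'a vacuum_module \<Rightarrow> 'a vacuum_module" is uminus
proof -
  fix u u' :: "'a affine_algebra env_algebra"
  assume "vacuum_cong u u'"
  then show "vacuum_cong (- u) (- u')"
    using left_ideal_minus[of "u - u'"] by (simp add: vacuum_cong_def vacuum_ideal_def)
qed
definition minus_vacuum_module :: "'a vacuum_module \<Rightarrow> 'a vacuum_module \<Rightarrow> 'a vacuum_module"
  where "u - v = u + - v" for u v :: "'a vacuum_module"
lift_definition scaleC_vacuum_module :: "complex \<Rightarrow> 'a vacuum_module \<Rightarrow> 'a vacuum_module" is scaleC
proof -
  fix c and u u' :: "'a affine_algebra env_algebra"
  assume "vacuum_cong u u'"
  then show "vacuum_cong (c *\<^sub>C u) (c *\<^sub>C u')"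
    using left_ideal_scaleC[of "u - u'" _ c]
    by (simp add: vacuum_cong_def vacuum_ideal_def complex_vector.scale_right_diff_distrib)
qed
instance
  by standard (simp add: minus_vacuum_module_def |
    (transfer, simp add: algebra_simps scaleC_add_right scaleC_add_left scaleC_scaleC scaleC_one
      equivp_reflp[OF equivp_vacuum_cong]; fail))+
end

definition vacuum_class :: "'g::complex_lie_algebra affine_algebra env_algebra \<Rightarrow> 'g vacuum_module"
  where "vacuum_class = abs_vacuum_module"

lemma vacuum_class_eq_0_iff: "vacuum_class u = 0 \<longleftrightarrow> u \<in> vacuum_ideal"
  by (simp add: vacuum_class_def zero_vacuum_module.abs_eq vacuum_module.abs_eq_iff vacuum_cong_def)

lemma clinear_vacuum_class: "clinear vacuum_class"
  by (rule clinearI) (simp_all add: vacuum_class_def plus_vacuum_module.abs_eq scaleC_vacuum_module.abs_eq)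

lemma vacuum_class_cases: obtains u where "v = vacuum_class u"
proof -
  have "\<exists>u. v = vacuum_class u"
    unfolding vacuum_class_def by (metis Quotient3_abs_rep[OF Quotient3_vacuum_module])
  then show ?thesis using that by blast
qed

definition induced_endo ::
    "('g::complex_lie_algebra affine_algebra env_algebra \<Rightarrow> 'g affine_algebra env_algebra) \<Rightarrow> 'g vacuum_module
        endo"
  where "induced_endo f = Endo (\<lambda>v. vacuum_class (f (rep_vacuum_module v)))"

lemma induced_endo:
  fixes f :: "'g::complex_lie_algebra affine_algebra env_algebra \<Rightarrow> 'g affine_algebra env_algebra"
  assumes f: "clinear f" and ideal: "\<And>u. u \<in> vacuum_ideal \<Longrightarrow> f u \<in> vacuum_ideal"
  shows "apply_endo (induced_endo f) (vacuum_class u) = vacuum_class (f u)"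
proof -
  define F :: "'g vacuum_module \<Rightarrow> 'g vacuum_module"
    where "F v = vacuum_class (f (rep_vacuum_module v))" for v
  have cl: "F (vacuum_class u) = vacuum_class (f u)" for u
  proof -
    have "vacuum_cong (rep_vacuum_module (vacuum_class u)) u"
      unfolding vacuum_class_def
      by (rule Quotient3_rep_abs[OF Quotient3_vacuum_module equivp_reflp[OF equivp_vacuum_cong]])
    then have "f (rep_vacuum_module (vacuum_class u)) - f u \<in> vacuum_ideal"
      using ideal by (simp add: vacuum_cong_def flip: clinear_diff[OF f])
    then have "vacuum_class (f (rep_vacuum_module (vacuum_class u)) - f u) = 0"
      by (simp only: vacuum_class_eq_0_iff)
    then show ?thesis by (simp add: F_def clinear_diff[OF clinear_vacuum_class])
  qed
  have "clinear F"
  proof (rule clinearI)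
    fix v w :: "'g vacuum_module" and c
    obtain a b where ab: "v = vacuum_class a" "w = vacuum_class b" by (metis vacuum_class_cases)
    show "F (v + w) = F v + F w"
      using cl[of "a + b"] by (simp add: ab cl clinear_add[OF clinear_vacuum_class] clinear_add[OF f])
    show "F (c *\<^sub>C v) = c *\<^sub>C F v"
      using cl[of "c *\<^sub>C a"] by (simp add: ab cl clinear_scale[OF clinear_vacuum_class] clinear_scale[OF f])
  qed
  then have "apply_endo (induced_endo f) = F"
    unfolding induced_endo_def F_def[symmetric] by (intro Endo_inverse) simp
  then show ?thesis by (simp add: cl)
qed

section \<open>Generators and the translation operator\<close>

definition affine_elem :: "int \<Rightarrow> 'g::complex_lie_algebra \<Rightarrow> 'g affine_algebra"
  where "affine_elem n x = Affine (Poly_Mapping.single n x) 0"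

definition affine_tau :: "'g::complex_lie_algebra affine_algebra \<Rightarrow> 'g affine_algebra"
  where "affine_tau p = Affine (loop_tau (loop_part p)) 0"

lemma clinear_affine_tau: "clinear affine_tau"
  by (rule clinearI) (simp_all add: affine_tau_def plus_affine_algebra_def scaleC_affine_algebra_def
      loop_tau_add loop_tau_scaleC)

text \<open>Translation invariance of the cocycle, which makes the extension of
  \<open>loop_tau\<close> by zero on the centre a derivation. On generators with m + n = 1 the two
  terms are multiples of m (m - 1) and m n with sum m (m + n - 1) = 0.\<close>

lemma killing_cocycle_loop_tau: "killing_cocycle (loop_tau p) q + killing_cocycle p (loop_tau q) = 0"
proof -
  have z: "loop_tau 0 = (0 :: int \<Rightarrow>\<^sub>0 'a)" by (simp add: loop_tau_def)
  note bil = killing_cocycle_add_left killing_cocycle_add_right loop_tau_add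
  have 1: "killing_cocycle (loop_tau (Poly_Mapping.single m x)) (Poly_Mapping.single n y) +
      killing_cocycle (Poly_Mapping.single m x) (loop_tau (Poly_Mapping.single n y)) = 0" for m n and x y :: 'a
  proof (cases "m + n = 1")
    case True
    then have n: "n = 1 - m" by simp
    show ?thesis
      unfolding n
      by (simp add: loop_tau_single killing_cocycle_single killing_form_scaleC_left[of "- _"]
          killing_form_scaleC_right[of _ "- _"] killing_form_scaleC_left killing_form_scaleC_right ring_distribs
          del: complex_vector.scale_minus_left)
  qed (simp add: loop_tau_single killing_cocycle_single)
  have 2: "killing_cocycle (loop_tau (Poly_Mapping.single m x)) q +
      killing_cocycle (Poly_Mapping.single m x) (loop_tau q) = 0" for m and x :: 'a and q
  proof (induction q rule: poly_mapping_single_induct)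
    case (add n y q)
    have "killing_cocycle (loop_tau (Poly_Mapping.single m x)) (Poly_Mapping.single n y + q) +
        killing_cocycle (Poly_Mapping.single m x) (loop_tau (Poly_Mapping.single n y + q)) =
      (killing_cocycle (loop_tau (Poly_Mapping.single m x)) (Poly_Mapping.single n y) +
        killing_cocycle (Poly_Mapping.single m x) (loop_tau (Poly_Mapping.single n y))) +
      (killing_cocycle (loop_tau (Poly_Mapping.single m x)) q +
          killing_cocycle (Poly_Mapping.single m x) (loop_tau q))"
      by (simp only: bil ac_simps)
    then show ?case by (simp only: 1 add add_0_left)
  qed (simp add: z)
  show ?thesis
  proof (induction p rule: poly_mapping_single_induct)
    case (add n y p)
    have "killing_cocycle (loop_tau (Poly_Mapping.single n y + p)) q +
        killing_cocycle (Poly_Mapping.single n y + p) (loop_tau q) =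
      (killing_cocycle (loop_tau (Poly_Mapping.single n y)) q +
          killing_cocycle (Poly_Mapping.single n y) (loop_tau q)) +
      (killing_cocycle (loop_tau p) q + killing_cocycle p (loop_tau q))"
      by (simp only: bil ac_simps)
    then show ?case by (simp only: 2 add add_0_left)
  qed (simp add: z)
qed

lemma affine_tau_bracket: "affine_tau (bracket x y) = bracket (affine_tau x) y + bracket x (affine_tau y)"
proof -
  have "- 1 / 2 * killing_cocycle (loop_tau (loop_part x)) (loop_part y) +
      - 1 / 2 * killing_cocycle (loop_part x) (loop_tau (loop_part y)) = 0"
    unfolding distrib_left[symmetric] killing_cocycle_loop_tau by simp
  then show ?thesis
    by (simp add: affine_tau_def bracket_affine_algebra_def plus_affine_algebra_def loop_tau_bracket)
qed

definition translation :: "'g::complex_lie_algebra affine_algebra env_algebra \<Rightarrow> 'g affine_algebra env_algebra"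
  where "translation = env_ext (leibniz env_of affine_tau)"

lemma lie_multilinear_affine_tau: "lie_multilinear (leibniz env_of affine_tau)"
  by (rule lie_multilinear_leibniz[OF clinear_affine_tau affine_tau_bracket])

lemma clinear_translation: "clinear translation"
  unfolding translation_def by (rule clinear_env_ext[OF lie_multilinear_affine_tau])

lemma translation_prod_list: "translation (prod_list (map env_of xs)) = leibniz env_of affine_tau xs"
  unfolding translation_def by (rule env_ext_prod_list[OF lie_multilinear_affine_tau])

lemma translation_1: "translation 1 = 0"
  using translation_prod_list[of "[]"] by simp

lemma translation_env_of: "translation (env_of x) = env_of (affine_tau x)"
  using translation_prod_list[of "[x]"] by simp

lemma translation_mult: "translation (u * v) = translation u * v + u * translation v"
proof (induction u rule: env_algebra_induct)
  case zero
  show ?case by (simp add: clinear_zero[OF clinear_translation])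
next
  case (add c xs u)
  note lin = clinear_add[OF clinear_translation] clinear_scale[OF clinear_translation]
    clinear_zero[OF clinear_translation]
  have "translation (prod_list (map env_of xs) * v) =
      translation (prod_list (map env_of xs)) * v + prod_list (map env_of xs) * translation v"
  proof (induction v rule: env_algebra_induct)
    case zero
    show ?case by (simp add: lin)
  next
    case (add d ys v)
    have "translation (prod_list (map env_of xs) * prod_list (map env_of ys)) =
        translation (prod_list (map env_of xs)) * prod_list (map env_of ys) +
        prod_list (map env_of xs) * translation (prod_list (map env_of ys))"
      using translation_prod_list[of "xs @ ys"] by (simp add: translation_prod_list leibniz_append)
    with add show ?case
      by (simp add: distrib_left lin scaleC_mult_right scaleC_add_right algebra_simps)
  qed
  with add show ?case
    by (simp add: distrib_right lin scaleC_mult_left scaleC_add_right algebra_simps)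
qed

lemma lookup_loop_tau: "Poly_Mapping.lookup (loop_tau p) n = - of_int (n + 1) *\<^sub>C Poly_Mapping.lookup p (n + 1)"
proof (cases "n + 1 \<in> Poly_Mapping.keys p")
  case True
  have "Poly_Mapping.lookup (loop_tau p) n =
      (\<Sum>k\<in>Poly_Mapping.keys p. if k = n + 1 then - of_int k *\<^sub>C Poly_Mapping.lookup p k else 0)"
    unfolding loop_tau_def lookup_sum
    by (intro sum.cong) (auto simp: lookup_single when_def simp del: of_int_add complex_vector.scale_minus_left)
  then show ?thesis using True by (simp only: sum.delta[OF finite_keys] if_True)
next
  case False
  then have "n \<notin> Poly_Mapping.keys (loop_tau p)" using keys_loop_tau by blast
  with False show ?thesis by (simp add: in_keys_iff)
qed

text \<open>Translation lowers the mode by one, so that only x[0] could leave the current algebra,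
  and its factor n = 0 sends it to zero. The central generator of the ideal is also sent to
  zero.\<close>

lemma translation_vacuum_ideal: "u \<in> vacuum_ideal \<Longrightarrow> translation u \<in> vacuum_ideal"
  unfolding vacuum_ideal_def
proof (induction rule: left_ideal.induct)
  case zero
  show ?case by (simp add: clinear_zero[OF clinear_translation] left_ideal.zero)
next
  case (add r s a)
  let ?I = "left_ideal (env_of ` current_subalgebra \<union> {env_of (Affine 0 1) - 1})"
  have "translation r \<in> ?I"
    using add.hyps(1)
  proof
    assume "r \<in> env_of ` current_subalgebra"
    then obtain p where p: "r = env_of (Affine p 0)" "\<forall>n\<in>Poly_Mapping.keys p. 0 \<le> n"
      unfolding current_subalgebra_def by auto
    have "0 \<le> n" if n: "n \<in> Poly_Mapping.keys (loop_tau p)" for n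
    proof -
      have "0 \<le> n + 1" using keys_loop_tau[OF n] p(2) by blast
      moreover have "n \<noteq> - 1" using n lookup_loop_tau[of p "- 1"] by (auto simp: in_keys_iff)
      ultimately show ?thesis by simp
    qed
    then have "Affine (loop_tau p) 0 \<in> current_subalgebra" by (auto simp: current_subalgebra_def)
    then show ?thesis
      by (intro left_ideal_gen) (simp add: p(1) translation_env_of affine_tau_def)
  next
    assume "r \<in> {env_of (Affine 0 1) - 1}"
    moreover have "affine_tau (Affine 0 1) = (0 :: 'a affine_algebra)"
      by (simp add: affine_tau_def loop_tau_def zero_affine_algebra_def)
    ultimately have "translation r = 0"
      by (simp add: clinear_diff[OF clinear_translation] translation_env_of translation_1 clinear_zero[OF
          clinear_env_of])
    then show ?thesis by (simp add: left_ideal.zero)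
  qed
  moreover have "translation a * r + (a * translation r + translation s) \<in> ?I"
    by (intro left_ideal_plus left_ideal_lmult calculation add.IH left_ideal_gen add.hyps)
  ultimately show ?case
    by (simp add: clinear_add[OF clinear_translation] translation_mult add.assoc)
qed

definition vacuum_X :: "int \<Rightarrow> 'g::complex_lie_algebra \<Rightarrow> 'g vacuum_module endo"
  where "vacuum_X n x = induced_endo (\<lambda>u. env_of (affine_elem n x) * u)"

definition vacuum_T :: "'g::complex_lie_algebra vacuum_module endo"
  where "vacuum_T = induced_endo translation"

lemma vacuum_X_class: "apply_endo (vacuum_X n x) (vacuum_class u) = vacuum_class (env_of (affine_elem n x) * u)"
  unfolding vacuum_X_def
proof (rule induced_endo)
  show "clinear (\<lambda>u. env_of (affine_elem n x) * u)"
    by (rule clinearI) (simp_all add: distrib_left scaleC_mult_right)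
qed (simp add: vacuum_ideal_def left_ideal_lmult)

lemma vacuum_T_class: "apply_endo vacuum_T (vacuum_class u) = vacuum_class (translation u)"
  unfolding vacuum_T_def by (rule induced_endo[OF clinear_translation translation_vacuum_ideal])

lemma endo_eqI:
  fixes f g :: "'g::complex_lie_algebra vacuum_module endo"
  assumes "\<And>u. apply_endo f (vacuum_class u) = apply_endo g (vacuum_class u)"
  shows "f = g"
proof -
  have "apply_endo f v = apply_endo g v" for v
    using assms by (cases v rule: vacuum_class_cases) simp
  then show ?thesis by (simp add: apply_endo_inject[symmetric] fun_eq_iff)
qed

text \<open>The ideal is a left ideal, so its generator must stand on the right; centrality moves it
  there.\<close>

lemma central_class: "vacuum_class (env_of (Affine 0 1) * u) = vacuum_class u"
proof -
  have c: "bracket (Affine 0 1) y = (0 :: 'a affine_algebra)" for y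
    by (simp add: bracket_affine_algebra_def zero_affine_algebra_def)
  have "env_of (Affine 0 1) * u = u * env_of (Affine 0 1)"
  proof (induction u rule: env_algebra_induct)
    case (add d xs u)
    have "env_of (Affine 0 1) * prod_list (map env_of xs) = prod_list (map env_of xs) * env_of (Affine 0 1)"
    proof (induction xs)
      case (Cons x xs)
      have "env_of (Affine 0 1) * env_of x = env_of x * env_of (Affine 0 1)"
        using env_of_commutator[of "Affine 0 1" x] by (simp add: c clinear_zero[OF clinear_env_of])
      then show ?case using Cons by (simp add: mult.assoc[symmetric]) (simp add: mult.assoc)
    qed simp
    with add show ?case by (simp add: distrib_left distrib_right scaleC_mult_left scaleC_mult_right)
  qed simp
  then have "env_of (Affine 0 1) * u - u = u * (env_of (Affine 0 1) - 1)" by (simp add: algebra_simps)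
  also have "\<dots> \<in> vacuum_ideal"
    unfolding vacuum_ideal_def by (intro left_ideal_lmult left_ideal_gen) simp
  finally show ?thesis
    using vacuum_class_eq_0_iff[of "env_of (Affine 0 1) * u - u"]
        by (simp add: clinear_diff[OF clinear_vacuum_class])
qed

lemma critical_vacuum_vacuum_module:
  assumes "finite (basis :: 'g::complex_lie_algebra set)"
  shows "critical_vacuum (vacuum_X :: int \<Rightarrow> 'g \<Rightarrow> _) vacuum_T (vacuum_class 1)"
proof (rule critical_vacuum.intro)
  note cls = clinear_add[OF clinear_vacuum_class] clinear_diff[OF clinear_vacuum_class] clinear_scale[OF
      clinear_vacuum_class]
  have lin: "clinear (affine_elem n :: 'g \<Rightarrow> _)" for n
    by (rule clinearI) (simp_all add: affine_elem_def plus_affine_algebra_def scaleC_affine_algebra_def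
        single_add scaleC_single)
  show "finite (basis :: 'g set)" by fact
  show "clinear (vacuum_X n :: 'g \<Rightarrow> _)" for n
    by (rule clinearI; rule endo_eqI)
      (simp_all add: plus_endo.rep_eq scaleC_endo.rep_eq vacuum_X_class clinear_add[OF lin] clinear_scale[OF
          lin]
        env_of_add env_of_scaleC distrib_right scaleC_mult_left cls)
  show "vacuum_X m x * vacuum_X n y - vacuum_X n y * vacuum_X m x = vacuum_X (m + n) (bracket x y) +
      (if m + n = 0 then - (of_int m / 2) * killing_form x y else 0) *\<^sub>C 1" for m n and x y :: 'g
  proof (rule endo_eqI)
    fix u :: "'g affine_algebra env_algebra"
    let ?c = "if m + n = 0 then - (of_int m / 2) * killing_form x y else 0"
    have "bracket (affine_elem m x) (affine_elem n y) = affine_elem (m + n) (bracket x y) + ?c *\<^sub>C Affine 0 1"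
      by (simp add: affine_elem_def bracket_affine_algebra_def plus_affine_algebra_def scaleC_affine_algebra_def
          bracket_pm_single killing_cocycle_single)
    then have "env_of (affine_elem m x) * env_of (affine_elem n y) - env_of (affine_elem n y) * env_of
        (affine_elem m x) =
        env_of (affine_elem (m + n) (bracket x y)) + ?c *\<^sub>C env_of (Affine 0 1)"
      by (simp only: env_of_commutator env_of_add env_of_scaleC)
    then have "env_of (affine_elem m x) * (env_of (affine_elem n y) * u) - env_of (affine_elem n y) *
        (env_of (affine_elem m x) * u) =
        env_of (affine_elem (m + n) (bracket x y)) * u + ?c *\<^sub>C (env_of (Affine 0 1) * u)"
      by (simp only: mult.assoc[symmetric] left_diff_distrib[symmetric] distrib_right scaleC_mult_left)
    from arg_cong[OF this, of vacuum_class]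
    show "apply_endo (vacuum_X m x * vacuum_X n y - vacuum_X n y * vacuum_X m x) (vacuum_class u) =
        apply_endo (vacuum_X (m + n) (bracket x y) + ?c *\<^sub>C 1) (vacuum_class u)"
      by (simp only: cls central_class minus_endo.rep_eq plus_endo.rep_eq scaleC_endo.rep_eq times_endo.rep_eq
          one_endo.rep_eq vacuum_X_class)
  qed
  show "vacuum_T * vacuum_X n x - vacuum_X n x * vacuum_T = - of_int n *\<^sub>C vacuum_X (n - 1) x" for n and x :: 'g
  proof (rule endo_eqI)
    fix u :: "'g affine_algebra env_algebra"
    have "affine_tau (affine_elem n x) = (- of_int n) *\<^sub>C affine_elem (n - 1) x"
      by (simp only: affine_tau_def affine_elem_def affine_algebra.sel loop_tau_single scaleC_affine_algebra_def
          scaleC_single mult_zero_right)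
    then have "translation (env_of (affine_elem n x) * u) - env_of (affine_elem n x) * translation u =
        (- of_int n) *\<^sub>C (env_of (affine_elem (n - 1) x) * u)"
      by (simp only: translation_mult translation_env_of env_of_scaleC scaleC_mult_left add_diff_cancel_right')
    from arg_cong[OF this, of vacuum_class]
    show "apply_endo (vacuum_T * vacuum_X n x - vacuum_X n x * vacuum_T) (vacuum_class u) =
        apply_endo (- of_int n *\<^sub>C vacuum_X (n - 1) x) (vacuum_class u)"
      by (simp only: cls minus_endo.rep_eq scaleC_endo.rep_eq times_endo.rep_eq vacuum_X_class vacuum_T_class)
  qed
  show "apply_endo (vacuum_X n x) (vacuum_class 1) = 0" if "0 \<le> n" for n and x :: 'g
  proof -
    have "affine_elem n x \<in> current_subalgebra"
      using that by (auto simp: affine_elem_def current_subalgebra_def split: if_splits)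
    then show ?thesis
      by (auto simp: vacuum_X_class vacuum_class_eq_0_iff vacuum_ideal_def intro: left_ideal_gen)
  qed
  show "apply_endo vacuum_T (vacuum_class 1) = (0 :: 'g vacuum_module)"
    by (simp add: vacuum_T_class translation_1 clinear_zero[OF clinear_vacuum_class])
qed

section \<open>Symmetrisation with derivations as powers of \<open>\<tau> + y[-1]\<close>\<close>

lemma clinear_permutation_average_distrib:
  "clinear L \<Longrightarrow> L (permutation_average f xs) = permutation_average (\<lambda>ys. L (f ys)) xs"
  by (simp add: permutation_average_def clinear_scale clinear_sum_distrib)

lemma permutation_average_map: "permutation_average f (map g xs) = permutation_average (\<lambda>ys. f (map g ys)) xs"
  by (simp add: permutation_average_def permute_list_map)

text \<open>The tail \<open>zs\<close> takes up the letter that is split off in the induction step;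
  symmetry of \<open>G\<close> then allows the letters to be sorted again.\<close>

lemma symmetric_multilinear_binomial:
  assumes G: "symmetric_multilinear G"
  shows "G (replicate N (a + b) @ zs) = (\<Sum>j\<le>N. of_nat (N choose j) *\<^sub>C G (replicate (N - j) a @ replicate j
      b @ zs))"
proof (induction N arbitrary: zs)
  case 0
  show ?case by (simp add: scaleC_one)
next
  case (Suc N)
  have sym: "G xs = G ys" if "mset xs = mset ys" for xs ys
    using G that unfolding symmetric_multilinear_def by blast
  have lin: "clinear (\<lambda>x. G (x # us))" for us
    using G[THEN symmetric_multilinearD, unfolded multilinear_def, rule_format, of "[]" us] by simp
  let ?g = "\<lambda>i j. G (replicate i a @ replicate j b @ zs)"
  have "G (replicate (Suc N) (a + b) @ zs) = G (replicate N (a + b) @ (a + b) # zs)"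
    by (rule sym) simp
  also have "\<dots> = (\<Sum>j\<le>N. of_nat (N choose j) *\<^sub>C (?g (Suc N - j) j + ?g (N - j) (Suc j)))"
    unfolding Suc.IH
  proof (intro sum.cong refl arg_cong[of _ _ "\<lambda>v. _ *\<^sub>C v"])
    fix j assume "j \<in> {..N}"
    then have j: "Suc N - j = Suc (N - j)" by (simp add: Suc_diff_le)
    have "G (replicate (N - j) a @ replicate j b @ (a + b) # zs) = G ((a +
        b) # replicate (N - j) a @ replicate j b @ zs)"
      by (rule sym) simp
    also have "\<dots> = G (a # replicate (N - j) a @ replicate j b @ zs) +
        G (b # replicate (N - j) a @ replicate j b @ zs)"
      by (rule clinear_add[OF lin])
    also have "G (b # replicate (N - j) a @ replicate j b @ zs) = ?g (N - j) (Suc j)"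
      by (rule sym) simp
    finally show "G (replicate (N - j) a @ replicate j b @ (a + b) # zs) = ?g (Suc N - j) j +
        ?g (N - j) (Suc j)"
      by (simp add: j)
  qed
  also have "\<dots> = (\<Sum>j\<le>Suc N. of_nat (Suc N choose j) *\<^sub>C ?g (Suc N - j) j)"
  proof -
    have "(\<Sum>j\<le>Suc N. of_nat (Suc N choose j) *\<^sub>C ?g (Suc N - j) j) =
        ?g (Suc N) 0 + (\<Sum>j\<le>N. of_nat (N choose Suc j) *\<^sub>C ?g (N - j) (Suc j)) +
            (\<Sum>j\<le>N. of_nat (N choose j) *\<^sub>C ?g (N - j) (Suc j))"
      unfolding sum.atMost_Suc_shift by (simp add: scaleC_add_left sum.distrib scaleC_one)
    also have "?g (Suc N) 0 + (\<Sum>j\<le>N. of_nat (N choose Suc j) *\<^sub>C ?g (N - j) (Suc j)) =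
        (\<Sum>j\<le>Suc N. of_nat (N choose j) *\<^sub>C ?g (Suc N - j) j)"
      unfolding sum.atMost_Suc_shift by (simp add: scaleC_one)
    also have "\<dots> = (\<Sum>j\<le>N. of_nat (N choose j) *\<^sub>C ?g (Suc N - j) j)" by simp
    finally show ?thesis by (simp add: scaleC_add_right sum.distrib)
  qed
  finally show ?case .
qed

lemma env_inclusion_prod_list:
  "env_inclusion (prod_list (map env_of ps)) = prod_list (map (\<lambda>p. env_of (Affine (loop_of p) 0)) ps)"
  unfolding env_inclusion_def env_map_def by (rule env_ext_prod_list[OF lie_multilinear_env_inclusion])

lemma clinear_env_inclusion: "clinear env_inclusion"
  unfolding env_inclusion_def env_map_def by (rule clinear_env_ext[OF lie_multilinear_env_inclusion])

lemma env_inclusion_mult: "env_inclusion (env_of p * u) = env_of (Affine (loop_of p) 0) * env_inclusion u"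
proof (induction u rule: env_algebra_induct)
  case (add c xs u)
  have "env_inclusion (env_of p * prod_list (map env_of xs)) =
      env_of (Affine (loop_of p) 0) * env_inclusion (prod_list (map env_of xs))"
    using env_inclusion_prod_list[of "p # xs"] by (simp add: env_inclusion_prod_list)
  with add show ?case
    by (simp add: distrib_left scaleC_mult_right clinear_add[OF clinear_env_inclusion] clinear_scale[OF
        clinear_env_inclusion])
qed (simp add: clinear_zero[OF clinear_env_inclusion])

lemma env_inclusion_env_tau: "env_inclusion (env_tau u) = translation (env_inclusion u)"
proof (induction u rule: env_algebra_induct)
  case zero
  show ?case by (simp add: clinear_zero[OF clinear_env_inclusion] clinear_zero[OF clinear_env_tau]
      clinear_zero[OF clinear_translation])
next
  case (add c xs u)
  note lin = clinear_add[OF clinear_env_inclusion] clinear_add[OF clinear_env_tau] clinear_add[OF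
      clinear_translation]
    clinear_scale[OF clinear_env_inclusion] clinear_scale[OF clinear_env_tau] clinear_scale[OF
        clinear_translation]
  have "env_inclusion (leibniz env_of tau ps) = translation (env_inclusion (prod_list (map env_of ps)))"
      for ps :: "'a negative_loop list"
  proof (induction ps)
    case Nil
    show ?case using env_inclusion_prod_list[of "[] :: 'a negative_loop list"]
      by (simp add: clinear_zero[OF clinear_env_inclusion] translation_1)
  next
    case (Cons p ps)
    then show ?case
      by (simp add: lin env_inclusion_mult translation_mult translation_env_of affine_tau_def tau.rep_eq)
  qed
  with add show ?case by (simp add: lin env_tau_prod_list)
qed

definition vacuum_of :: "'g::complex_lie_algebra negative_loop env_algebra \<Rightarrow> 'g vacuum_module"
  where "vacuum_of u = vacuum_class (env_inclusion u)"

lemma clinear_vacuum_of: "clinear vacuum_of"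
  unfolding vacuum_of_def by (rule clinear_compose[OF clinear_vacuum_class clinear_env_inclusion])

fun letter_endo :: "'g::complex_lie_algebra tau_letter \<Rightarrow> 'g vacuum_module endo" where
  "letter_endo Tau = vacuum_T"
| "letter_endo (Elem y) = vacuum_X (- 1) y"

lemma vacuum_of_tau_word:
  "vacuum_of (tau_word (map (map_tau_letter at_minus_one) w)) =
      apply_endo (prod_list (map letter_endo w)) (vacuum_class 1)"
proof (induction w)
  case Nil
  show ?case using env_inclusion_prod_list[of "[] :: 'a negative_loop list"]
    by (simp add: vacuum_of_def one_endo.rep_eq)
next
  case (Cons a w)
  show ?case
  proof (cases a)
    case Tau
    then show ?thesis using Cons
      by (simp add: vacuum_of_def env_inclusion_env_tau times_endo.rep_eq flip: vacuum_T_class)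
  next
    case (Elem y)
    have "vacuum_of (env_of (at_minus_one y) * u) = apply_endo (vacuum_X (- 1) y) (vacuum_of u)" for u
      by (simp add: vacuum_of_def env_inclusion_mult vacuum_X_class affine_elem_def at_minus_one.rep_eq)
    then show ?thesis using Cons Elem by (simp add: times_endo.rep_eq)
  qed
qed

lemma clinear_sym_map: "clinear h \<Longrightarrow> clinear (sym_map h)"
  unfolding sym_map_def by (rule clinear_sym_ext[OF symmetric_multilinear_sym_map])

lemma sym_map_power: "clinear h \<Longrightarrow> sym_map h (sym_of y ^ n) = prod_list (map sym_of (replicate n (h y)))"
  using sym_map_prod_list[of h "replicate n y"] by (simp add: prod_list_replicate)

text \<open>The average over orderings is symmetric and multilinear and does nothing to a constant
  word. Hence the power of a sum expands binomially although the summands do not commute.\<close>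

lemma vacuum_T_X_power:
  "apply_endo ((vacuum_T + vacuum_X (- 1) y) ^ N) (vacuum_class 1) =
    (\<Sum>j\<le>N. of_nat (N choose j) *\<^sub>C vacuum_of (sym_tau (N - j) (sym_map at_minus_one (sym_of y ^ j))))"
proof -
  let ?g = "\<lambda>us :: 'a vacuum_module endo list. apply_endo (prod_list us) (vacuum_class 1)"
  have "multilinear ?g"
    unfolding multilinear_def
    by (intro allI clinearI) (simp_all add: distrib_left distrib_right endo_scaleC_mult plus_endo.rep_eq
        scaleC_endo.rep_eq)
  note G = symmetric_multilinear_permutation_average[OF this]
  have w: "permutation_average ?g (replicate i vacuum_T @ replicate j (vacuum_X (- 1) y)) =
      vacuum_of (sym_tau i (sym_map at_minus_one (sym_of y ^ j)))" for i j
  proof -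
    let ?w = "replicate i Tau @ replicate j (Elem y)"
    have "vacuum_of (sym_tau i (sym_map at_minus_one (sym_of y ^ j))) =
        vacuum_of (permutation_average tau_word (map (map_tau_letter at_minus_one) ?w))"
      by (simp add: sym_map_power[OF clinear_at_minus_one] sym_tau_prod_list map_replicate_const
          del: map_replicate) simp
    also have "\<dots> = permutation_average (\<lambda>w. ?g (map letter_endo w)) ?w"
      by (simp only: clinear_permutation_average_distrib[OF clinear_vacuum_of] permutation_average_map
          vacuum_of_tau_word)
    also have "\<dots> = permutation_average ?g (map letter_endo ?w)"
      by (simp only: permutation_average_map)
    finally show ?thesis by simp
  qed
  have "apply_endo ((vacuum_T + vacuum_X (- 1) y) ^ N) (vacuum_class 1) =
      permutation_average ?g (replicate N (vacuum_T + vacuum_X (- 1) y))"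
    using prod_list_replicate[of "\<lambda>u. u" N "vacuum_T + vacuum_X (- 1) y"]
        by (simp add: permutation_average_replicate)
  also have "\<dots> = (\<Sum>j\<le>N. of_nat (N choose j) *\<^sub>C
      permutation_average ?g (replicate (N - j) vacuum_T @ replicate j (vacuum_X (- 1) y)))"
    using symmetric_multilinear_binomial[OF G, of N vacuum_T "vacuum_X (- 1) y" "[]"] by simp
  finally show ?thesis by (simp only: w)
qed

text \<open>For \<open>l = k - 2 * r\<close> this is the origin of the coefficient
  \<open>k choose (2 * r)\<close> in the vector \<open>S\<close>.\<close>

lemma lin_ext_vacuum_power:
  assumes "represents q l F P" "l \<le> k" "k < q"
  shows "lin_ext (\<lambda>y. apply_endo ((vacuum_T + vacuum_X (- 1) y) ^ k) (vacuum_class 1)) P =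
    of_nat (k choose l) *\<^sub>C vacuum_of (sym_tau (k - l) (sym_map at_minus_one F))"
proof -
  let ?\<Phi> = "\<lambda>j F. vacuum_of (sym_tau (k - j) (sym_map at_minus_one F))"
  have \<Phi>: "clinear (?\<Phi> j)" for j
    by (intro clinear_compose[OF clinear_vacuum_of] clinear_compose[OF clinear_sym_tau] clinear_sym_map
        clinear_at_minus_one)
  have "lin_ext (\<lambda>y. apply_endo ((vacuum_T + vacuum_X (- 1) y) ^ k) (vacuum_class 1)) P =
      (\<Sum>j\<le>k. of_nat (k choose j) *\<^sub>C lin_ext (\<lambda>y. ?\<Phi> j (sym_of y ^ j)) P)"
    by (simp only: vacuum_T_X_power lin_ext_sum_fun lin_ext_scaleC_fun)
  also have "\<dots> = (\<Sum>j\<le>k. if j = l then of_nat (k choose j) *\<^sub>C ?\<Phi> j F else 0)"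
    using assms(3) by (intro sum.cong refl) (simp add: represents_linear[OF assms(1) _ \<Phi>])
  also have "\<dots> = of_nat (k choose l) *\<^sub>C ?\<Phi> l F"
    using assms(2) by simp
  finally show ?thesis .
qed

lemma sym_tau_0: "sym_tau 0 F = sym_to_env F"
proof -
  have e: "tau_word (map Elem ys) = prod_list (map env_of ys)" for ys :: "'a negative_loop list"
    by (induction ys) simp_all
  show ?thesis
    unfolding sym_tau_def sym_to_env_def by (simp add: permutation_average_map e)
qed

section \<open>Leading terms\<close>

text \<open>Length exactly \<open>j\<close>: derivations act letter by letter and preserve this
  span, so that in a word containing \<tau> only the other letters count.\<close>

definition env_words :: "nat \<Rightarrow> 'l::complex_lie_algebra env_algebra set"
  where "env_words j = complex_vector.span {prod_list (map env_of xs) | xs. length xs = j}"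

lemma linear_image_span:
  assumes f: "clinear f" and W: "complex_vector.subspace W" and "\<And>x. x \<in> A \<Longrightarrow> f x \<in> W"
    and "x \<in> complex_vector.span A"
  shows "f x \<in> W"
proof -
  have "complex_vector.subspace {x. f x \<in> W}"
    using W by (intro complex_vector.subspaceI)
      (auto simp: clinear_zero[OF f] clinear_add[OF f] clinear_scale[OF f] complex_vector.subspace_0
        complex_vector.subspace_add complex_vector.subspace_scale)
  then have "complex_vector.span A \<subseteq> {x. f x \<in> W}"
    using assms(3) by (intro complex_vector.span_minimal) auto
  with assms(4) show ?thesis by blast
qed

lemma subspace_env_words: "complex_vector.subspace (env_words j)"
  unfolding env_words_def by (rule complex_vector.subspace_span)

lemma env_words_mult:
  assumes "u \<in> env_words j"
  shows "env_of y * u \<in> env_words (Suc j)"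
proof (rule linear_image_span[of "\<lambda>u. env_of y * u"])
  show "clinear (\<lambda>u. env_of y * u)" by (rule clinearI) (simp_all add: distrib_left scaleC_mult_right)
  show "u \<in> complex_vector.span {prod_list (map env_of xs) | xs. length xs = j}"
    using assms by (simp only: env_words_def)
  show "env_of y * v \<in> env_words (Suc j)" if v: "v \<in> {prod_list (map env_of xs) | xs. length xs = j}" for v
  proof -
    obtain xs where "v = prod_list (map env_of xs)" "length xs = j" using v by blast
    then have "env_of y * v = prod_list (map env_of (y # xs))" "length (y # xs) = Suc j" by simp_all
    then show ?thesis unfolding env_words_def by (intro complex_vector.span_base) blast
  qed
qed (rule subspace_env_words)

lemma env_words_leibniz: "leibniz env_of d ys \<in> env_words (length ys)"
proof (induction ys)
  case Nil
  show ?case using complex_vector.subspace_0[OF subspace_env_words] by simp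
next
  case (Cons y ys)
  have "prod_list (map env_of ys) \<in> env_words (length ys)"
    unfolding env_words_def by (rule complex_vector.span_base) blast
  with Cons show ?case
    by (auto intro!: complex_vector.subspace_add[OF subspace_env_words] env_words_mult)
qed

lemma env_words_env_tau:
  assumes "u \<in> env_words j"
  shows "env_tau u \<in> env_words j"
proof (rule linear_image_span[OF clinear_env_tau subspace_env_words])
  show "u \<in> complex_vector.span {prod_list (map env_of xs) | xs. length xs = j}"
    using assms by (simp only: env_words_def)
  show "env_tau v \<in> env_words j" if "v \<in> {prod_list (map env_of xs) | xs. length xs = j}" for v
    using that env_words_leibniz by (auto simp: env_tau_prod_list)
qed

lemma tau_word_env_words: "tau_word w \<in> env_words (size (filter_mset (\<lambda>a. a \<noteq> Tau) (mset w)))"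
proof (induction w rule: tau_word.induct)
  case 1
  have "(1 :: 'a negative_loop env_algebra) \<in> {prod_list (map env_of xs) |xs. length xs = 0}" by simp
  then show ?case unfolding env_words_def by (auto intro: complex_vector.span_base)
qed (simp_all add: env_words_env_tau env_words_mult)

lemma sym_tau_env_words:
  assumes "F \<in> sym_power j"
  shows "sym_tau r (sym_map at_minus_one F) \<in> env_words j"
  using assms unfolding sym_power_powers
proof (rule linear_image_span[OF _ subspace_env_words, rotated -1])
  show "clinear (\<lambda>F. sym_tau r (sym_map at_minus_one F))"
    by (intro clinear_compose[OF clinear_sym_tau] clinear_sym_map clinear_at_minus_one)
  fix F assume "F \<in> range (\<lambda>y :: 'a. sym_of y ^ j)"
  then obtain y :: 'a where F: "F = sym_of y ^ j" by blast
  let ?w = "replicate r Tau @ map Elem (replicate j (at_minus_one y))"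
  have "tau_word (permute_list \<sigma> ?w) \<in> env_words j" if "\<sigma> permutes {..<length ?w}" for \<sigma>
  proof -
    have "size (filter_mset (\<lambda>a. a \<noteq> Tau) (mset (permute_list \<sigma> ?w))) = length (filter (\<lambda>a. a \<noteq> Tau) ?w)"
      unfolding mset_permute_list[OF that] by (simp only: mset_filter[symmetric] size_mset)
    then show ?thesis using tau_word_env_words[of "permute_list \<sigma> ?w"] by simp
  qed
  then show "sym_tau r (sym_map at_minus_one F) \<in> env_words j"
    unfolding F sym_map_power[OF clinear_at_minus_one] sym_tau_prod_list permutation_average_def
    by (intro complex_vector.subspace_scale[OF subspace_env_words] complex_vector.subspace_sum[OF
        subspace_env_words]) simp
qed

lemma env_words_filtration: "j < k \<Longrightarrow> env_words j \<subseteq> env_filtration_less k"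
  unfolding env_words_def env_filtration_less_def by (intro complex_vector.span_mono) auto

lemma sym_map_sym_power:
  assumes "clinear h" "F \<in> sym_power j"
  shows "sym_map h F \<in> sym_power j"
  using assms(2) unfolding sym_power_powers[of j, where 'a = 'a]
proof (rule linear_image_span[OF clinear_sym_map[OF assms(1)], rotated -1])
  fix F assume "F \<in> range (\<lambda>y :: 'a. sym_of y ^ j)"
  then show "sym_map h F \<in> sym_power j"
    unfolding sym_power_def
    by (auto simp: sym_map_power[OF assms(1)] intro!: complex_vector.span_base exI[of _ "replicate j _"])
qed (simp add: sym_power_def complex_vector.subspace_span)

section \<open>Semisimple Lie algebras\<close>

lemma semisimple_finite_basis:
  assumes "semisimple_lie_algebra TYPE('g::complex_lie_algebra)"
  shows "finite (basis :: 'g set)"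
proof -
  obtain B :: "'g set" where B: "finite B" "complex_vector.span B = UNIV"
    using assms unfolding semisimple_lie_algebra_def by blast
  have "\<not> complex_vector.dependent (basis :: 'g set)" unfolding basis_def by (rule basis_indep)
  from complex_vector.independent_span_bound[OF B(1) this] B(2) show ?thesis by simp
qed

text \<open>The kernel of \<open>ad\<close> is the centre, an abelian and hence solvable
  ideal.\<close>

lemma semisimple_inj_ad:
  assumes "semisimple_lie_algebra TYPE('g::complex_lie_algebra)"
  shows "inj (ad :: 'g \<Rightarrow> 'g endo)"
proof -
  let ?Z = "{x :: 'g. \<forall>y. bracket x y = 0}"
  have "lie_ideal ?Z"
    unfolding lie_ideal_def
  proof (intro conjI allI ballI)
    show "complex_vector.subspace ?Z"
      by (rule complex_vector.subspaceI) (simp_all add: bracket_add_left bracket_scaleC_left)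
    fix x y assume "y \<in> ?Z"
    then have "bracket x y = 0" using bracket_anti[of x y] by simp
    then show "bracket x y \<in> ?Z" by simp
  qed
  moreover have "solvable ?Z"
  proof -
    have "{bracket x y |x y. x \<in> ?Z \<and> y \<in> ?Z} = {0}" by (auto intro!: exI[of _ 0])
    then have "derived_algebra ?Z = {0}"
      unfolding derived_algebra_def by simp
    then have "(derived_algebra ^^ 1) ?Z = {0}" by simp
    then show ?thesis unfolding solvable_def by blast
  qed
  ultimately have Z: "?Z = {0}" using assms unfolding semisimple_lie_algebra_def by blast
  show ?thesis
  proof (rule injI)
    fix x y :: 'g assume "ad x = ad y"
    then have "ad (x - y) = 0" by (simp add: clinear_diff[OF clinear_ad])
    then have "bracket (x - y) z = 0" for z by (metis ad.rep_eq zero_endo.rep_eq)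
    then have "x - y \<in> ?Z" by simp
    then show "x = y" using Z by simp
  qed
qed

text \<open>The case \<open>2 r + 1 = k\<close>, which is absent from the sum defining \<open>S\<close>.\<close>
lemma invariant_degree_1:
  fixes F :: "'g::complex_lie_algebra sym_algebra"
  assumes fin: "finite (basis :: 'g set)" and inj: "inj (ad :: 'g \<Rightarrow> 'g endo)"
    and P: "represents q 1 F P" "invariant_points q' P" and q: "1 < q" "1 < q'"
  shows "F = 0"
proof -
  define v where "v = lin_ext (\<lambda>y. y) P"
  have F: "F = sym_of v"
    using P(1) q(1) unfolding represents_def v_def
    by (simp add: clinear_lin_ext_distrib[OF clinear_sym_of] split: if_splits)
  \<comment> \<open>Invariance tested on coordinate functionals makes \<open>v\<close>
    central.\<close>
  have "bracket b v = 0" for b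
  proof -
    have "coord c (bracket b v) = 0" for c
    proof -
      have "lin_ext (\<lambda>y. eval_all_deriv [coord c] y (bracket b y)) P = 0"
        using P(2) q(2) clinear_coord unfolding invariant_points_def
            by (metis One_nat_def empty_iff insert_iff length_Cons list.set(1,2) list.size(3))
      then show ?thesis
        by (simp add: v_def clinear_lin_ext_distrib[OF clinear_bracket] clinear_lin_ext_distrib[OF
            clinear_coord])
    qed
    then show ?thesis using sum_coord[OF fin, of "bracket b v"] by simp
  qed
  then have "bracket v b = 0" for b using bracket_anti[of v b] by simp
  then have "ad v = ad 0"
    by (simp add: apply_endo_inject[symmetric] ad.rep_eq fun_eq_iff)
  then have "v = 0" using inj by (simp add: inj_eq)
  then show ?thesis using F by (simp add: clinear_zero[OF clinear_sym_of])
qed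

lemma feigin_frenkel_centreI:
  assumes "\<And>m x. apply_endo (vacuum_X (int m) x) (vacuum_of S) = 0"
  shows "S \<in> feigin_frenkel_centre"
  unfolding feigin_frenkel_centre_def
proof (intro CollectI ballI)
  fix z :: "'a affine_algebra" assume "z \<in> current_subalgebra"
  then obtain p where p: "z = Affine p 0" "\<forall>n\<in>Poly_Mapping.keys p. 0 \<le> n"
    unfolding current_subalgebra_def by auto
  define f where "f p = vacuum_class (env_of (Affine p 0) * env_inclusion S)" for p
  have f: "clinear f"
  proof (rule clinearI)
    fix p q :: "int \<Rightarrow>\<^sub>0 'a" and c
    have "Affine (p + q) 0 = Affine p 0 + Affine q 0" "Affine (c *\<^sub>C p) 0 = c *\<^sub>C Affine p 0"
      by (simp_all add: plus_affine_algebra_def scaleC_affine_algebra_def)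
    then show "f (p + q) = f p + f q" "f (c *\<^sub>C p) = c *\<^sub>C f p"
      by (simp_all add: f_def env_of_add env_of_scaleC distrib_right scaleC_mult_left
          clinear_add[OF clinear_vacuum_class] clinear_scale[OF clinear_vacuum_class])
  qed
  have "f (Poly_Mapping.single n x) = 0" if n: "n \<in> Poly_Mapping.keys p" for n x
  proof -
    have "n = int (nat n)" using p(2) n by simp
    then show ?thesis
      using assms[of "nat n" x] by (simp add: f_def vacuum_of_def vacuum_X_class affine_elem_def)
  qed
  then have "f (\<Sum>n\<in>Poly_Mapping.keys p. Poly_Mapping.single n (Poly_Mapping.lookup p n)) = 0"
    by (simp add: clinear_sum_distrib[OF f])
  then show "env_of z * env_inclusion S \<in> vacuum_ideal"
    by (simp add: f_def p(1) vacuum_class_eq_0_iff flip: poly_mapping_sum_single)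
qed

theorem theorem3p11:
  fixes H :: "'g::complex_lie_algebra sym_algebra"
    and M :: "nat \<Rightarrow> 'g sym_algebra"
    and k :: nat
  assumes "semisimple_lie_algebra TYPE('g)"
    and "H \<in> sym_invariants k"
    and "\<And>r. 1 \<le> r \<Longrightarrow> 2 * r + 1 \<le> k \<Longrightarrow>
      M r \<in> sym_power (k - 2 * r) \<and> m_map (2 * r + 1) H = sym_into_gl (M r)"
  defines "S \<equiv> sym_to_env (sym_map at_minus_one H) +
      (\<Sum>r | 1 \<le> r \<and> real r < (real k - 1) / 2.
        of_nat (k choose (2 * r)) *\<^sub>C sym_tau (2 * r) (sym_map at_minus_one (M r)))"
  shows "S \<in> feigin_frenkel_centre \<and> has_leading_term k S (sym_map at_minus_one H)"
proof
  let ?R = "{r. 1 \<le> r \<and> real r < (real k - 1) / 2}"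
  have R: "?R = {r. 1 \<le> r \<and> 2 * r + 1 < k}" by auto
  have finR: "finite ?R" unfolding R by (rule finite_subset[of _ "{..k}"]) auto
  have Hk: "H \<in> sym_power k" using assms(2) by (simp add: sym_invariants_def)
  show "has_leading_term k S (sym_map at_minus_one H)"
    unfolding has_leading_term_def
  proof
    show "sym_map at_minus_one H \<in> sym_power k" by (rule sym_map_sym_power[OF clinear_at_minus_one Hk])
    have "sym_tau (2 * r) (sym_map at_minus_one (M r)) \<in> env_filtration_less k" if "r \<in> ?R" for r
    proof -
      have "M r \<in> sym_power (k - 2 * r)" "k - 2 * r < k" using assms(3)[of r] that unfolding R by auto
      then show ?thesis using sym_tau_env_words env_words_filtration by blast
    qed
    then show "S - sym_to_env (sym_map at_minus_one H) \<in> env_filtration_less k"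
      unfolding S_def add_diff_cancel_left' env_filtration_less_def
      by (intro complex_vector.span_sum complex_vector.span_scale)
  qed
  have fin: "finite (basis :: 'g set)" by (rule semisimple_finite_basis[OF assms(1)])
  have inj: "inj (ad :: 'g \<Rightarrow> 'g endo)" by (rule semisimple_inj_ad[OF assms(1)])
  interpret critical_vacuum "vacuum_X :: int \<Rightarrow> 'g \<Rightarrow> _" vacuum_T "vacuum_class 1"
    by (rule critical_vacuum_vacuum_module[OF fin])
  define M' where "M' r = (if r = 0 then H else M r)" for r
  show "S \<in> feigin_frenkel_centre"
  proof (rule feigin_frenkel_centreI)
    fix m :: nat and x :: 'g
    define q where "q = 5 * k + 5 * m + 10"
    \<comment> \<open>The guard admits \<open>r = 0\<close> also for \<open>k = 0\<close>, where
      \<open>2 * r + 1 \<le> k\<close> fails.\<close>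
    have "\<exists>P. represents q (k - 2 * r) (M' r) P" if "2 * r \<le> k \<and> (r = 0 \<or> 2 * r + 1 \<le> k)" for r
      using that assms(3)[of r] Hk by (intro represents_exists) (auto simp: M'_def q_def)
    then obtain P where P: "\<And>r. 2 * r \<le> k \<and> (r = 0 \<or> 2 * r + 1 \<le> k) \<Longrightarrow> represents q (k - 2 * r) (M' r) (P r)"
      by metis
    let ?D = "\<lambda>r. lin_ext (\<lambda>y. apply_endo (D y ^ k) (vacuum_class 1)) (P r)"
    have D: "?D r = of_nat (k choose (2 * r)) *\<^sub>C vacuum_of (sym_tau (2 * r) (sym_map at_minus_one (M' r)))"
      if r: "2 * r \<le> k \<and> (r = 0 \<or> 2 * r + 1 \<le> k)" for r
    proof -
      have "k choose (k - 2 * r) = k choose (2 * r)" using r binomial_symmetric[of "2 * r" k] by simp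
      then show ?thesis
        using lin_ext_vacuum_power[OF P[OF r], of k] r by (simp add: D_def q_def)
    qed
    have S: "vacuum_of S = ?D 0 + (\<Sum>r\<in>?R. ?D r)"
    proof -
      have "?D 0 = vacuum_of (sym_to_env (sym_map at_minus_one H))"
        using D[of 0] by (simp add: M'_def sym_tau_0 scaleC_one)
      moreover have "(\<Sum>r\<in>?R. ?D r) = (\<Sum>r\<in>?R. of_nat (k choose (2 * r)) *\<^sub>C vacuum_of (sym_tau (2 * r)
          (sym_map at_minus_one (M r))))"
        by (intro sum.cong refl) (use D in \<open>auto simp: R M'_def\<close>)
      ultimately show ?thesis
        by (simp add: S_def clinear_add[OF clinear_vacuum_of] clinear_sum_distrib[OF clinear_vacuum_of]
            clinear_scale[OF clinear_vacuum_of])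
    qed
    have XD: "apply_endo (vacuum_X (int m) x) (?D r) =
        lin_ext (\<lambda>y. apply_endo (vacuum_X (int m) x * D y ^ k) (vacuum_class 1)) (P r)" for r
      by (simp add: clinear_lin_ext_distrib[OF clinear_apply_endo] times_endo.rep_eq)
    show "apply_endo (vacuum_X (int m) x) (vacuum_of S) = 0"
    \<comment> \<open>For \<open>k = 0\<close> the range \<open>2 * r + 1 \<le> k\<close> does not
      contain the index of \<open>H\<close> itself; there \<open>S\<close> is a multiple of the
      unit.\<close>
    proof (cases "k = 0")
      case True
      then have "?R = {}" unfolding R by auto
      moreover have "apply_endo (vacuum_X (int m) x * D y ^ k) (vacuum_class 1) = 0" for y
        using X_vac[of "int m" x] True by (simp add: times_endo.rep_eq one_endo.rep_eq)
      ultimately show ?thesis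
        unfolding S using XD[of 0] by (simp only: sum.empty add_0_right lin_ext_zero_fun)
    next
      case False
      have M'm: "m_map (2 * r + 1) H = sym_into_gl (M' r)" if "1 \<le> r" "2 * r + 1 \<le> k" for r
        using assms(3)[OF that] that by (simp add: M'_def)
      have rep: "represents q (k - 2 * r) (M' r) (P r)" if "2 * r + 1 \<le> k" for r
        using P that by simp
      have last: "?D r = 0" if r: "1 \<le> r" "2 * r + 1 = k" for r
      proof -
        have rep0: "represents q k H (P 0)" using P[of 0] by (simp add: M'_def)
        have k1: "k - 2 * r = 1" "k + 1 - (2 * r + 1) = 1" using r by simp_all
        have repr: "represents q 1 (M' r) (P r)" using rep[of r] r unfolding k1 by simp
        have "represents q (k + 1 - (2 * r + 1)) (M' r) (P r)" unfolding k1 by (rule repr)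
        then have inv: "invariant_points 2 (P r)"
          using r q_def M'm[of r]
          by (intro invariant_points_m_map[OF fin inj rep0 _ _ _ _ _ invariant_points_invariants[OF assms(2)
              rep0]]) auto
        have "M' r = 0"
          using q_def by (intro invariant_degree_1[OF fin inj repr inv]) auto
        then show ?thesis
          using D[of r] r by (simp add: clinear_zero[OF clinear_sym_map[OF clinear_at_minus_one]]
              clinear_zero[OF clinear_sym_tau] clinear_zero[OF clinear_vacuum_of])
      qed
      have "vacuum_of S = (\<Sum>r\<in>insert 0 ?R. ?D r)"
        unfolding S using finR by simp
      \<comment> \<open>The only index that may be added is \<open>2 * r + 1 = k\<close>, where
        \<open>M r\<close> is an invariant of degree 1 and hence zero.\<close>
      also have "\<dots> = (\<Sum>r | 2 * r + 1 \<le> k. ?D r)"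
      proof (rule sum.mono_neutral_left)
        show "finite {r. 2 * r + 1 \<le> k}" by (rule finite_subset[of _ "{..k}"]) auto
        show "insert 0 ?R \<subseteq> {r. 2 * r + 1 \<le> k}" unfolding R using False by auto
        show "\<forall>r\<in>{r. 2 * r + 1 \<le> k} - insert 0 ?R. ?D r = 0"
        proof
          fix r assume "r \<in> {r. 2 * r + 1 \<le> k} - insert 0 ?R"
          then have "1 \<le> r" "2 * r + 1 = k" unfolding R by auto
          then show "?D r = 0" by (rule last)
        qed
      qed
      finally have "apply_endo (vacuum_X (int m) x) (vacuum_of S) =
          (\<Sum>r | 2 * r + 1 \<le> k. lin_ext (\<lambda>y. apply_endo (vacuum_X (int m) x * D y ^ k) (vacuum_class 1)) (P r))"
        by (simp only: clinear_sum_distrib[OF clinear_apply_endo] XD)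
      also have "\<dots> = 0"
      proof (rule X_annihilates_sum[OF inj _ assms(2), where M = M' and q = q])
        show "0 < k" using False by simp
        show "M' 0 = H" by (simp add: M'_def)
        show "5 * k + 5 * m + 10 \<le> q" by (simp add: q_def)
      qed (use rep M'm in auto)
      finally show ?thesis .
    qed
  qed
qed

end
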